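(* Let $m\ge 2$. The map $\pi$ is injective when restricted to $\psi(\tilde{y}(m))$, and $\phi=\pi\circ\psi$. Hence $\psi$ is a trivial lifting of $\phi$, i.e. $\pi$ restricts to an isomorphism from $\psi(\tilde{y}(m))$ onto $\phi(\tilde{y}(m))$.
   Context: Conventions: $x^y=y^{-1}xy$, $[x,y]=x^{-1}y^{-1}xy$. $S_m$ is the symmetric group on $\{1,\dots,m\}$ and $s_i=(i,i+1)$. The group $y(m)=\langle a, S_m \mid [s_1,s_1^{a^k}]=1 \text{ for all } k\in\mathbb{Z},\ a^{s_i}=a^{-1} \text{ for } 2\le i\le m-1\rangle$ (quotient of the free product of $\langle a\rangle\cong\mathbb{Z}$ and $S_m$). $\tilde{y}(m)=y(m)\langle\tau\rangle$ is the semidirect product with an involution $\tau$ acting on $y(m)$ by inverting $a$ and centralising $S_m$. Put $\tilde{s}_i=\tau s_i$. $R=\mathbb{F}_2[s,s^{-1}]$ with $s$ an indeterminate, $t=s^2$. $V$ is the free $R$-module with basis $u,v_1,\dots,v_m$. The symplectic (alternating) bilinear form $(\cdot,\cdot)$ on $V$ is given by $(u,v_i)=(v_i,v_j)=1$ for all $i$ and all $j\neq i$, and $q$ is the quadratic form with associated bilinear form $(\cdot,\cdot)$ and $q(u)=1$, $q(v_1)=\dots=q(v_m)=t^{-1}$. $SO(V,q)=GO(V,q)$ is the group of $R$-module automorphisms of $V$ preserving $q$; maps act on the right, so products are composed left to right. For $w\in V$ with $q(w)$ invertible, $r_w(x)=x+\frac{(x,w)}{q(w)}w$. $Cl=Cl(V,q)$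 is the Clifford algebra, the quotient of the tensor algebra $T(V)$ by the ideal generated by the relations $w^2=q(w)$, $w\in V$; $V$ and $R$ are regarded as subsets of $Cl$. $x\mapsto\overline{x}$ is the anti-automorphism of $Cl$ reversing products of vectors. $C(V,q)=\{c\in Cl^\times : c^{-1}vc\in V \text{ for all } v\in V\}$, $Pin(V,q)=\{c\in C(V,q): c\overline{c}=1\}$, and $\pi:Pin(V,q)\to SO(V,q)$ is the homomorphism sending $c$ to the map $v\mapsto c^{-1}vc$. $\phi:\tilde{y}(m)\to SO(V,q)$ is the homomorphism with $\tau\mapsto r_u$, $a\mapsto r_ur_{v_1}$, $\tilde{s}_i\mapsto r_{v_i+v_{i+1}}$, and $\psi:\tilde{y}(m)\to Pin(V,q)$ is the homomorphism with $\tau\mapsto u$, $a\mapsto s\,uv_1$, $\tilde{s}_i\mapsto v_i+v_{i+1}$ (both are well-defined homomorphisms). *)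

theory Defs
  imports
    "HOL-Library.Poly_Mapping"
    "HOL-Library.Z2"
    "HOL-Algebra.Elementary_Groups"
    "HOL-Algebra.Sym_Groups"
    "HOL-Algebra.QuotRing"
begin

section \<open>Free products, normal closures, semidirect products\<close>

definition fp_letters :: "('a, 'c) monoid_scheme \<Rightarrow> ('b, 'd) monoid_scheme \<Rightarrow> ('a + 'b) set" where
  "fp_letters G H = carrier G <+> carrier H"

text \<open>The congruence on words over the disjoint union of two groups that is generated by
  multiplying adjacent letters of the same group and by deleting identity letters.\<close>

inductive fp_eq ::
    "('a, 'c) monoid_scheme \<Rightarrow> ('b, 'd) monoid_scheme \<Rightarrow> ('a + 'b) list \<Rightarrow> ('a + 'b) list \<Rightarrow> bool"
  for G H where
  refl: "w \<in> lists (fp_letters G H) \<Longrightarrow> fp_eq G H w w"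
| sym: "fp_eq G H w w' \<Longrightarrow> fp_eq G H w' w"
| trans: "fp_eq G H w w' \<Longrightarrow> fp_eq G H w' w'' \<Longrightarrow> fp_eq G H w w''"
| one_left: "xs \<in> lists (fp_letters G H) \<Longrightarrow> ys \<in> lists (fp_letters G H) \<Longrightarrow>
    fp_eq G H (xs @ [Inl \<one>\<^bsub>G\<^esub>] @ ys) (xs @ ys)"
| one_right: "xs \<in> lists (fp_letters G H) \<Longrightarrow> ys \<in> lists (fp_letters G H) \<Longrightarrow>
    fp_eq G H (xs @ [Inr \<one>\<^bsub>H\<^esub>] @ ys) (xs @ ys)"
| mult_left: "xs \<in> lists (fp_letters G H) \<Longrightarrow> ys \<in> lists (fp_letters G H) \<Longrightarrow>
    g \<in> carrier G \<Longrightarrow> g' \<in> carrier G \<Longrightarrow>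
    fp_eq G H (xs @ [Inl g, Inl g'] @ ys) (xs @ [Inl (g \<otimes>\<^bsub>G\<^esub> g')] @ ys)"
| mult_right: "xs \<in> lists (fp_letters G H) \<Longrightarrow> ys \<in> lists (fp_letters G H) \<Longrightarrow>
    h \<in> carrier H \<Longrightarrow> h' \<in> carrier H \<Longrightarrow>
    fp_eq G H (xs @ [Inr h, Inr h'] @ ys) (xs @ [Inr (h \<otimes>\<^bsub>H\<^esub> h')] @ ys)"

definition fp_class ::
    "('a, 'c) monoid_scheme \<Rightarrow> ('b, 'd) monoid_scheme \<Rightarrow> ('a + 'b) list \<Rightarrow> ('a + 'b) list set" where
  "fp_class G H w = {w'. fp_eq G H w w'}"

definition free_product ::
    "('a, 'c) monoid_scheme \<Rightarrow> ('b, 'd) monoid_scheme \<Rightarrow> ('a + 'b) list set monoid" where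
  "free_product G H =
    \<lparr> carrier = fp_class G H ` lists (fp_letters G H),
      monoid.mult = (\<lambda>A B. \<Union>x\<in>A. \<Union>y\<in>B. fp_class G H (x @ y)),
      one = fp_class G H [] \<rparr>"

definition normal_closure :: "('a, 'b) monoid_scheme \<Rightarrow> 'a set \<Rightarrow> 'a set" where
  "normal_closure G S = \<Inter> {N. N \<lhd> G \<and> S \<subseteq> N}"

definition semidirect_product ::
    "('a, 'c) monoid_scheme \<Rightarrow> ('b, 'd) monoid_scheme \<Rightarrow> ('b \<Rightarrow> 'a \<Rightarrow> 'a) \<Rightarrow> ('a \<times> 'b) monoid" where
  "semidirect_product G H \<alpha> =
    \<lparr> carrier = carrier G \<times> carrier H,
      monoid.mult = (\<lambda>(g, h) (g', h'). (g \<otimes>\<^bsub>G\<^esub> \<alpha> h g', h \<otimes>\<^bsub>H\<^esub> h')),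
      one = (\<one>\<^bsub>G\<^esub>, \<one>\<^bsub>H\<^esub>) \<rparr>"

definition conj_by :: "('a, 'b) monoid_scheme \<Rightarrow> 'a \<Rightarrow> 'a \<Rightarrow> 'a" where
  "conj_by G x y = inv\<^bsub>G\<^esub> y \<otimes>\<^bsub>G\<^esub> x \<otimes>\<^bsub>G\<^esub> y"

definition commutator :: "('a, 'b) monoid_scheme \<Rightarrow> 'a \<Rightarrow> 'a \<Rightarrow> 'a" where
  "commutator G x y = inv\<^bsub>G\<^esub> x \<otimes>\<^bsub>G\<^esub> inv\<^bsub>G\<^esub> y \<otimes>\<^bsub>G\<^esub> x \<otimes>\<^bsub>G\<^esub> y"


section \<open>The groups \<open>y(m)\<close> and \<open>y(m)\<langle>\<tau>\<rangle>\<close>\<close>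

text \<open>\<^const>\<open>sym_group\<close> composes permutations right to left. Inversion identifies it with the group
  composed left to right and fixes every \<open>s\<^sub>i\<close>, so the presentation is unaffected.\<close>

type_synonym y_word = "(int + (nat \<Rightarrow> nat)) list"

definition y_free :: "nat \<Rightarrow> y_word set monoid" where
  "y_free m = free_product integer_group (sym_group m)"

definition free_a :: "nat \<Rightarrow> y_word set" where
  "free_a m = fp_class integer_group (sym_group m) [Inl 1]"

definition free_s :: "nat \<Rightarrow> nat \<Rightarrow> y_word set" where
  "free_s m i = fp_class integer_group (sym_group m) [Inr (transpose i (i + 1))]"

text \<open>A relation \<open>x = y\<close> is encoded by the relator \<open>x y\<^sup>-\<^sup>1\<close>.\<close>

definition y_relators :: "nat \<Rightarrow> y_word set set" where
  "y_relators m =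
    {commutator (y_free m) (free_s m 1)
       (conj_by (y_free m) (free_s m 1) (free_a m [^]\<^bsub>y_free m\<^esub> k)) | k::int. True} \<union>
    {conj_by (y_free m) (free_a m) (free_s m i)
       \<otimes>\<^bsub>y_free m\<^esub> inv\<^bsub>y_free m\<^esub> (inv\<^bsub>y_free m\<^esub> (free_a m)) | i. 2 \<le> i \<and> i \<le> m - 1}"

definition y_kernel :: "nat \<Rightarrow> y_word set set" where
  "y_kernel m = normal_closure (y_free m) (y_relators m)"

definition y_group :: "nat \<Rightarrow> y_word set set monoid" where
  "y_group m = y_free m Mod y_kernel m"

text \<open>The automorphism of \<open>y(m)\<close> inverting \<open>a\<close> and centralising \<open>S\<^sub>m\<close> is induced by negating the
  integer letters of words. An element of \<open>y(m)\<close> is a set (coset) of sets (elements of the free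
  product) of words, hence the two images.\<close>

definition flip_word :: "y_word \<Rightarrow> y_word" where
  "flip_word = map (map_sum uminus id)"

definition y_flip :: "y_word set set \<Rightarrow> y_word set set" where
  "y_flip Q = (\<lambda>C. flip_word ` C) ` Q"

definition yt_group :: "nat \<Rightarrow> (y_word set set \<times> int) monoid" where
  "yt_group m =
    semidirect_product (y_group m) (integer_mod_group 2) (\<lambda>e. if e = 0 then id else y_flip)"

definition yt_tau :: "nat \<Rightarrow> y_word set set \<times> int" where
  "yt_tau m = (\<one>\<^bsub>y_group m\<^esub>, 1)"

definition yt_a :: "nat \<Rightarrow> y_word set set \<times> int" where
  "yt_a m = (y_kernel m #>\<^bsub>y_free m\<^esub> free_a m, 0)"

definition yt_s :: "nat \<Rightarrow> nat \<Rightarrow> y_word set set \<times> int" where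
  "yt_s m i = (y_kernel m #>\<^bsub>y_free m\<^esub> free_s m i, 0)"

definition yt_stilde :: "nat \<Rightarrow> nat \<Rightarrow> y_word set set \<times> int" where
  "yt_stilde m i = yt_tau m \<otimes>\<^bsub>yt_group m\<^esub> yt_s m i"


section \<open>Tensor and Clifford algebras\<close>

text \<open>Words under concatenation, written additively so that \<open>'a word \<Rightarrow>\<^sub>0 'r\<close> carries the
  (non-commutative) multiplication of the free associative algebra.\<close>

datatype 'a word = Word (letters: "'a list")

instantiation word :: (type) monoid_add
begin
definition zero_word :: "'a word" where "0 = Word []"
definition plus_word :: "'a word \<Rightarrow> 'a word \<Rightarrow> 'a word" where
  "x + y = Word (letters x @ letters y)"
instance by standard (simp_all add: zero_word_def plus_word_def)
end

definition free_algebra :: "'a set \<Rightarrow> ('a word \<Rightarrow>\<^sub>0 'r::comm_ring_1) ring" where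
  "free_algebra S =
    \<lparr> carrier = {p. \<forall>w \<in> Poly_Mapping.keys p. set (letters w) \<subseteq> S},
      monoid.mult = (*), one = 1, zero = 0, add = (+) \<rparr>"

abbreviation gen :: "'a \<Rightarrow> ('a word \<Rightarrow>\<^sub>0 'r::comm_ring_1)" where
  "gen v \<equiv> Poly_Mapping.single (Word [v]) 1"

abbreviation const :: "'r \<Rightarrow> ('a word \<Rightarrow>\<^sub>0 'r::comm_ring_1)" where
  "const r \<equiv> Poly_Mapping.single (Word []) r"

definition smul :: "'r \<Rightarrow> ('i \<Rightarrow>\<^sub>0 'r) \<Rightarrow> ('i \<Rightarrow>\<^sub>0 'r::comm_ring_1)" where
  "smul r = Poly_Mapping.map ((*) r)"

text \<open>Below, \<open>V\<close> is a submodule of some free module \<open>'i \<Rightarrow>\<^sub>0 'r\<close>. Its tensor algebra is the free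
  associative algebra on the set \<open>V\<close> modulo linearity of the generators.\<close>

type_synonym ('i, 'r) tensor = "(('i \<Rightarrow>\<^sub>0 'r) word \<Rightarrow>\<^sub>0 'r) set"
type_synonym ('i, 'r) cliff = "('i, 'r) tensor set"

definition tensor_ideal :: "('i \<Rightarrow>\<^sub>0 'r::comm_ring_1) set \<Rightarrow> ('i, 'r) tensor" where
  "tensor_ideal V = Idl\<^bsub>free_algebra V\<^esub>
    ({gen (v + w) - gen v - gen w | v w. v \<in> V \<and> w \<in> V} \<union>
     {gen (smul r v) - const r * gen v | r v. v \<in> V})"

definition tensor_algebra :: "('i \<Rightarrow>\<^sub>0 'r::comm_ring_1) set \<Rightarrow> ('i, 'r) tensor ring" where
  "tensor_algebra V = free_algebra V Quot tensor_ideal V"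

definition tensor_vec :: "('i \<Rightarrow>\<^sub>0 'r::comm_ring_1) set \<Rightarrow> ('i \<Rightarrow>\<^sub>0 'r) \<Rightarrow> ('i, 'r) tensor" where
  "tensor_vec V v = tensor_ideal V +>\<^bsub>free_algebra V\<^esub> gen v"

definition tensor_scalar :: "('i \<Rightarrow>\<^sub>0 'r::comm_ring_1) set \<Rightarrow> 'r \<Rightarrow> ('i, 'r) tensor" where
  "tensor_scalar V r = tensor_ideal V +>\<^bsub>free_algebra V\<^esub> const r"

definition clifford_ideal ::
    "('i \<Rightarrow>\<^sub>0 'r::comm_ring_1) set \<Rightarrow> (('i \<Rightarrow>\<^sub>0 'r) \<Rightarrow> 'r) \<Rightarrow> ('i, 'r) cliff" where
  "clifford_ideal V q = Idl\<^bsub>tensor_algebra V\<^esub>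
    {tensor_vec V w \<otimes>\<^bsub>tensor_algebra V\<^esub> tensor_vec V w
       \<ominus>\<^bsub>tensor_algebra V\<^esub> tensor_scalar V (q w) | w. w \<in> V}"

definition clifford ::
    "('i \<Rightarrow>\<^sub>0 'r::comm_ring_1) set \<Rightarrow> (('i \<Rightarrow>\<^sub>0 'r) \<Rightarrow> 'r) \<Rightarrow> ('i, 'r) cliff ring" where
  "clifford V q = tensor_algebra V Quot clifford_ideal V q"

definition cl_vec ::
    "('i \<Rightarrow>\<^sub>0 'r::comm_ring_1) set \<Rightarrow> (('i \<Rightarrow>\<^sub>0 'r) \<Rightarrow> 'r) \<Rightarrow> ('i \<Rightarrow>\<^sub>0 'r) \<Rightarrow> ('i, 'r) cliff" where
  "cl_vec V q v = clifford_ideal V q +>\<^bsub>tensor_algebra V\<^esub> tensor_vec V v"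

definition cl_scalar ::
    "('i \<Rightarrow>\<^sub>0 'r::comm_ring_1) set \<Rightarrow> (('i \<Rightarrow>\<^sub>0 'r) \<Rightarrow> 'r) \<Rightarrow> 'r \<Rightarrow> ('i, 'r) cliff" where
  "cl_scalar V q r = clifford_ideal V q +>\<^bsub>tensor_algebra V\<^esub> tensor_scalar V r"

text \<open>The reversal anti-automorphism, induced by reversing words in the free algebra (which
  preserves both families of relations). An element of the Clifford algebra is a coset of cosets,
  hence the two images.\<close>

definition rev_word :: "'a word \<Rightarrow> 'a word" where
  "rev_word w = Word (rev (letters w))"

definition cl_rev :: "('i, 'r::comm_ring_1) cliff \<Rightarrow> ('i, 'r) cliff" where
  "cl_rev Q = (\<lambda>C. Poly_Mapping.map_key rev_word ` C) ` Q"


section \<open>Orthogonal, Clifford and Pin groups\<close>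

text \<open>Maps act on the right: in a product of two maps, the first factor is applied first.\<close>

definition GO ::
    "('i \<Rightarrow>\<^sub>0 'r::comm_ring_1) set \<Rightarrow> (('i \<Rightarrow>\<^sub>0 'r) \<Rightarrow> 'r) \<Rightarrow> (('i \<Rightarrow>\<^sub>0 'r) \<Rightarrow> ('i \<Rightarrow>\<^sub>0 'r)) monoid" where
  "GO V q =
    \<lparr> carrier = {f \<in> extensional V. bij_betw f V V
        \<and> (\<forall>x\<in>V. \<forall>y\<in>V. f (x + y) = f x + f y)
        \<and> (\<forall>r. \<forall>x\<in>V. f (smul r x) = smul r (f x))
        \<and> (\<forall>x\<in>V. q (f x) = q x)},
      monoid.mult = (\<lambda>f g. compose V g f),
      one = (\<lambda>x\<in>V. x) \<rparr>"

abbreviation "SO \<equiv> GO"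

definition clifford_group ::
    "('i \<Rightarrow>\<^sub>0 'r::comm_ring_1) set \<Rightarrow> (('i \<Rightarrow>\<^sub>0 'r) \<Rightarrow> 'r) \<Rightarrow> ('i, 'r) cliff set" where
  "clifford_group V q =
    {c \<in> Units (clifford V q). \<forall>v\<in>V. conj_by (clifford V q) (cl_vec V q v) c \<in> cl_vec V q ` V}"

definition Pin ::
    "('i \<Rightarrow>\<^sub>0 'r::comm_ring_1) set \<Rightarrow> (('i \<Rightarrow>\<^sub>0 'r) \<Rightarrow> 'r) \<Rightarrow> ('i, 'r) cliff monoid" where
  "Pin V q =
    \<lparr> carrier = {c \<in> clifford_group V q. c \<otimes>\<^bsub>clifford V q\<^esub> cl_rev c = \<one>\<^bsub>clifford V q\<^esub>},
      monoid.mult = monoid.mult (clifford V q),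
      one = \<one>\<^bsub>clifford V q\<^esub> \<rparr>"

text \<open>\<open>c \<mapsto> (v \<mapsto> c\<^sup>-\<^sup>1 v c)\<close>, read back from the copy of \<open>V\<close> inside the Clifford algebra.\<close>

definition pin_map ::
    "('i \<Rightarrow>\<^sub>0 'r::comm_ring_1) set \<Rightarrow> (('i \<Rightarrow>\<^sub>0 'r) \<Rightarrow> 'r) \<Rightarrow> ('i, 'r) cliff \<Rightarrow> ('i \<Rightarrow>\<^sub>0 'r) \<Rightarrow> ('i \<Rightarrow>\<^sub>0 'r)" where
  "pin_map V q c =
    (\<lambda>v\<in>V. the_inv_into V (cl_vec V q) (conj_by (clifford V q) (cl_vec V q v) c))"

text \<open>Meaningful only when \<open>q w\<close> is invertible; the \<open>THE\<close> term is then its inverse.\<close>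

definition refl_map ::
    "('i \<Rightarrow>\<^sub>0 'r::comm_ring_1) set \<Rightarrow> (('i \<Rightarrow>\<^sub>0 'r) \<Rightarrow> 'r) \<Rightarrow> (('i \<Rightarrow>\<^sub>0 'r) \<Rightarrow> ('i \<Rightarrow>\<^sub>0 'r) \<Rightarrow> 'r)
      \<Rightarrow> ('i \<Rightarrow>\<^sub>0 'r) \<Rightarrow> ('i \<Rightarrow>\<^sub>0 'r) \<Rightarrow> ('i \<Rightarrow>\<^sub>0 'r)" where
  "refl_map V q b w = (\<lambda>x\<in>V. x + smul (b x w * (THE c. q w * c = 1)) w)"


section \<open>The quadratic space\<close>

text \<open>Laurent polynomials over the two-element field, as finitely supported functions on the
  exponents.\<close>

type_synonym laurent = "int \<Rightarrow>\<^sub>0 bit"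

definition s_var :: laurent where "s_var = Poly_Mapping.single 1 1"
definition s_inv :: laurent where "s_inv = Poly_Mapping.single (-1) 1"
definition t_var :: laurent where "t_var = s_var\<^sup>2"
definition t_inv :: laurent where "t_inv = s_inv\<^sup>2"

text \<open>Index \<open>0\<close> stands for \<open>u\<close> and index \<open>i \<ge> 1\<close> for \<open>v\<^sub>i\<close>.\<close>

type_synonym vec = "nat \<Rightarrow>\<^sub>0 laurent"

definition V_mod :: "nat \<Rightarrow> vec set" where
  "V_mod m = {x. Poly_Mapping.keys x \<subseteq> {0..m}}"

definition u_vec :: vec where "u_vec = Poly_Mapping.single 0 1"
definition v_vec :: "nat \<Rightarrow> vec" where "v_vec i = Poly_Mapping.single i 1"

abbreviation coord :: "vec \<Rightarrow> nat \<Rightarrow> laurent" where "coord \<equiv> Poly_Mapping.lookup"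

definition bform :: "nat \<Rightarrow> vec \<Rightarrow> vec \<Rightarrow> laurent" where
  "bform m x y = (\<Sum>i\<le>m. \<Sum>j\<in>{..m} - {i}. coord x i * coord y j)"

definition qform :: "nat \<Rightarrow> vec \<Rightarrow> laurent" where
  "qform m x = (coord x 0)\<^sup>2 + (\<Sum>i=1..m. t_inv * (coord x i)\<^sup>2)
     + (\<Sum>j\<le>m. \<Sum>i<j. coord x i * coord x j)"

section \<open>Well-definedness of the constructions\<close>

subsection \<open>Free and semidirect products\<close>

lemma fp_letters_group:
  assumes "group G" "group H"
  shows "Inl \<one>\<^bsub>G\<^esub> \<in> fp_letters G H" "Inr \<one>\<^bsub>H\<^esub> \<in> fp_letters G H"
    "g \<in> carrier G \<Longrightarrow> Inl g \<in> fp_letters G H" "h \<in> carrier H \<Longrightarrow> Inr h \<in> fp_letters G H"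
  using assms by (auto simp: fp_letters_def group.is_monoid)

lemma fp_eq_lists:
  assumes "group G" "group H" "fp_eq G H w w'"
  shows "w \<in> lists (fp_letters G H) \<and> w' \<in> lists (fp_letters G H)"
  using assms(3)
proof induction
  case (mult_left xs ys g g')
  then have "g \<otimes>\<^bsub>G\<^esub> g' \<in> carrier G" using assms by (simp add: group.is_monoid monoid.m_closed)
  then show ?case using mult_left fp_letters_group[OF assms(1,2)] by auto
next
  case (mult_right xs ys g g')
  then have "g \<otimes>\<^bsub>H\<^esub> g' \<in> carrier H" using assms by (simp add: group.is_monoid monoid.m_closed)
  then show ?case using mult_right fp_letters_group[OF assms(1,2)] by auto
qed (use fp_letters_group[OF assms(1,2)] in auto)

lemma fp_eq_context:
  assumes "fp_eq G H w w'" "as \<in> lists (fp_letters G H)" "bs \<in> lists (fp_letters G H)"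
  shows "fp_eq G H (as @ w @ bs) (as @ w' @ bs)"
  using assms(1)
proof induction
  case (refl w) then show ?case using assms by (intro fp_eq.refl) auto
next
  case (sym w w') then show ?case by (blast intro: fp_eq.sym)
next
  case (trans w w' w'') then show ?case by (blast intro: fp_eq.trans)
next
  case (one_left xs ys)
  then show ?case using fp_eq.one_left[of "as @ xs" G H "ys @ bs"] assms by simp
next
  case (one_right xs ys)
  then show ?case using fp_eq.one_right[of "as @ xs" G H "ys @ bs"] assms by simp
next
  case (mult_left xs ys g g')
  then show ?case using fp_eq.mult_left[of "as @ xs" G H "ys @ bs" g g'] assms by simp
next
  case (mult_right xs ys g g')
  then show ?case using fp_eq.mult_right[of "as @ xs" G H "ys @ bs" g g'] assms by simp
qed

lemma fp_class_eq_iff: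
  assumes "w \<in> lists (fp_letters G H)"
  shows "fp_class G H w = fp_class G H w' \<longleftrightarrow> fp_eq G H w w'"
  using assms unfolding fp_class_def by (blast intro: fp_eq.refl fp_eq.sym fp_eq.trans)

lemma fp_eq_append:
  assumes "group G" "group H" "fp_eq G H x x'" "fp_eq G H y y'"
  shows "fp_eq G H (x @ y) (x' @ y')"
proof -
  have "fp_eq G H (x @ y) (x' @ y)"
    using fp_eq_context[OF assms(3), of "[]" y] fp_eq_lists[OF assms(1,2,4)] by simp
  moreover have "fp_eq G H (x' @ y) (x' @ y')"
    using fp_eq_context[OF assms(4), of x' "[]"] fp_eq_lists[OF assms(1,2,3)] by simp
  ultimately show ?thesis by (rule fp_eq.trans)
qed

lemma free_product_mult:
  assumes "group G" "group H" "x \<in> lists (fp_letters G H)" "y \<in> lists (fp_letters G H)"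
  shows "fp_class G H x \<otimes>\<^bsub>free_product G H\<^esub> fp_class G H y = fp_class G H (x @ y)"
proof -
  have "fp_class G H (x' @ y') = fp_class G H (x @ y)"
    if "x' \<in> fp_class G H x" "y' \<in> fp_class G H y" for x' y'
  proof -
    have "fp_eq G H (x @ y) (x' @ y')"
      using that fp_eq_append[OF assms(1,2)] by (simp add: fp_class_def)
    then show ?thesis
      using fp_class_eq_iff[of "x @ y" G H "x' @ y'"] fp_eq_lists[OF assms(1,2)] by blast
  qed
  moreover have "x \<in> fp_class G H x" "y \<in> fp_class G H y"
    using assms by (simp_all add: fp_class_def fp_eq.refl del: in_lists_conv_set)
  ultimately have "(\<Union>x'\<in>fp_class G H x. \<Union>y'\<in>fp_class G H y. fp_class G H (x' @ y'))
      = fp_class G H (x @ y)" by blast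
  then show ?thesis by (simp add: free_product_def)
qed

lemma free_product_letter_inverse:
  assumes "group G" "group H" "l \<in> fp_letters G H"
  shows "\<exists>l' \<in> fp_letters G H. fp_eq G H [l', l] []"
proof (cases l)
  case (Inl g)
  then have g: "g \<in> carrier G" using assms by (auto simp: fp_letters_def)
  have "fp_eq G H [Inl (inv\<^bsub>G\<^esub> g), Inl g] [Inl \<one>\<^bsub>G\<^esub>]"
    using fp_eq.mult_left[of "[]" G H "[]" "inv\<^bsub>G\<^esub> g" g] g assms by (simp add: group.l_inv)
  also have "fp_eq G H [Inl \<one>\<^bsub>G\<^esub>] []"
    using fp_eq.one_left[of "[]" G H "[]"] by simp
  finally (fp_eq.trans) show ?thesis using Inl g assms fp_letters_group(3)[OF assms(1,2)] by auto
next
  case (Inr g)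
  then have g: "g \<in> carrier H" using assms by (auto simp: fp_letters_def)
  have "fp_eq G H [Inr (inv\<^bsub>H\<^esub> g), Inr g] [Inr \<one>\<^bsub>H\<^esub>]"
    using fp_eq.mult_right[of "[]" G H "[]" "inv\<^bsub>H\<^esub> g" g] g assms by (simp add: group.l_inv)
  also have "fp_eq G H [Inr \<one>\<^bsub>H\<^esub>] []"
    using fp_eq.one_right[of "[]" G H "[]"] by simp
  finally (fp_eq.trans) show ?thesis using Inr g assms fp_letters_group(4)[OF assms(1,2)] by auto
qed

lemma free_product_word_inverse:
  assumes "group G" "group H" "w \<in> lists (fp_letters G H)"
  shows "\<exists>w' \<in> lists (fp_letters G H). fp_eq G H (w' @ w) []"
  using assms(3)
proof induction
  case Nil
  then show ?case by (auto intro!: bexI[of _ "[]"] fp_eq.refl)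
next
  case (Cons l w)
  obtain l' where l': "l' \<in> fp_letters G H" "fp_eq G H [l', l] []"
    using free_product_letter_inverse[OF assms(1,2) Cons(1)] by blast
  obtain w' where w': "w' \<in> lists (fp_letters G H)" "fp_eq G H (w' @ w) []" using Cons by blast
  have "fp_eq G H (w' @ [l', l] @ w) (w' @ [] @ w)"
    using fp_eq_context[OF l'(2)] w' Cons by blast
  then have "fp_eq G H ((w' @ [l']) @ l # w) []" using w'(2) by (auto intro: fp_eq.trans)
  then show ?case using w' l' by (intro bexI[of _ "w' @ [l']"]) auto
qed

lemma free_product_group:
  assumes "group G" "group H"
  shows "group (free_product G H)"
proof (rule groupI)
  note m = free_product_mult[OF assms]
  have c: "carrier (free_product G H) = fp_class G H ` lists (fp_letters G H)"
    and o: "\<one>\<^bsub>free_product G H\<^esub> = fp_class G H []" by (simp_all add: free_product_def)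
  show "\<one>\<^bsub>free_product G H\<^esub> \<in> carrier (free_product G H)" by (auto simp: c o)
  have ap: "v @ w \<in> lists (fp_letters G H)"
    if "v \<in> lists (fp_letters G H)" "w \<in> lists (fp_letters G H)" for v w
    using that by simp
  fix x assume "x \<in> carrier (free_product G H)"
  then obtain u where u: "u \<in> lists (fp_letters G H)" "x = fp_class G H u"
    unfolding c by blast
  show "\<one>\<^bsub>free_product G H\<^esub> \<otimes>\<^bsub>free_product G H\<^esub> x = x"
    using m[of "[]" u] u by (simp add: o)
  obtain u' where u': "u' \<in> lists (fp_letters G H)" "fp_eq G H (u' @ u) []"
    using free_product_word_inverse[OF assms u(1)] by blast
  have "fp_class G H u' \<otimes>\<^bsub>free_product G H\<^esub> x = fp_class G H []"
    using u' fp_class_eq_iff[OF ap[OF u'(1) u(1)]] by (simp only: u(2) m[OF u'(1) u(1)])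
  then show "\<exists>y\<in>carrier (free_product G H). y \<otimes>\<^bsub>free_product G H\<^esub> x = \<one>\<^bsub>free_product G H\<^esub>"
    using u' unfolding c o by blast
  fix y assume "y \<in> carrier (free_product G H)"
  then obtain v where v: "v \<in> lists (fp_letters G H)" "y = fp_class G H v"
    unfolding c by blast
  show "x \<otimes>\<^bsub>free_product G H\<^esub> y \<in> carrier (free_product G H)"
    unfolding u(2) v(2) m[OF u(1) v(1)] c by (rule imageI[OF ap[OF u(1) v(1)]])
  fix z assume "z \<in> carrier (free_product G H)"
  then obtain w where w: "w \<in> lists (fp_letters G H)" "z = fp_class G H w"
    unfolding c by blast
  show "x \<otimes>\<^bsub>free_product G H\<^esub> y \<otimes>\<^bsub>free_product G H\<^esub> z
      = x \<otimes>\<^bsub>free_product G H\<^esub> (y \<otimes>\<^bsub>free_product G H\<^esub> z)"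
    by (simp only: u(2) v(2) w(2) m ap u(1) v(1) w(1) append_assoc)
qed

lemma (in group) normal_closure_normal:
  assumes "S \<subseteq> carrier G"
  shows "normal_closure G S \<lhd> G"
proof -
  have c: "carrier G \<lhd> G" by (simp add: normal_inv_iff subgroup_self)
  have "subgroup (normal_closure G S) G" unfolding normal_closure_def
    by (rule subgroups_Inter) (use c assms in \<open>auto simp: normal_imp_subgroup\<close>)
  then show ?thesis
    unfolding normal_inv_iff by (auto simp: normal_closure_def dest: normal.inv_op_closed2)
qed

lemma normal_closure_incl: "S \<subseteq> normal_closure G S"
  by (auto simp: normal_closure_def)

lemma normal_closure_minimal: "N \<lhd> G \<Longrightarrow> S \<subseteq> N \<Longrightarrow> normal_closure G S \<subseteq> N"
  by (auto simp: normal_closure_def)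

lemma semidirect_product_group:
  assumes "group G" "group H"
    and hom: "\<And>h. h \<in> carrier H \<Longrightarrow> \<alpha> h \<in> hom G G"
    and one: "\<And>g. g \<in> carrier G \<Longrightarrow> \<alpha> \<one>\<^bsub>H\<^esub> g = g"
    and mult: "\<And>h h' g. h \<in> carrier H \<Longrightarrow> h' \<in> carrier H \<Longrightarrow> g \<in> carrier G \<Longrightarrow>
      \<alpha> (h \<otimes>\<^bsub>H\<^esub> h') g = \<alpha> h (\<alpha> h' g)"
  shows "group (semidirect_product G H \<alpha>)"
proof -
  interpret G: group G by fact
  interpret H: group H by fact
  have cl: "\<alpha> h g \<in> carrier G" if "h \<in> carrier H" "g \<in> carrier G" for h g
    using hom that by (auto simp: hom_def)
  have hm: "\<alpha> h (g \<otimes>\<^bsub>G\<^esub> g') = \<alpha> h g \<otimes>\<^bsub>G\<^esub> \<alpha> h g'"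
    if "h \<in> carrier H" "g \<in> carrier G" "g' \<in> carrier G" for h g g'
    using hom that by (auto simp: hom_def)
  show ?thesis
  proof (rule groupI)
    show "\<exists>y\<in>carrier (semidirect_product G H \<alpha>).
        y \<otimes>\<^bsub>semidirect_product G H \<alpha>\<^esub> x = \<one>\<^bsub>semidirect_product G H \<alpha>\<^esub>"
      if x0: "x \<in> carrier (semidirect_product G H \<alpha>)" for x
    proof -
      obtain g h where x: "x = (g, h)" "g \<in> carrier G" "h \<in> carrier H"
        using x0 by (cases x) (auto simp: semidirect_product_def)
      show ?thesis
        by (rule bexI[of _ "(inv\<^bsub>G\<^esub> (\<alpha> (inv\<^bsub>H\<^esub> h) g), inv\<^bsub>H\<^esub> h)"])
          (use x cl in \<open>auto simp: semidirect_product_def\<close>)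
    qed
  qed (auto simp: semidirect_product_def cl hm one mult G.m_assoc H.m_assoc)
qed

subsection \<open>The flip of \<open>y(m)\<close>\<close>

lemma y_free_group: "group (y_free m)"
  unfolding y_free_def by (intro free_product_group group_integer_group sym_group_is_group)

lemma free_a_carrier: "free_a m \<in> carrier (y_free m)"
  by (auto simp: free_a_def y_free_def free_product_def fp_letters_def integer_group_def intro!: imageI)

lemma free_s_carrier: "1 \<le> i \<Longrightarrow> i + 1 \<le> m \<Longrightarrow> free_s m i \<in> carrier (y_free m)"
  by (auto simp: free_s_def y_free_def free_product_def fp_letters_def sym_group_def
      intro!: imageI permutes_swap_id)

lemma y_relators_carrier:
  assumes "m \<ge> 2"
  shows "y_relators m \<subseteq> carrier (y_free m)"
proof -
  interpret F: group "y_free m" by (rule y_free_group)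
  show ?thesis using assms free_a_carrier free_s_carrier
    by (auto simp: y_relators_def commutator_def conj_by_def)
qed

lemma y_kernel_normal: "m \<ge> 2 \<Longrightarrow> y_kernel m \<lhd> y_free m"
  unfolding y_kernel_def
  by (intro group.normal_closure_normal y_free_group y_relators_carrier)

lemma y_group_group: "m \<ge> 2 \<Longrightarrow> group (y_group m)"
  unfolding y_group_def by (intro normal.factorgroup_is_group y_kernel_normal)

lemma flip_word_flip_word: "flip_word (flip_word w) = w"
proof -
  have "map_sum uminus id (map_sum uminus id x) = x" for x :: "int + (nat \<Rightarrow> nat)"
    by (cases x) simp_all
  then show ?thesis by (simp add: flip_word_def o_def)
qed

lemma flip_word_lists:
  "flip_word w \<in> lists (fp_letters integer_group (sym_group m)) \<longleftrightarrow>
    w \<in> lists (fp_letters integer_group (sym_group m))"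
proof -
  have "map_sum uminus id x \<in> fp_letters integer_group (sym_group m) \<longleftrightarrow>
      x \<in> fp_letters integer_group (sym_group m)" for x :: "int + (nat \<Rightarrow> nat)"
    by (cases x) (auto simp: fp_letters_def integer_group_def)
  then show ?thesis by (auto simp: flip_word_def)
qed

lemma fp_eq_flip:
  "fp_eq integer_group (sym_group m) w w' \<Longrightarrow>
    fp_eq integer_group (sym_group m) (flip_word w) (flip_word w')"
proof (induction rule: fp_eq.induct)
  case (refl w)
  then show ?case by (intro fp_eq.refl) (simp only: flip_word_lists)
next
  case (one_left xs ys)
  then show ?case
    using fp_eq.one_left[of "flip_word xs" integer_group "sym_group m" "flip_word ys"]
    by (simp add: flip_word_lists) (simp add: flip_word_def)
next
  case (one_right xs ys)
  then show ?case
    using fp_eq.one_right[of "flip_word xs" integer_group "sym_group m" "flip_word ys"]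
    by (simp add: flip_word_lists) (simp add: flip_word_def)
next
  case (mult_left xs ys g g')
  then show ?case
    using fp_eq.mult_left[of "flip_word xs" integer_group "sym_group m" "flip_word ys" "-g" "-g'"]
    by (simp add: flip_word_lists) (simp add: flip_word_def)
next
  case (mult_right xs ys g g')
  then show ?case
    using fp_eq.mult_right[of "flip_word xs" integer_group "sym_group m" "flip_word ys" g g']
    by (simp add: flip_word_lists) (simp add: flip_word_def)
qed (auto simp: flip_word_lists intro: fp_eq.intros)

lemma flip_class:
  "flip_word ` fp_class integer_group (sym_group m) w = fp_class integer_group (sym_group m) (flip_word w)"
proof -
  have "w' \<in> flip_word ` fp_class integer_group (sym_group m) w"
    if "fp_eq integer_group (sym_group m) (flip_word w) w'" for w'
    using fp_eq_flip[OF that] flip_word_flip_word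
    by (auto simp: fp_class_def intro!: image_eqI[of _ _ "flip_word w'"])
  then show ?thesis by (auto simp: fp_class_def intro: fp_eq_flip)
qed



lemma y_free_carrier: "carrier (y_free m) =
    fp_class integer_group (sym_group m) ` lists (fp_letters integer_group (sym_group m))"
  by (simp add: y_free_def free_product_def)

lemma y_free_mult:
  assumes "x \<in> lists (fp_letters integer_group (sym_group m))"
    "y \<in> lists (fp_letters integer_group (sym_group m))"
  shows "fp_class integer_group (sym_group m) x \<otimes>\<^bsub>y_free m\<^esub> fp_class integer_group (sym_group m) y
    = fp_class integer_group (sym_group m) (x @ y)"
  unfolding y_free_def
  by (rule free_product_mult[OF group_integer_group sym_group_is_group assms])

lemma flip_class_hom: "(`) flip_word \<in> hom (y_free m) (y_free m)"
proof (rule homI)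
  fix x y assume "x \<in> carrier (y_free m)" "y \<in> carrier (y_free m)"
  then obtain v w where vw: "x = fp_class integer_group (sym_group m) v"
      "y = fp_class integer_group (sym_group m) w"
      "v \<in> lists (fp_letters integer_group (sym_group m))"
      "w \<in> lists (fp_letters integer_group (sym_group m))"
    unfolding y_free_carrier by blast
  show "flip_word ` x \<in> carrier (y_free m)"
    using vw unfolding y_free_carrier flip_class[of m v] vw(1) flip_word_lists[symmetric, of v] by blast
  have "flip_word (v @ w) = flip_word v @ flip_word w" by (simp add: flip_word_def)
  then show "flip_word ` (x \<otimes>\<^bsub>y_free m\<^esub> y) = flip_word ` x \<otimes>\<^bsub>y_free m\<^esub> flip_word ` y"
    by (simp only: vw flip_class y_free_mult flip_word_lists)
qed

lemma flip_image_image: "flip_word ` flip_word ` A = A"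
  by (simp add: image_image flip_word_flip_word)

lemma flip_free_a: "flip_word ` free_a m = inv\<^bsub>y_free m\<^esub> free_a m"
proof -
  interpret F: group "y_free m" by (rule y_free_group)
  have l: "[Inl 1] \<in> lists (fp_letters integer_group (sym_group m))"
    "[Inl (-1)] \<in> lists (fp_letters integer_group (sym_group m))"
    by (auto simp: fp_letters_def)
  have f: "flip_word ` free_a m = fp_class integer_group (sym_group m) [Inl (-1)]"
    unfolding free_a_def flip_class by (simp add: flip_word_def)
  have "fp_eq integer_group (sym_group m) [Inl (-1), Inl 1] [Inl 0]"
    using fp_eq.mult_left[of "[]" integer_group "sym_group m" "[]" "-1" 1] by simp
  moreover have "fp_eq integer_group (sym_group m) [Inl 0] []"
    using fp_eq.one_left[of "[]" integer_group "sym_group m" "[]"] by simp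
  ultimately have e: "fp_eq integer_group (sym_group m) ([Inl (-1)] @ [Inl 1]) []"
    by (auto intro: fp_eq.trans)
  have "[Inl (-1)] @ [Inl 1] \<in> lists (fp_letters integer_group (sym_group m))"
    using l by simp
  then have "fp_class integer_group (sym_group m) ([Inl (-1)] @ [Inl 1])
      = fp_class integer_group (sym_group m) []"
    using e fp_class_eq_iff by blast
  then have "flip_word ` free_a m \<otimes>\<^bsub>y_free m\<^esub> free_a m = \<one>\<^bsub>y_free m\<^esub>"
    unfolding f unfolding free_a_def y_free_mult[OF l(2,1)]
    by (simp add: y_free_def free_product_def)
  then show ?thesis
    using F.inv_equality free_a_carrier flip_class_hom[of m, THEN hom_in_carrier] by metis
qed

lemma flip_free_s: "flip_word ` free_s m i = free_s m i"
  unfolding free_s_def flip_class by (simp add: flip_word_def)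

lemma flip_relators:
  assumes "m \<ge> 2"
  shows "(`) flip_word ` y_relators m \<subseteq> y_kernel m"
proof
  interpret F: group "y_free m" by (rule y_free_group)
  interpret h: group_hom "y_free m" "y_free m" "(`) flip_word"
    by unfold_locales (rule flip_class_hom)
  interpret N: normal "y_kernel m" "y_free m" using assms by (rule y_kernel_normal)
  note a = free_a_carrier[of m] and s = free_s_carrier
  fix x assume "x \<in> (`) flip_word ` y_relators m"
  then consider (1) k :: int where "x = flip_word ` commutator (y_free m) (free_s m 1)
       (conj_by (y_free m) (free_s m 1) (free_a m [^]\<^bsub>y_free m\<^esub> k))"
    | (2) i where "2 \<le> i" "i \<le> m - 1" "x = flip_word ` (conj_by (y_free m) (free_a m) (free_s m i)
       \<otimes>\<^bsub>y_free m\<^esub> inv\<^bsub>y_free m\<^esub> (inv\<^bsub>y_free m\<^esub> (free_a m)))"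
    unfolding y_relators_def by blast
  then show "x \<in> y_kernel m"
  proof cases
    case 1
    have s1: "free_s m 1 \<in> carrier (y_free m)" using assms by (intro s) auto
    have "flip_word ` (free_a m [^]\<^bsub>y_free m\<^esub> k) = free_a m [^]\<^bsub>y_free m\<^esub> (-k)"
      using h.hom_int_pow[OF a, of k] a by (simp add: flip_free_a F.int_pow_inv F.int_pow_neg)
    then have "x = commutator (y_free m) (free_s m 1)
       (conj_by (y_free m) (free_s m 1) (free_a m [^]\<^bsub>y_free m\<^esub> (-k)))"
      using s1 a unfolding 1 commutator_def conj_by_def
      by (simp only: h.hom_mult h.hom_inv flip_free_s F.m_closed F.inv_closed F.int_pow_closed)
    then have "x \<in> y_relators m" unfolding y_relators_def by blast
    then show ?thesis unfolding y_kernel_def by (rule subsetD[OF normal_closure_incl])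
  next
    case (2 i)
    let ?r = "conj_by (y_free m) (free_a m) (free_s m i)
       \<otimes>\<^bsub>y_free m\<^esub> inv\<^bsub>y_free m\<^esub> (inv\<^bsub>y_free m\<^esub> (free_a m))"
    have s1: "free_s m i \<in> carrier (y_free m)" using 2 by (intro s) auto
    have "?r \<in> y_relators m" using 2 unfolding y_relators_def by blast
    then have r: "?r \<in> y_kernel m" unfolding y_kernel_def by (rule subsetD[OF normal_closure_incl])
    have "inv\<^bsub>y_free m\<^esub> (free_a m \<otimes>\<^bsub>y_free m\<^esub> ?r \<otimes>\<^bsub>y_free m\<^esub> inv\<^bsub>y_free m\<^esub> free_a m) \<in> y_kernel m"
      using N.inv_op_closed2[OF a r] by simp
    also have "inv\<^bsub>y_free m\<^esub> (free_a m \<otimes>\<^bsub>y_free m\<^esub> ?r \<otimes>\<^bsub>y_free m\<^esub> inv\<^bsub>y_free m\<^esub> free_a m) =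
        conj_by (y_free m) (inv\<^bsub>y_free m\<^esub> free_a m) (free_s m i) \<otimes>\<^bsub>y_free m\<^esub> inv\<^bsub>y_free m\<^esub> free_a m"
      using s1 a by (simp add: conj_by_def F.m_assoc F.inv_mult_group)
    also have "\<dots> = x"
      using s1 a unfolding 2 conj_by_def
      by (simp add: flip_free_s flip_free_a)
    finally show ?thesis .
  qed
qed

lemma flip_kernel:
  assumes "m \<ge> 2"
  shows "(`) flip_word ` y_kernel m = y_kernel m"
proof -
  interpret F: group "y_free m" by (rule y_free_group)
  interpret h: group_hom "y_free m" "y_free m" "(`) flip_word"
    by unfold_locales (rule flip_class_hom)
  interpret N: normal "y_kernel m" "y_free m" using assms by (rule y_kernel_normal)
  let ?P = "{x \<in> carrier (y_free m). flip_word ` x \<in> y_kernel m}"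
  have "subgroup ?P (y_free m)"
    by unfold_locales auto
  then have "?P \<lhd> y_free m"
    by (auto simp: F.normal_inv_iff N.inv_op_closed2)
  moreover have "y_relators m \<subseteq> ?P" using flip_relators[OF assms] y_relators_carrier[OF assms] by auto
  ultimately have P: "y_kernel m \<subseteq> ?P" unfolding y_kernel_def by (rule normal_closure_minimal)
  have "x \<in> (`) flip_word ` y_kernel m" if "x \<in> y_kernel m" for x
    by (rule image_eqI[where x="flip_word ` x"]) (use P that flip_image_image[of x] in blast)+
  then show ?thesis using P by blast
qed

lemma y_flip_coset:
  assumes "m \<ge> 2" "x \<in> carrier (y_free m)"
  shows "y_flip (y_kernel m #>\<^bsub>y_free m\<^esub> x) = y_kernel m #>\<^bsub>y_free m\<^esub> flip_word ` x"
proof -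
  interpret N: normal "y_kernel m" "y_free m" using assms(1) by (rule y_kernel_normal)
  have "y_flip (y_kernel m #>\<^bsub>y_free m\<^esub> x) = (\<lambda>n. flip_word ` (n \<otimes>\<^bsub>y_free m\<^esub> x)) ` y_kernel m"
    by (simp add: y_flip_def r_coset_def UNION_singleton_eq_range image_image)
  also have "\<dots> = (\<lambda>n. flip_word ` n \<otimes>\<^bsub>y_free m\<^esub> flip_word ` x) ` y_kernel m"
    by (rule image_cong[OF HOL.refl]) (simp add: hom_mult[OF flip_class_hom] assms)
  also have "\<dots> = (\<lambda>n. n \<otimes>\<^bsub>y_free m\<^esub> flip_word ` x) ` ((`) flip_word ` y_kernel m)"
    by (simp add: image_image)
  also have "\<dots> = y_kernel m #>\<^bsub>y_free m\<^esub> flip_word ` x"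
    unfolding flip_kernel[OF assms(1)] by (simp add: r_coset_def UNION_singleton_eq_range)
  finally show ?thesis .
qed

lemma y_flip_hom:
  assumes "m \<ge> 2"
  shows "y_flip \<in> hom (y_group m) (y_group m)"
proof -
  interpret N: normal "y_kernel m" "y_free m" using assms by (rule y_kernel_normal)
  show ?thesis
  proof (rule homI)
    fix x y assume "x \<in> carrier (y_group m)" "y \<in> carrier (y_group m)"
    then obtain v w where vw: "v \<in> carrier (y_free m)" "x = y_kernel m #>\<^bsub>y_free m\<^esub> v"
        "w \<in> carrier (y_free m)" "y = y_kernel m #>\<^bsub>y_free m\<^esub> w"
      by (auto simp: y_group_def FactGroup_def RCOSETS_def)
    have f: "flip_word ` v \<in> carrier (y_free m)" "flip_word ` w \<in> carrier (y_free m)"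
      using vw by (auto intro: hom_in_carrier[OF flip_class_hom])
    show "y_flip x \<in> carrier (y_group m)"
      using vw f by (auto simp: y_flip_coset assms y_group_def FactGroup_def RCOSETS_def)
    show "y_flip (x \<otimes>\<^bsub>y_group m\<^esub> y) = y_flip x \<otimes>\<^bsub>y_group m\<^esub> y_flip y"
      using vw f by (simp add: y_group_def FactGroup_def N.rcos_sum y_flip_coset assms
          hom_mult[OF flip_class_hom])
  qed
qed

lemma y_flip_y_flip: "y_flip (y_flip Q) = Q"
  by (simp add: y_flip_def image_image flip_word_flip_word)

lemma y_flip_a:
  assumes "m \<ge> 2"
  shows "y_flip (y_kernel m #>\<^bsub>y_free m\<^esub> free_a m) = inv\<^bsub>y_group m\<^esub> (y_kernel m #>\<^bsub>y_free m\<^esub> free_a m)"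
proof -
  interpret N: normal "y_kernel m" "y_free m" using assms by (rule y_kernel_normal)
  show ?thesis using assms free_a_carrier N.inv_FactGroup[of "y_kernel m #>\<^bsub>y_free m\<^esub> free_a m"]
    by (auto simp: y_flip_coset flip_free_a y_group_def N.rcos_inv FactGroup_def RCOSETS_def)
qed

lemma y_flip_s:
  assumes "1 \<le> i" "i + 1 \<le> m"
  shows "y_flip (y_kernel m #>\<^bsub>y_free m\<^esub> free_s m i) = y_kernel m #>\<^bsub>y_free m\<^esub> free_s m i"
  using assms by (simp add: y_flip_coset flip_free_s free_s_carrier)

lemma yt_group_group:
  assumes "m \<ge> 2"
  shows "group (yt_group m)"
  unfolding yt_group_def
proof (rule semidirect_product_group[OF y_group_group[OF assms]])
  fix h h' g assume "h \<in> carrier (integer_mod_group 2)" "h' \<in> carrier (integer_mod_group 2)"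
  then have "h = 0 \<or> h = 1" "h' = 0 \<or> h' = 1" by (auto simp: carrier_integer_mod_group)
  then show "(if h \<otimes>\<^bsub>integer_mod_group 2\<^esub> h' = 0 then id else y_flip) g
      = (if h = 0 then id else y_flip) ((if h' = 0 then id else y_flip) g)"
    by (auto simp: mult_integer_mod_group y_flip_y_flip)
next
  show "(if h = 0 then id else y_flip) \<in> hom (y_group m) (y_group m)" for h
    using y_flip_hom[OF assms] by (auto simp: hom_def)
qed simp_all

subsection \<open>The Clifford algebra and its reversal\<close>

lemma free_algebra_ring: "ring (free_algebra S :: ('a word \<Rightarrow>\<^sub>0 'r::comm_ring_1) ring)"
proof (rule ringI)
  show "abelian_group (free_algebra S :: ('a word \<Rightarrow>\<^sub>0 'r) ring)"
  proof (rule abelian_groupI)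
    fix x assume "x \<in> carrier (free_algebra S :: ('a word \<Rightarrow>\<^sub>0 'r) ring)"
    then show "\<exists>y\<in>carrier (free_algebra S). y \<oplus>\<^bsub>free_algebra S\<^esub> x = \<zero>\<^bsub>free_algebra S\<^esub>"
      by (intro bexI[of _ "- x"]) (auto simp: free_algebra_def in_keys_iff)
  qed (auto simp: free_algebra_def add_ac dest!: subsetD[OF Poly_Mapping.keys_add])
  show "Group.monoid (free_algebra S :: ('a word \<Rightarrow>\<^sub>0 'r) ring)"
  proof (rule monoidI)
    fix x y assume "x \<in> carrier (free_algebra S :: ('a word \<Rightarrow>\<^sub>0 'r) ring)"
      "y \<in> carrier (free_algebra S :: ('a word \<Rightarrow>\<^sub>0 'r) ring)"
    then show "x \<otimes>\<^bsub>free_algebra S\<^esub> y \<in> carrier (free_algebra S)"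
      by (fastforce simp: free_algebra_def plus_word_def dest!: subsetD[OF keys_mult])
  qed (auto simp: free_algebra_def mult.assoc zero_word_def)
qed (simp_all add: free_algebra_def distrib_left distrib_right)

lemma free_algebra_simps:
  "x \<otimes>\<^bsub>free_algebra S\<^esub> y = x * y" "x \<oplus>\<^bsub>free_algebra S\<^esub> y = x + y"
  "\<one>\<^bsub>free_algebra S\<^esub> = 1" "\<zero>\<^bsub>free_algebra S\<^esub> = 0"
  by (simp_all add: free_algebra_def)

lemma gen_carrier: "v \<in> S \<Longrightarrow> gen v \<in> carrier (free_algebra S)"
  by (simp add: free_algebra_def)

lemma const_carrier: "const r \<in> carrier (free_algebra S)"
  by (simp add: free_algebra_def)

lemma free_algebra_minus:
  fixes x y :: "'a word \<Rightarrow>\<^sub>0 'r::comm_ring_1"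
  assumes "x \<in> carrier (free_algebra S)" "y \<in> carrier (free_algebra S)"
  shows "x - y \<in> carrier (free_algebra S)"
  using assms Poly_Mapping.keys_add[of x "-y"] by (auto simp: free_algebra_def)

definition submodule_set :: "('i \<Rightarrow>\<^sub>0 'r::comm_ring_1) set \<Rightarrow> bool" where
  "submodule_set V \<longleftrightarrow> (\<forall>v\<in>V. \<forall>w\<in>V. v + w \<in> V) \<and> (\<forall>r. \<forall>v\<in>V. smul r v \<in> V)"

definition tensor_rels :: "('i \<Rightarrow>\<^sub>0 'r::comm_ring_1) set \<Rightarrow> (('i \<Rightarrow>\<^sub>0 'r) word \<Rightarrow>\<^sub>0 'r) set" where
  "tensor_rels V = {gen (v + w) - gen v - gen w | v w. v \<in> V \<and> w \<in> V} \<union>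
     {gen (smul r v) - const r * gen v | r v. v \<in> V}"

lemma tensor_rels_carrier:
  assumes "submodule_set V"
  shows "tensor_rels V \<subseteq> carrier (free_algebra V)"
proof -
  have "const r * gen v \<in> carrier (free_algebra V)" if "v \<in> V" for r :: 'b and v
    using that by (auto simp: mult_single plus_word_def free_algebra_def)
  then show ?thesis using assms
    by (auto simp: tensor_rels_def submodule_set_def intro!: free_algebra_minus gen_carrier)
qed

lemma tensor_ideal_ideal:
  assumes "submodule_set V"
  shows "ideal (tensor_ideal V) (free_algebra V)"
  unfolding tensor_ideal_def
  by (intro ring.genideal_ideal free_algebra_ring)
    (use tensor_rels_carrier[OF assms] in \<open>simp add: tensor_rels_def\<close>)

lemma tensor_algebra_ring: "submodule_set V \<Longrightarrow> ring (tensor_algebra V)"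
  unfolding tensor_algebra_def by (intro ideal.quotient_is_ring tensor_ideal_ideal)

lemma tensor_carrier:
  assumes "submodule_set V"
  shows "v \<in> V \<Longrightarrow> tensor_vec V v \<in> carrier (tensor_algebra V)"
    "tensor_scalar V r \<in> carrier (tensor_algebra V)"
proof -
  interpret I: ideal "tensor_ideal V" "free_algebra V" by (rule tensor_ideal_ideal[OF assms])
  have h: "(+>\<^bsub>free_algebra V\<^esub>) (tensor_ideal V) \<in> ring_hom (free_algebra V) (tensor_algebra V)"
    unfolding tensor_algebra_def by (rule I.rcos_ring_hom)
  show "v \<in> V \<Longrightarrow> tensor_vec V v \<in> carrier (tensor_algebra V)"
    unfolding tensor_vec_def by (intro ring_hom_closed[OF h] gen_carrier)
  show "tensor_scalar V r \<in> carrier (tensor_algebra V)"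
    unfolding tensor_scalar_def by (intro ring_hom_closed[OF h] const_carrier)
qed

lemma clifford_ideal_ideal:
  assumes "submodule_set V"
  shows "ideal (clifford_ideal V q) (tensor_algebra V)"
proof -
  interpret T: ring "tensor_algebra V" by (rule tensor_algebra_ring[OF assms])
  show ?thesis unfolding clifford_ideal_def
    by (intro T.genideal_ideal) (auto intro!: T.minus_closed T.m_closed tensor_carrier[OF assms])
qed

lemma clifford_ring: "submodule_set V \<Longrightarrow> ring (clifford V q)"
  unfolding clifford_def by (intro ideal.quotient_is_ring clifford_ideal_ideal)

locale anti_inv = ring R for R (structure) +
  fixes f
  assumes f_closed: "x \<in> carrier R \<Longrightarrow> f x \<in> carrier R"
    and f_add: "x \<in> carrier R \<Longrightarrow> y \<in> carrier R \<Longrightarrow> f (x \<oplus> y) = f x \<oplus> f y"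
    and f_mult: "x \<in> carrier R \<Longrightarrow> y \<in> carrier R \<Longrightarrow> f (x \<otimes> y) = f y \<otimes> f x"
    and f_f: "x \<in> carrier R \<Longrightarrow> f (f x) = x"
begin

lemma f_zero: "f \<zero> = \<zero>"
  using f_add[of \<zero> \<zero>] f_closed[of \<zero>] by (metis add.l_cancel_one' zero_closed l_zero)

lemma f_neg: "x \<in> carrier R \<Longrightarrow> f (\<ominus> x) = \<ominus> f x"
  by (metis a_inv_closed f_add f_closed f_zero l_neg minus_equality)

lemma f_minus: "x \<in> carrier R \<Longrightarrow> y \<in> carrier R \<Longrightarrow> f (x \<ominus> y) = f x \<ominus> f y"
  by (simp add: a_minus_def f_add f_neg)

lemma ideal_vimage:
  assumes "ideal I R"
  shows "ideal {x \<in> carrier R. f x \<in> I} R"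
proof -
  interpret I: ideal I R by fact
  show ?thesis
  proof (rule idealI[OF ring_axioms])
    have "f (\<ominus> x) \<in> I" if "x \<in> carrier R" "f x \<in> I" for x
      using that by (simp add: f_neg)
    then show "subgroup {x \<in> carrier R. f x \<in> I} (add_monoid R)"
      by (intro add.subgroupI) (auto simp: f_add f_zero simp flip: a_inv_def intro!: exI[of _ \<zero>])
  qed (auto simp: f_mult f_closed I.I_l_closed I.I_r_closed)
qed

lemma genideal_stable:
  assumes "S \<subseteq> carrier R" "f ` S \<subseteq> Idl S"
  shows "f ` (Idl S) = Idl S"
proof -
  interpret I: ideal "Idl S" R by (rule genideal_ideal[OF assms(1)])
  have "Idl S \<subseteq> {x \<in> carrier R. f x \<in> Idl S}"
    by (rule genideal_minimal[OF ideal_vimage[OF I.is_ideal]]) (use assms in auto)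
  then have P: "f x \<in> Idl S" "f (f x) = x" if "x \<in> Idl S" for x using that f_f by auto
  then have "x \<in> f ` (Idl S)" if "x \<in> Idl S" for x
    by (intro image_eqI[where x="f x"]) (simp_all add: that)
  then show ?thesis using P(1) by blast
qed

lemma f_coset:
  assumes "ideal I R" "f ` I = I" "x \<in> carrier R"
  shows "f ` (I +> x) = I +> f x"
proof -
  interpret I: ideal I R by fact
  have "f ` (I +> x) = (\<lambda>n. f (n \<oplus> x)) ` I"
    by (simp add: a_r_coset_def r_coset_def UNION_singleton_eq_range image_image)
  also have "\<dots> = (\<lambda>n. f n \<oplus> f x) ` I"
    by (rule image_cong[OF HOL.refl]) (simp add: f_add I.a_Hcarr assms)
  also have "\<dots> = (\<lambda>n. n \<oplus> f x) ` (f ` I)" by (simp add: image_image)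
  also have "\<dots> = I +> f x"
    unfolding assms(2) by (simp add: a_r_coset_def r_coset_def UNION_singleton_eq_range)
  finally show ?thesis .
qed

lemma quot_anti_inv:
  assumes I: "ideal I R" "f ` I = I"
  shows "anti_inv (R Quot I) (\<lambda>C. f ` C)"
proof -
  interpret I: ideal I R by fact
  interpret Q: ring "R Quot I" by (rule I.quotient_is_ring)
  note h = I.rcos_ring_hom
  have ex: "\<exists>u\<in>carrier R. x = I +> u" if "x \<in> carrier (R Quot I)" for x
    using that by (auto simp: FactRing_def A_RCOSETS_def' )
  show ?thesis
  proof unfold_locales
    fix x assume "x \<in> carrier (R Quot I)"
    then obtain u where u: "u \<in> carrier R" "x = I +> u" using ex by blast
    show "f ` x \<in> carrier (R Quot I)"
      using u f_coset[OF I] ring_hom_closed[OF h] f_closed by simp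
    show "f ` f ` x = x" using u f_coset[OF I] f_closed f_f by simp
    fix y assume "y \<in> carrier (R Quot I)"
    then obtain v where v: "v \<in> carrier R" "y = I +> v" using ex by blast
    show "f ` (x \<oplus>\<^bsub>R Quot I\<^esub> y) = f ` x \<oplus>\<^bsub>R Quot I\<^esub> f ` y"
      using u v by (simp add: f_coset[OF I] f_closed f_add flip: ring_hom_add[OF h])
    show "f ` (x \<otimes>\<^bsub>R Quot I\<^esub> y) = f ` y \<otimes>\<^bsub>R Quot I\<^esub> f ` x"
      using u v by (simp add: f_coset[OF I] f_closed f_mult flip: ring_hom_mult[OF h])
  qed
qed

end

lemma inj_rev_word: "inj rev_word"
  by (auto simp: inj_def rev_word_def intro: word.expand)

lemma rev_word_rev_word: "rev_word (rev_word w) = w"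
  by (simp add: rev_word_def)

lemma rev_single: "Poly_Mapping.map_key rev_word (Poly_Mapping.single w r)
    = Poly_Mapping.single (rev_word w) r"
  using map_key_single[OF inj_rev_word, of "rev_word w" r] by (simp add: rev_word_rev_word)

lemma rev_minus: "Poly_Mapping.map_key rev_word (p - q)
    = Poly_Mapping.map_key rev_word p - Poly_Mapping.map_key rev_word (q :: _ \<Rightarrow>\<^sub>0 'r::comm_ring_1)"
  by (rule poly_mapping_eqI) (simp add: map_key.rep_eq[OF inj_rev_word] lookup_minus)

lemma single_induct:
  fixes p :: "'a \<Rightarrow>\<^sub>0 'r::comm_monoid_add"
  assumes "P 0" "\<And>p w r. P p \<Longrightarrow> P (p + Poly_Mapping.single w r)"
  shows "P p"
proof (induction p rule: update_induct)
  case const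
  show ?case using assms(1) by simp
next
  case (update p w r)
  have "Poly_Mapping.update w r p = p + Poly_Mapping.single w r"
    using update(1) by (intro poly_mapping_eqI)
      (auto simp: lookup_update lookup_add lookup_single in_keys_iff when_def)
  then show ?case using assms(2) update by simp
qed

lemma rev_mult:
  fixes p q :: "'a word \<Rightarrow>\<^sub>0 'r::comm_ring_1"
  shows "Poly_Mapping.map_key rev_word (p * q)
    = Poly_Mapping.map_key rev_word q * Poly_Mapping.map_key rev_word p"
proof (induction p rule: single_induct)
  case 1 show ?case by (simp add: map_key_zero[OF inj_rev_word])
next
  case (2 p w r)
  have "Poly_Mapping.map_key rev_word (Poly_Mapping.single w r * q)
      = Poly_Mapping.map_key rev_word q * Poly_Mapping.single (rev_word w) r"
  proof (induction q rule: single_induct)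
    case 1 show ?case by (simp add: map_key_zero[OF inj_rev_word])
  next
    case (2 q w' r')
    then show ?case
      by (simp add: distrib_left distrib_right map_key_plus[OF inj_rev_word] mult_single rev_single)
        (simp add: rev_word_def plus_word_def mult.commute)
  qed
  then show ?case using 2
    by (simp add: distrib_left distrib_right map_key_plus[OF inj_rev_word] rev_single)
qed

lemma free_algebra_anti_inv:
  "anti_inv (free_algebra S :: ('a word \<Rightarrow>\<^sub>0 'r::comm_ring_1) ring) (Poly_Mapping.map_key rev_word)"
proof -
  interpret ring "free_algebra S :: ('a word \<Rightarrow>\<^sub>0 'r) ring" by (rule free_algebra_ring)
  show ?thesis
  proof unfold_locales
    fix x assume "x \<in> carrier (free_algebra S :: ('a word \<Rightarrow>\<^sub>0 'r) ring)"
    then show "Poly_Mapping.map_key rev_word x \<in> carrier (free_algebra S)"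
      by (fastforce simp: free_algebra_def keys_map_key[OF inj_rev_word] rev_word_def)
  qed (auto simp: free_algebra_simps rev_mult map_key_plus[OF inj_rev_word]
        map_key_compose[OF inj_rev_word inj_rev_word] rev_word_rev_word o_def map_key_id)
qed

lemma tensor_ideal_stable:
  assumes "submodule_set V"
  shows "Poly_Mapping.map_key rev_word ` tensor_ideal V = tensor_ideal V"
proof -
  interpret A: anti_inv "free_algebra V" "Poly_Mapping.map_key rev_word"
    by (rule free_algebra_anti_inv)
  have "Poly_Mapping.map_key rev_word x = x" if "x \<in> tensor_rels V" for x
    using that by (auto simp: tensor_rels_def rev_minus rev_single mult_single plus_word_def)
      (simp_all add: rev_word_def)
  then have "Poly_Mapping.map_key rev_word ` tensor_rels V \<subseteq> Idl\<^bsub>free_algebra V\<^esub> (tensor_rels V)"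
    using A.genideal_self[OF tensor_rels_carrier[OF assms]] by auto
  from A.genideal_stable[OF tensor_rels_carrier[OF assms] this]
  show ?thesis by (simp add: tensor_ideal_def tensor_rels_def)
qed

lemma tensor_anti_inv:
  assumes "submodule_set V"
  shows "anti_inv (tensor_algebra V) (\<lambda>C. Poly_Mapping.map_key rev_word ` C)"
  unfolding tensor_algebra_def
  by (rule anti_inv.quot_anti_inv[OF free_algebra_anti_inv tensor_ideal_ideal[OF assms]
        tensor_ideal_stable[OF assms]])

lemma rev_tensor:
  assumes "submodule_set V"
  shows "v \<in> V \<Longrightarrow> Poly_Mapping.map_key rev_word ` tensor_vec V v = tensor_vec V v"
    "Poly_Mapping.map_key rev_word ` tensor_scalar V r = tensor_scalar V r"
proof -
  interpret A: anti_inv "free_algebra V" "Poly_Mapping.map_key rev_word"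
    by (rule free_algebra_anti_inv)
  note c = A.f_coset[OF tensor_ideal_ideal[OF assms] tensor_ideal_stable[OF assms]]
  show "v \<in> V \<Longrightarrow> Poly_Mapping.map_key rev_word ` tensor_vec V v = tensor_vec V v"
    unfolding tensor_vec_def by (simp add: c gen_carrier rev_single) (simp add: rev_word_def)
  show "Poly_Mapping.map_key rev_word ` tensor_scalar V r = tensor_scalar V r"
    unfolding tensor_scalar_def by (simp add: c const_carrier rev_single) (simp add: rev_word_def)
qed

lemma clifford_ideal_stable:
  assumes "submodule_set V"
  shows "(`) (Poly_Mapping.map_key rev_word) ` clifford_ideal V q = clifford_ideal V q"
proof -
  interpret A: anti_inv "tensor_algebra V" "\<lambda>C. Poly_Mapping.map_key rev_word ` C"
    by (rule tensor_anti_inv[OF assms])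
  let ?S = "{tensor_vec V w \<otimes>\<^bsub>tensor_algebra V\<^esub> tensor_vec V w
       \<ominus>\<^bsub>tensor_algebra V\<^esub> tensor_scalar V (q w) | w. w \<in> V}"
  have S: "?S \<subseteq> carrier (tensor_algebra V)"
    by (auto intro!: A.minus_closed A.m_closed tensor_carrier[OF assms])
  have "Poly_Mapping.map_key rev_word ` x = x" if "x \<in> ?S" for x
  proof -
    obtain w where w: "w \<in> V" "x = tensor_vec V w \<otimes>\<^bsub>tensor_algebra V\<^esub> tensor_vec V w
       \<ominus>\<^bsub>tensor_algebra V\<^esub> tensor_scalar V (q w)" using \<open>x \<in> ?S\<close> by blast
    show ?thesis unfolding w(2)
      by (simp only: A.f_minus A.f_mult rev_tensor[OF assms] tensor_carrier[OF assms]
          A.m_closed w(1))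
  qed
  then have "(`) (Poly_Mapping.map_key rev_word) ` ?S \<subseteq> Idl\<^bsub>tensor_algebra V\<^esub> ?S"
    using A.genideal_self[OF S] by auto
  from A.genideal_stable[OF S this] show ?thesis by (simp add: clifford_ideal_def)
qed

lemma clifford_anti_inv:
  assumes "submodule_set V"
  shows "anti_inv (clifford V q) cl_rev"
proof -
  have "cl_rev = (\<lambda>D :: ('a, 'b) cliff. (\<lambda>C. Poly_Mapping.map_key rev_word ` C) ` D)"
    by (simp add: cl_rev_def fun_eq_iff)
  then show ?thesis unfolding clifford_def
    using anti_inv.quot_anti_inv[OF tensor_anti_inv[OF assms] clifford_ideal_ideal[OF assms]
        clifford_ideal_stable[OF assms]] by simp
qed

lemma cl_rev_vec:
  assumes "submodule_set V" "v \<in> V"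
  shows "cl_rev (cl_vec V q v) = cl_vec V q v"
  using anti_inv.f_coset[OF tensor_anti_inv[OF assms(1)] clifford_ideal_ideal[OF assms(1)]
      clifford_ideal_stable[OF assms(1)] tensor_carrier(1)[OF assms], of q]
  by (simp add: cl_rev_def cl_vec_def rev_tensor(1)[OF assms])

lemma cl_vec_square:
  assumes "submodule_set V" "v \<in> V"
  shows "cl_vec V q v \<otimes>\<^bsub>clifford V q\<^esub> cl_vec V q v = cl_scalar V q (q v)"
proof -
  interpret T: ring "tensor_algebra V" by (rule tensor_algebra_ring[OF assms(1)])
  interpret I: ideal "clifford_ideal V q" "tensor_algebra V"
    by (rule clifford_ideal_ideal[OF assms(1)])
  let ?v = "tensor_vec V v"
  have "?v \<otimes>\<^bsub>tensor_algebra V\<^esub> ?v \<ominus>\<^bsub>tensor_algebra V\<^esub> tensor_scalar V (q v) \<in> clifford_ideal V q"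
    unfolding clifford_ideal_def genideal_def using assms by blast
  then have "clifford_ideal V q +>\<^bsub>tensor_algebra V\<^esub> (?v \<otimes>\<^bsub>tensor_algebra V\<^esub> ?v)
      = clifford_ideal V q +>\<^bsub>tensor_algebra V\<^esub> tensor_scalar V (q v)"
    using tensor_carrier[OF assms(1)] assms T.quotient_eq_iff_same_a_r_cos[OF I.is_ideal] by auto
  then show ?thesis
    using ring_hom_mult[OF I.rcos_ring_hom, of ?v ?v] tensor_carrier[OF assms(1)] assms
    by (simp add: cl_vec_def cl_scalar_def clifford_def)
qed

subsection \<open>The quadratic form\<close>

lemma smul_lookup: "Poly_Mapping.lookup (smul r x) i = r * Poly_Mapping.lookup x i"
  by (auto simp: smul_def map.rep_eq when_def)

lemma V_mod_submodule: "submodule_set (V_mod m)"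
  by (auto simp: submodule_set_def V_mod_def smul_lookup in_keys_iff subset_iff lookup_add)
   (metis add_0)

lemma s_var_s_inv: "s_var * s_inv = 1"
  by (simp add: s_var_def s_inv_def mult_single)

lemma t_var_t_inv: "t_var * t_inv = 1"
  by (simp add: t_var_def t_inv_def s_var_s_inv flip: power_mult_distrib)

lemma laurent_2: "(x::laurent) + x = 0"
proof (rule poly_mapping_eqI)
  show "Poly_Mapping.lookup (x + x) k = Poly_Mapping.lookup 0 k" for k
    unfolding lookup_add by (cases "Poly_Mapping.lookup x k") simp_all
qed

lemma laurent_square_add: "((x::laurent) + y)\<^sup>2 = x\<^sup>2 + y\<^sup>2"
  using laurent_2[of "x * y"] by (simp add: power2_eq_square algebra_simps)

lemma bform_alt:
  "bform m x y = (\<Sum>j\<le>m. \<Sum>i<j. coord x i * coord y j + coord x j * coord y i)"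
proof -
  have "(\<Sum>j\<in>{..m} - {i}. coord x i * coord y j)
      = (\<Sum>j<i. coord x i * coord y j) + (\<Sum>j\<in>{j \<in> {..m}. i < j}. coord x i * coord y j)"
    if "i \<le> m" for i
  proof -
    have "{..m} - {i} = {..<i} \<union> {j \<in> {..m}. i < j}" using that by auto
    then show ?thesis by (simp add: sum.union_disjoint disjoint_iff)
  qed
  then have "bform m x y = (\<Sum>i\<le>m. \<Sum>j<i. coord x i * coord y j)
      + (\<Sum>i\<le>m. \<Sum>j\<in>{j \<in> {..m}. i < j}. coord x i * coord y j)"
    by (simp add: bform_def sum.distrib)
  also have "(\<Sum>i\<le>m. \<Sum>j\<in>{j \<in> {..m}. i < j}. coord x i * coord y j)
      = (\<Sum>j\<le>m. \<Sum>i\<in>{i \<in> {..m}. i < j}. coord x i * coord y j)"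
    by (rule sum.swap_restrict) simp_all
  also have "\<dots> = (\<Sum>j\<le>m. \<Sum>i<j. coord x i * coord y j)"
    by (intro sum.cong refl) auto
  finally show ?thesis by (simp add: sum.distrib add.commute)
qed

lemma qform_values:
  shows "qform m u_vec = 1" and "1 \<le> i \<Longrightarrow> i \<le> m \<Longrightarrow> qform m (v_vec i) = t_inv"
proof -
  have z: "(\<Sum>j\<le>m. \<Sum>k<j. coord (Poly_Mapping.single i 1) k * coord (Poly_Mapping.single i 1) j) = 0"
    for i
    by (intro sum.neutral ballI) (auto simp: lookup_single when_def)
  show "qform m u_vec = 1"
    unfolding qform_def u_vec_def z by (simp add: lookup_single when_def del: single_one)
  assume i: "1 \<le> i" "i \<le> m"
  have "(\<Sum>k=1..m. t_inv * (coord (v_vec i) k)\<^sup>2) = (\<Sum>k=1..m. if k = i then t_inv else 0)"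
    by (intro sum.cong) (auto simp: v_vec_def lookup_single when_def)
  then show "qform m (v_vec i) = t_inv"
    using i z unfolding qform_def by (simp add: v_vec_def lookup_single when_def)
qed

lemma bform_single:
  assumes "i \<le> m" "j \<le> m" "i \<noteq> j"
  shows "bform m (Poly_Mapping.single i 1) (Poly_Mapping.single j 1) = 1"
proof -
  have "bform m (Poly_Mapping.single i 1) (Poly_Mapping.single j 1)
      = (\<Sum>k\<le>m. if k = i then (\<Sum>l\<in>{..m} - {k}. if l = j then 1 else 0) else 0)"
    unfolding bform_def
    by (intro sum.cong refl) (auto simp: lookup_single when_def intro!: sum.cong sum.neutral)
  then show ?thesis using assms by simp
qed

lemma bform_values:
  shows "1 \<le> i \<Longrightarrow> i \<le> m \<Longrightarrow> bform m u_vec (v_vec i) = 1"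
    and "1 \<le> i \<Longrightarrow> i \<le> m \<Longrightarrow> 1 \<le> j \<Longrightarrow> j \<le> m \<Longrightarrow> i \<noteq> j \<Longrightarrow> bform m (v_vec i) (v_vec j) = 1"
  by (auto simp: u_vec_def v_vec_def simp del: single_one intro!: bform_single)

lemma bform_alternating: "bform m x x = 0"
proof -
  have "coord x i * coord x j + coord x j * coord x i = 0" for i j
    using laurent_2[of "coord x i * coord x j"] by (simp add: mult.commute)
  then show ?thesis unfolding bform_alt by (intro sum.neutral ballI)
qed

lemma qform_smul: "qform m (smul r x) = r\<^sup>2 * qform m x"
  by (simp add: qform_def smul_lookup power_mult_distrib distrib_left sum_distrib_left
      power2_eq_square mult_ac)

lemma qform_add: "qform m (x + y) = qform m x + qform m y + bform m x y"
  by (simp add: qform_def bform_alt lookup_add laurent_square_add distrib_left distrib_right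
      sum.distrib add_ac mult.commute)

end

theory Submission
  imports Defs
begin

text \<open>
  The vectors \<open>u\<close>, \<open>s v\<^sub>1\<close> and \<open>v\<^sub>i + v\<^sub>i\<^sub>+\<^sub>1\<close> have norm \<open>1\<close>. In the Clifford algebra, conjugation by a vector
  \<open>w\<close> of norm \<open>1\<close> is the reflection in \<open>w\<close> (\<open>monomial_conjugation\<close>). The map \<open>\<psi>\<close> sends the generators
  \<open>\<tau>\<close>, \<open>a\<close> and \<open>\<tau>s\<^sub>i\<close> to products of such vectors, and \<open>\<phi>\<close> sends them to the products of the same
  reflections. Products of the generators exhaust the group (\<open>yt_induct\<close>), so for every \<open>g\<close> there
  is a list of norm-one vectors whose product is \<open>\<psi>(g)\<close> and whose product of reflections is \<open>\<phi>(g)\<close>. This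
  gives \<open>\<phi> = \<pi> \<circ> \<psi>\<close> and reduces injectivity to the claim that \<open>c = \<psi>(g)\<close> equals \<open>1\<close> whenever \<open>\<phi>(g)\<close> is the
  identity. Such a \<open>c\<close> commutes with all vectors.

  For even \<open>m\<close> the sum of the basis vectors spans the radical of the bilinear form and is an odd
  central element of the Clifford algebra, so centrality alone does not force \<open>c\<close> to be a scalar. The first
  step is that \<open>c\<close> is even (\<open>reflect_trivial_even\<close>). At \<open>s = 1\<close> the reflections permute
  the \<open>m + 2\<close> functionals formed by the coordinates and their sum, each as a transposition; the group acts
  through the symmetric group on \<open>m + 2\<close> points. A product of reflections that is the identity has
  the trivial permutation, hence an even number of factors.

  The second step is that an even central element is a scalar (\<open>even_central_monomial\<close>). The Clifford
  algebra acts on the exterior algebra of \<open>V\<close>, and the map from \<open>c\<close> to its value on the vacuum is injective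
  (\<open>fock_act_faithful\<close>). In this model the commutator with a vector \<open>v\<close> is contraction with
  \<open>(v, \<cdot>)\<close> (\<open>left_right_difference\<close>). Taking for \<open>v\<close> the sums of two basis vectors shows that the value
  on the vacuum has no component of degree two or more, and evenness excludes degree one.

  Finally a scalar \<open>r\<close> in the Pin group satisfies \<open>r\<^sup>2 = 1\<close>, so \<open>r = 1\<close> in characteristic two.
\<close>

section \<open>Presentation of the Clifford algebra by words\<close>

text \<open>The Clifford algebra is a quotient of a quotient of the free algebra on the set \<open>V\<close>. Representing
  its elements by polynomials in words makes the arithmetic of the free algebra available.\<close>

definition cl_of ::
    "('i \<Rightarrow>\<^sub>0 'r::comm_ring_1) set \<Rightarrow> (('i \<Rightarrow>\<^sub>0 'r) \<Rightarrow> 'r) \<Rightarrow> (('i \<Rightarrow>\<^sub>0 'r) word \<Rightarrow>\<^sub>0 'r) \<Rightarrow> ('i, 'r) cliff" where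
  "cl_of V q p = clifford_ideal V q +>\<^bsub>tensor_algebra V\<^esub> (tensor_ideal V +>\<^bsub>free_algebra V\<^esub> p)"

lemma cl_of_gen: "cl_of V q (gen v) = cl_vec V q v"
  and cl_of_const: "cl_of V q (const r) = cl_scalar V q r"
  by (simp_all add: cl_of_def cl_vec_def cl_scalar_def tensor_vec_def tensor_scalar_def)

lemma cl_of_hom:
  assumes "submodule_set V"
  shows "cl_of V q \<in> ring_hom (free_algebra V) (clifford V q)"
proof -
  have "(+>\<^bsub>tensor_algebra V\<^esub>) (clifford_ideal V q) \<circ> (+>\<^bsub>free_algebra V\<^esub>) (tensor_ideal V)
      \<in> ring_hom (free_algebra V) (clifford V q)"
    unfolding clifford_def
    by (rule ring_hom_trans[where S = "tensor_algebra V"])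
      (use ideal.rcos_ring_hom[OF tensor_ideal_ideal[OF assms]]
        ideal.rcos_ring_hom[OF clifford_ideal_ideal[OF assms]] in
        \<open>simp_all add: tensor_algebra_def\<close>)
  moreover have "cl_of V q = (+>\<^bsub>tensor_algebra V\<^esub>) (clifford_ideal V q) \<circ> (+>\<^bsub>free_algebra V\<^esub>) (tensor_ideal V)"
    by (simp add: fun_eq_iff cl_of_def)
  ultimately show ?thesis by simp
qed

lemma tensor_algebra_surj:
  assumes "X \<in> carrier (tensor_algebra V)"
  obtains x where "x \<in> carrier (free_algebra V)" "X = tensor_ideal V +>\<^bsub>free_algebra V\<^esub> x"
  using assms by (auto simp: tensor_algebra_def FactRing_def A_RCOSETS_def')

lemma (in ideal) coset_zero_imp_mem:
  assumes "x \<in> carrier R" "I +> x = \<zero>\<^bsub>R Quot I\<^esub>"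
  shows "x \<in> I"
proof -
  have "I +> x = I +> \<zero>" using assms a_rcos_zero[OF is_ideal] a_coset_add_zero[OF a_subset] by (simp add: FactRing_def)
  then have "x \<ominus> \<zero> \<in> I" using quotient_eq_iff_same_a_r_cos[OF is_ideal, of x \<zero>] assms by simp
  then show ?thesis using assms by (simp add: a_minus_def)
qed

lemma free_algebra_a_inv:
  fixes x :: "'a word \<Rightarrow>\<^sub>0 'r::comm_ring_1"
  assumes "x \<in> carrier (free_algebra S)"
  shows "\<ominus>\<^bsub>free_algebra S\<^esub> x = - x"
proof -
  interpret ring "free_algebra S :: ('a word \<Rightarrow>\<^sub>0 'r) ring" by (rule free_algebra_ring)
  have "- x \<in> carrier (free_algebra S)"
    using free_algebra_minus[of 0 S x] assms zero_closed by (simp add: free_algebra_simps)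
  then show ?thesis using minus_equality[of "- x" x] assms by (simp add: free_algebra_simps)
qed

lemma free_algebra_idealI:
  fixes K :: "('a word \<Rightarrow>\<^sub>0 'r::comm_ring_1) set"
  assumes "K \<subseteq> carrier (free_algebra S)" "0 \<in> K"
    and "\<And>x y. x \<in> K \<Longrightarrow> y \<in> K \<Longrightarrow> x + y \<in> K" "\<And>x. x \<in> K \<Longrightarrow> - x \<in> K"
    and "\<And>x y. x \<in> K \<Longrightarrow> y \<in> carrier (free_algebra S) \<Longrightarrow> y * x \<in> K \<and> x * y \<in> K"
  shows "ideal K (free_algebra S)"
proof -
  interpret ring "free_algebra S :: ('a word \<Rightarrow>\<^sub>0 'r) ring" by (rule free_algebra_ring)
  show ?thesis
  proof (rule idealI[OF free_algebra_ring])
    show "subgroup K (add_monoid (free_algebra S))"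
      by (rule add.subgroupI)
        (use assms in \<open>auto simp: free_algebra_simps free_algebra_a_inv subset_iff simp flip: a_inv_def\<close>)
  qed (use assms in \<open>auto simp: free_algebra_simps\<close>)
qed

text \<open>The universal property in terms of ideals: the two successive quotients impose only the listed
  relations. For an ideal \<open>K\<close> containing the relations, the cosets contained in \<open>K\<close> form an ideal of the
  tensor algebra, and this ideal contains the Clifford relators.\<close>

lemma cl_of_kernel:
  assumes V: "submodule_set V" and K: "ideal K (free_algebra V)"
    and t: "tensor_rels V \<subseteq> K"
    and c: "\<And>w. w \<in> V \<Longrightarrow> gen w * gen w - const (q w) \<in> K"
    and p: "p \<in> carrier (free_algebra V)" "cl_of V q p = \<zero>\<^bsub>clifford V q\<^esub>"
  shows "p \<in> K"
proof -
  let ?F = "free_algebra V :: (('a \<Rightarrow>\<^sub>0 'b) word \<Rightarrow>\<^sub>0 'b) ring" and ?T = "tensor_algebra V"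
  interpret F: ring ?F by (rule free_algebra_ring)
  interpret T: ring ?T by (rule tensor_algebra_ring[OF V])
  interpret I: ideal "tensor_ideal V" ?F by (rule tensor_ideal_ideal[OF V])
  interpret C: ideal "clifford_ideal V q" ?T by (rule clifford_ideal_ideal[OF V])
  interpret K: ideal K ?F by fact
  let ?h = "(+>\<^bsub>?F\<^esub>) (tensor_ideal V)"
  have h: "?h \<in> ring_hom ?F ?T" unfolding tensor_algebra_def by (rule I.rcos_ring_hom)
  interpret h: ring_hom_ring ?F ?T ?h by (rule ring_hom_ringI2[OF F.ring_axioms T.ring_axioms h])
  have IK: "tensor_ideal V \<subseteq> K"
    unfolding tensor_ideal_def using t by (intro F.genideal_minimal[OF K]) (simp add: tensor_rels_def)
  have sub: "?h x \<subseteq> K \<longleftrightarrow> x \<in> K" if x: "x \<in> carrier ?F" for x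
  proof
    have "x \<in> ?h x" using x I.a_rcos_self by blast
    then show "?h x \<subseteq> K \<Longrightarrow> x \<in> K" by blast
    show "x \<in> K \<Longrightarrow> ?h x \<subseteq> K" using IK by (auto simp: a_r_coset_def r_coset_def)
  qed
  let ?KT = "{X \<in> carrier ?T. X \<subseteq> K}"
  have KT: "ideal ?KT ?T"
  proof (rule idealI[OF T.ring_axioms])
    have ex: "\<exists>x\<in>K. x \<in> carrier ?F \<and> X = ?h x" if X: "X \<in> ?KT" for X
      using X tensor_algebra_surj sub by (metis (no_types, lifting) mem_Collect_eq)
    have "\<zero>\<^bsub>?T\<^esub> = ?h \<zero>\<^bsub>?F\<^esub>" by simp
    then have zero: "\<zero>\<^bsub>?T\<^esub> \<in> ?KT" using sub[of "\<zero>\<^bsub>?F\<^esub>"] by simp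
    have neg: "\<ominus>\<^bsub>?T\<^esub> X \<in> ?KT" if X: "X \<in> ?KT" for X
    proof -
      obtain x where x: "x \<in> carrier ?F" "X = ?h x" "x \<in> K" using ex[OF X] by blast
      have "\<ominus>\<^bsub>?T\<^esub> X = ?h (\<ominus>\<^bsub>?F\<^esub> x)" by (simp add: x)
      then show ?thesis using x sub[of "\<ominus>\<^bsub>?F\<^esub> x"] by simp
    qed
    have add: "X \<oplus>\<^bsub>?T\<^esub> Y \<in> ?KT" if X: "X \<in> ?KT" and Y: "Y \<in> ?KT" for X Y
    proof -
      obtain x where x: "x \<in> carrier ?F" "X = ?h x" "x \<in> K" using ex[OF X] by blast
      obtain y where y: "y \<in> carrier ?F" "Y = ?h y" "y \<in> K" using ex[OF Y] by blast
      have "X \<oplus>\<^bsub>?T\<^esub> Y = ?h (x \<oplus>\<^bsub>?F\<^esub> y)" by (simp add: x y)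
      then show ?thesis using x y sub[of "x \<oplus>\<^bsub>?F\<^esub> y"] by simp
    qed
    show "subgroup ?KT (add_monoid ?T)"
      by (rule T.add.subgroupI) (use zero neg add in \<open>auto simp flip: a_inv_def\<close>)
  next
    fix X Y assume X: "X \<in> ?KT" and Y: "Y \<in> carrier ?T"
    obtain x where x: "x \<in> carrier ?F" "X = ?h x" "x \<in> K"
      using tensor_algebra_surj sub X by (metis (no_types, lifting) mem_Collect_eq)
    obtain y where y: "y \<in> carrier ?F" "Y = ?h y" using tensor_algebra_surj[OF Y] .
    have "Y \<otimes>\<^bsub>?T\<^esub> X = ?h (y \<otimes>\<^bsub>?F\<^esub> x)" "X \<otimes>\<^bsub>?T\<^esub> Y = ?h (x \<otimes>\<^bsub>?F\<^esub> y)" by (simp_all add: x y)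
    then show "Y \<otimes>\<^bsub>?T\<^esub> X \<in> ?KT" "X \<otimes>\<^bsub>?T\<^esub> Y \<in> ?KT"
      using x y sub[of "y \<otimes>\<^bsub>?F\<^esub> x"] sub[of "x \<otimes>\<^bsub>?F\<^esub> y"] K.I_l_closed K.I_r_closed by simp_all
  qed
  have "clifford_ideal V q \<subseteq> ?KT"
    unfolding clifford_ideal_def
  proof (rule T.genideal_minimal[OF KT], safe)
    fix w assume w: "w \<in> V"
    have "tensor_vec V w \<otimes>\<^bsub>?T\<^esub> tensor_vec V w \<ominus>\<^bsub>?T\<^esub> tensor_scalar V (q w)
        = ?h (gen w \<otimes>\<^bsub>?F\<^esub> gen w \<oplus>\<^bsub>?F\<^esub> \<ominus>\<^bsub>?F\<^esub> const (q w))"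
      by (simp only: tensor_vec_def tensor_scalar_def a_minus_def h.hom_add h.hom_mult h.hom_a_inv
          gen_carrier[OF w] const_carrier F.m_closed F.a_inv_closed)
    also have "gen w \<otimes>\<^bsub>?F\<^esub> gen w \<oplus>\<^bsub>?F\<^esub> \<ominus>\<^bsub>?F\<^esub> const (q w) = gen w * gen w - const (q w)"
      by (simp add: free_algebra_simps free_algebra_a_inv const_carrier)
    finally have e: "tensor_vec V w \<otimes>\<^bsub>?T\<^esub> tensor_vec V w \<ominus>\<^bsub>?T\<^esub> tensor_scalar V (q w)
        = ?h (gen w * gen w - const (q w))" .
    show "tensor_vec V w \<otimes>\<^bsub>?T\<^esub> tensor_vec V w \<ominus>\<^bsub>?T\<^esub> tensor_scalar V (q w) \<in> carrier ?T"
      using tensor_carrier[OF V] w by simp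
    fix x assume "x \<in> tensor_vec V w \<otimes>\<^bsub>?T\<^esub> tensor_vec V w \<ominus>\<^bsub>?T\<^esub> tensor_scalar V (q w)"
    then show "x \<in> K" unfolding e using sub[OF K.Icarr[OF c[OF w]]] c[OF w] by blast
  qed
  moreover have "?h p \<in> clifford_ideal V q"
    by (rule C.coset_zero_imp_mem) (use p in \<open>simp_all add: cl_of_def clifford_def\<close>)
  ultimately show ?thesis using sub[OF p(1)] by blast
qed

section \<open>The Fock representation\<close>

text \<open>Coefficients in an exterior algebra: a set of indices names the product of its basis vectors. The order
  of the factors is irrelevant because \<open>1 = -1\<close> in the scalars.\<close>

type_synonym fock = "nat set \<Rightarrow> laurent"

definition toggle :: "nat \<Rightarrow> nat set \<Rightarrow> nat set" where
  "toggle i S = (if i \<in> S then S - {i} else insert i S)"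

lemma toggle_simps [simp]:
  "toggle i (toggle i S) = S"
  "i \<in> toggle j S \<longleftrightarrow> (if i = j then i \<notin> S else i \<in> S)"
  by (auto simp: toggle_def)

lemma toggle_commute: "toggle i (toggle j S) = toggle j (toggle i S)"
  by (auto simp: toggle_def)

text \<open>Exterior multiplication by the vector with coordinates \<open>a\<close>, plus contraction with the functional with
  values \<open>l\<close> on the basis. The first acts on the coefficient at \<open>S\<close> through the indices in \<open>S\<close>, the
  second through those outside \<open>S\<close>.\<close>

definition fock_op :: "nat \<Rightarrow> (nat \<Rightarrow> laurent) \<Rightarrow> (nat \<Rightarrow> laurent) \<Rightarrow> fock \<Rightarrow> fock" where
  "fock_op m a l f S = (\<Sum>i\<le>m. (if i \<in> S then a i else l i) * f (toggle i S))"

lemma laurent_eqI: "x = y" if "x + y = 0" for x y :: laurent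
proof -
  have "x = (x + y) + y" by (simp only: add.assoc laurent_2 add_0_right)
  then show ?thesis by (simp only: that add_0_left)
qed

lemma sum_symmetric_char2:
  fixes t :: "nat \<Rightarrow> nat \<Rightarrow> laurent"
  assumes "\<And>i j. i \<noteq> j \<Longrightarrow> t i j = t j i"
  shows "(\<Sum>i\<le>m. \<Sum>j\<le>m. t i j) = (\<Sum>i\<le>m. t i i)"
proof (induction m)
  case (Suc m)
  have e: "(\<Sum>i\<le>m. t i (Suc m)) = (\<Sum>i\<le>m. t (Suc m) i)"
    by (intro sum.cong refl assms) auto
  have "(\<Sum>i\<le>Suc m. \<Sum>j\<le>Suc m. t i j) = (\<Sum>i\<le>m. \<Sum>j\<le>m. t i j)
      + ((\<Sum>i\<le>m. t i (Suc m)) + (\<Sum>i\<le>m. t (Suc m) i)) + t (Suc m) (Suc m)"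
    by (simp add: sum.distrib add_ac)
  then show ?case using Suc by (simp add: e laurent_2)
qed simp

text \<open>Toggling \<open>i\<close> and \<open>j\<close> in either order gives the same coefficient when \<open>i \<noteq> j\<close>, so these terms cancel in
  characteristic two; what survives is toggling the same index twice.\<close>

lemma fock_op_square:
  "fock_op m a l (fock_op m a l f) S = (\<Sum>i\<le>m. a i * l i) * f S"
proof -
  let ?k = "\<lambda>i T. if i \<in> T then a i else l i"
  have "fock_op m a l (fock_op m a l f) S
      = (\<Sum>i\<le>m. \<Sum>j\<le>m. ?k i S * (?k j (toggle i S) * f (toggle j (toggle i S))))"
    by (simp only: fock_op_def sum_distrib_left)
  also have "\<dots> = (\<Sum>i\<le>m. ?k i S * (?k i (toggle i S) * f (toggle i (toggle i S))))"
    by (rule sum_symmetric_char2) (simp add: toggle_commute mult_ac)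
  also have "\<dots> = (\<Sum>i\<le>m. a i * l i * f S)"
    by (intro sum.cong) (auto simp: mult_ac)
  finally show ?thesis by (simp add: sum_distrib_right)
qed

lemma fock_op_anticommute:
  "fock_op m a l (fock_op m a' l' f) S + fock_op m a' l' (fock_op m a l f) S
    = (\<Sum>i\<le>m. a i * l' i + l i * a' i) * f S"
proof -
  let ?k = "\<lambda>i T. if i \<in> T then a i else l i" and ?k' = "\<lambda>i T. if i \<in> T then a' i else l' i"
  have "fock_op m a' l' (fock_op m a l f) S
      = (\<Sum>j\<le>m. \<Sum>i\<le>m. ?k' j S * (?k i (toggle j S) * f (toggle i (toggle j S))))"
    by (simp only: fock_op_def sum_distrib_left)
  also have "\<dots> = (\<Sum>i\<le>m. \<Sum>j\<le>m. ?k' j S * (?k i (toggle j S) * f (toggle i (toggle j S))))"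
    by (rule sum.swap)
  finally have 1: "fock_op m a' l' (fock_op m a l f) S = \<dots>" .
  have 2: "fock_op m a l (fock_op m a' l' f) S
      = (\<Sum>i\<le>m. \<Sum>j\<le>m. ?k i S * (?k' j (toggle i S) * f (toggle j (toggle i S))))"
    by (simp only: fock_op_def sum_distrib_left)
  have t: "?k i S * (?k' j (toggle i S) * f (toggle j (toggle i S)))
      + ?k' j S * (?k i (toggle j S) * f (toggle i (toggle j S)))
      = (if j = i then (a i * l' i + l i * a' i) * f S else 0)" for i j
    by (cases "j = i") (auto simp: toggle_commute mult_ac laurent_2 algebra_simps)
  show ?thesis
    unfolding 1 2 by (simp only: t flip: sum.distrib) (simp add: sum_distrib_right)
qed

definition q_diag :: "nat \<Rightarrow> laurent" where "q_diag i = (if i = 0 then 1 else t_inv)"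

text \<open>Left multiplication of the Clifford algebra, transported to the exterior algebra. The contraction uses
  the upper triangular bilinear form \<open>B\<close> with \<open>B(x, x) = q(x)\<close>; for right multiplication, \<open>right_op\<close>
  below, the transposed form takes its place.\<close>

definition left_op :: "nat \<Rightarrow> vec \<Rightarrow> fock \<Rightarrow> fock" where
  "left_op m v = fock_op m (coord v) (\<lambda>j. q_diag j * coord v j + (\<Sum>i<j. coord v i))"

definition right_op :: "nat \<Rightarrow> vec \<Rightarrow> fock \<Rightarrow> fock" where
  "right_op m v = fock_op m (coord v) (\<lambda>j. q_diag j * coord v j + (\<Sum>i\<in>{j<..m}. coord v i))"

lemma left_op_square: "left_op m v (left_op m v f) S = qform m v * f S"
proof -
  have "(\<Sum>j\<le>m. q_diag j * (coord v j)\<^sup>2) = (coord v 0)\<^sup>2 + (\<Sum>j=1..m. t_inv * (coord v j)\<^sup>2)"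
    by (simp add: q_diag_def sum.atLeast1_atMost_eq atMost_atLeast0 sum.atLeast_Suc_atMost)
  then have "(\<Sum>j\<le>m. coord v j * (q_diag j * coord v j + (\<Sum>i<j. coord v i))) = qform m v"
    by (simp add: qform_def distrib_left sum.distrib sum_distrib_left power2_eq_square mult_ac)
  then show ?thesis by (simp add: left_op_def fock_op_square)
qed

text \<open>Both contributions to the anticommutator equal \<open>B(v, w)\<close>, summed once by rows and once by columns, so they
  cancel; and in characteristic two the anticommutator is the commutator.\<close>

lemma left_right_commute: "left_op m v (right_op m w f) S = right_op m w (left_op m v f) S"
proof -
  have "(\<Sum>j\<le>m. \<Sum>i\<in>{j<..m}. coord v j * coord w i) = (\<Sum>j\<le>m. \<Sum>i\<in>{i\<in>{..m}. j < i}. coord v j * coord w i)"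
    by (intro sum.cong) auto
  also have "\<dots> = (\<Sum>i\<le>m. \<Sum>j\<in>{j\<in>{..m}. j < i}. coord v j * coord w i)"
    by (rule sum.swap_restrict) auto
  also have "\<dots> = (\<Sum>i\<le>m. \<Sum>j<i. coord v j * coord w i)"
    by (intro sum.cong) auto
  finally have "(\<Sum>j\<le>m. coord v j * (q_diag j * coord w j + (\<Sum>i\<in>{j<..m}. coord w i)))
     = (\<Sum>j\<le>m. (q_diag j * coord v j + (\<Sum>i<j. coord v i)) * coord w j)"
    by (simp add: algebra_simps sum.distrib sum_distrib_left sum_distrib_right)
  then have "left_op m v (right_op m w f) S + right_op m w (left_op m v f) S = 0"
    by (simp add: left_op_def right_op_def fock_op_anticommute sum.distrib laurent_2)
  then show ?thesis by (rule laurent_eqI)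
qed

lemma left_op_linear:
  "left_op m v (\<lambda>S. f S + g S) = (\<lambda>S. left_op m v f S + left_op m v g S)"
  "left_op m v (\<lambda>S. r * f S) = (\<lambda>S. r * left_op m v f S)"
  "left_op m (v + w) f = (\<lambda>S. left_op m v f S + left_op m w f S)"
  "left_op m (smul r v) f = (\<lambda>S. r * left_op m v f S)"
  "left_op m v (\<lambda>S. 0) = (\<lambda>S. 0)"
proof -
  show "left_op m (smul r v) f = (\<lambda>S. r * left_op m v f S)"
    unfolding left_op_def fock_op_def sum_distrib_left smul_lookup
    by (intro ext sum.cong) (auto simp: algebra_simps sum_distrib_left)
  show "left_op m (v + w) f = (\<lambda>S. left_op m v f S + left_op m w f S)"
    unfolding left_op_def fock_op_def lookup_add sum.distrib[symmetric]
    by (intro ext sum.cong) (auto simp: algebra_simps sum.distrib)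
qed (auto simp: fun_eq_iff left_op_def fock_op_def algebra_simps sum.distrib sum_distrib_left)

text \<open>The two triangular forms add up to the polar form of \<open>q\<close>. Hence the commutator with \<open>v\<close> in the Clifford
  algebra is contraction with \<open>(v, \<cdot>)\<close>.\<close>

lemma left_right_difference:
  "left_op m v f S + right_op m v f S
    = (\<Sum>j\<in>{..m} - S. (\<Sum>i\<in>{..m} - {j}. coord v i) * f (insert j S))"
proof -
  have s: "(\<Sum>i<j. coord v i) + (\<Sum>i\<in>{j<..m}. coord v i) = (\<Sum>i\<in>{..m} - {j}. coord v i)" if "j \<le> m" for j
  proof -
    have "{..m} - {j} = {..<j} \<union> {j<..m}" using that by auto
    then show ?thesis by (simp add: sum.union_disjoint disjoint_iff)
  qed
  have "left_op m v f S + right_op m v f S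
    = (\<Sum>j\<le>m. if j \<notin> S then (\<Sum>i\<in>{..m} - {j}. coord v i) * f (insert j S) else 0)"
    unfolding left_op_def right_op_def fock_op_def sum.distrib[symmetric]
  proof (rule sum.cong[OF HOL.refl])
    fix j assume "j \<in> {..m}"
    then have j: "j \<le> m" by simp
    show "(if j \<in> S then coord v j else q_diag j * coord v j + (\<Sum>i<j. coord v i)) * f (toggle j S)
        + (if j \<in> S then coord v j else q_diag j * coord v j + (\<Sum>i\<in>{j<..m}. coord v i)) * f (toggle j S)
      = (if j \<notin> S then (\<Sum>i\<in>{..m} - {j}. coord v i) * f (insert j S) else 0)"
    proof (cases "j \<in> S")
      case False
      have "q_diag j * coord v j + (\<Sum>i<j. coord v i) + (q_diag j * coord v j + (\<Sum>i\<in>{j<..m}. coord v i))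
         = (q_diag j * coord v j + q_diag j * coord v j) + ((\<Sum>i<j. coord v i) + (\<Sum>i\<in>{j<..m}. coord v i))"
        by (simp only: add_ac)
      also have "\<dots> = (\<Sum>i\<in>{..m} - {j}. coord v i)" by (simp only: laurent_2 s[OF j] add_0)
      finally show ?thesis using False by (simp add: toggle_def flip: distrib_right)
    qed (simp add: laurent_2)
  qed
  also have "\<dots> = (\<Sum>j\<in>{j\<in>{..m}. j \<notin> S}. (\<Sum>i\<in>{..m} - {j}. coord v i) * f (insert j S))"
    by (rule sum.inter_filter[symmetric]) simp
  also have "{j\<in>{..m}. j \<notin> S} = {..m} - S" by auto
  finally show ?thesis .
qed

definition vacuum :: fock where "vacuum S = (if S = {} then 1 else 0)"

lemma left_op_vacuum:
  "left_op m v vacuum S = (\<Sum>i\<le>m. if S = {i} then coord v i else 0)"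
  "right_op m v vacuum = left_op m v vacuum"
proof -
  have e: "toggle i S = {} \<longleftrightarrow> S = {i}" for i S by (auto simp: toggle_def split: if_splits)
  show "left_op m v vacuum S = (\<Sum>i\<le>m. if S = {i} then coord v i else 0)"
    unfolding left_op_def fock_op_def vacuum_def e by (intro sum.cong) auto
  show "right_op m v vacuum = left_op m v vacuum"
    unfolding left_op_def right_op_def fock_op_def vacuum_def e by (intro ext sum.cong) auto
qed

definition fock_act :: "nat \<Rightarrow> (vec word \<Rightarrow>\<^sub>0 laurent) \<Rightarrow> fock \<Rightarrow> fock" where
  "fock_act m p f S
    = (\<Sum>w\<in>Poly_Mapping.keys p. Poly_Mapping.lookup p w * foldr (left_op m) (letters w) f S)"

lemma fock_act_superset:
  assumes "finite A" "Poly_Mapping.keys p \<subseteq> A"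
  shows "fock_act m p f S = (\<Sum>w\<in>A. Poly_Mapping.lookup p w * foldr (left_op m) (letters w) f S)"
  unfolding fock_act_def
  by (rule sum.mono_neutral_left) (use assms in \<open>auto simp: in_keys_iff\<close>)

lemma fock_act_add: "fock_act m (p + q) f S = fock_act m p f S + fock_act m q f S"
proof -
  let ?A = "Poly_Mapping.keys p \<union> Poly_Mapping.keys q"
  have "Poly_Mapping.keys (p + q) \<subseteq> ?A" by (rule Poly_Mapping.keys_add)
  then show ?thesis
    by (simp add: fock_act_superset[of ?A] lookup_add distrib_right sum.distrib)
qed

lemma fock_act_single:
  "fock_act m (Poly_Mapping.single w r) f S = r * foldr (left_op m) (letters w) f S"
  by (subst fock_act_superset[of "{w}"]) auto

lemma fock_act_zero: "fock_act m 0 f S = 0"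
  by (simp add: fock_act_def)

lemma fock_act_minus: "fock_act m (p - q) f S = fock_act m p f S - fock_act m q f S"
  using fock_act_add[of m "p - q" q f S] by simp

lemma fock_act_one: "fock_act m 1 f = f"
proof
  fix S
  have "fock_act m (Poly_Mapping.single 0 1) f S = f S"
    by (simp add: fock_act_single zero_word_def del: single_one)
  then show "fock_act m 1 f S = f S" by simp
qed

lemma foldr_left_op_linear:
  "foldr (left_op m) ws (\<lambda>S. f S + g S) = (\<lambda>S. foldr (left_op m) ws f S + foldr (left_op m) ws g S)"
  "foldr (left_op m) ws (\<lambda>S. r * f S) = (\<lambda>S. r * foldr (left_op m) ws f S)"
  "foldr (left_op m) ws (\<lambda>S. 0) = (\<lambda>S. 0)"
  by (induction ws) (simp_all add: left_op_linear)

lemma fock_act_mult: "fock_act m (p * q) f S = fock_act m p (fock_act m q f) S"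
proof (induction p rule: single_induct)
  case 1 show ?case by (simp add: fock_act_zero)
next
  case (2 p w r)
  have "fock_act m (Poly_Mapping.single w r * q) f S
      = r * foldr (left_op m) (letters w) (fock_act m q f) S"
  proof (induction q arbitrary: S rule: single_induct)
    case 1
    have "fock_act m 0 f = (\<lambda>S. 0)" by (simp add: fock_act_zero fun_eq_iff)
    then show ?case by (simp add: fock_act_zero foldr_left_op_linear)
  next
    case (2 q w' r')
    have "fock_act m (q + Poly_Mapping.single w' r') f
       = (\<lambda>S. fock_act m q f S + r' * foldr (left_op m) (letters w') f S)"
      by (simp add: fun_eq_iff fock_act_add fock_act_single)
    then show ?case using 2
      by (simp add: distrib_left fock_act_add mult_single fock_act_single foldr_left_op_linear plus_word_def)
  qed
  then show ?case using 2 by (simp add: distrib_right fock_act_add fock_act_single)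
qed

text \<open>Right multiplication commutes with the whole left action because it commutes with each letter.\<close>

lemma fock_act_right_op:
  "fock_act m p (right_op m w f) S = right_op m w (fock_act m p f) S"
proof -
  have c: "foldr (left_op m) ws (right_op m w f) = right_op m w (foldr (left_op m) ws f)" for ws
    by (induction ws) (simp_all add: left_right_commute[THEN ext])
  show ?thesis unfolding fock_act_def c
    unfolding right_op_def fock_op_def sum_distrib_left
    by (subst sum.swap) (simp add: mult_ac)
qed

text \<open>The polynomials acting as zero form an ideal that contains the defining relations of the Clifford
  algebra, so the action depends only on the class.\<close>

lemma fock_act_well_defined:
  assumes "p \<in> carrier (free_algebra (V_mod m))" "q \<in> carrier (free_algebra (V_mod m))"
    and "cl_of (V_mod m) (qform m) p = cl_of (V_mod m) (qform m) q"
  shows "fock_act m p f = fock_act m q f"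
proof -
  let ?F = "free_algebra (V_mod m) :: (vec word \<Rightarrow>\<^sub>0 laurent) ring" and ?C = "clifford (V_mod m) (qform m)"
  let ?K = "{p \<in> carrier ?F. \<forall>f S. fock_act m p f S = 0}"
  note V = V_mod_submodule[of m]
  interpret F: ring ?F by (rule free_algebra_ring)
  interpret C: ring ?C by (rule clifford_ring[OF V])
  interpret h: ring_hom_ring ?F ?C "cl_of (V_mod m) (qform m)"
    by (rule ring_hom_ringI2[OF F.ring_axioms C.ring_axioms cl_of_hom[OF V]])
  have K: "ideal ?K ?F"
  proof (rule free_algebra_idealI, goal_cases)
    case (5 x y)
    have "fock_act m x f = (\<lambda>S. 0)" for f using 5 by auto
    moreover have "fock_act m y (\<lambda>S. 0) S = 0" for S
      by (simp add: fock_act_def foldr_left_op_linear)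
    ultimately have "fock_act m (y * x) f S = 0" "fock_act m (x * y) f S = 0" for f S
      by (simp_all add: fock_act_mult)
    then show ?case using 5 F.m_closed by (simp add: free_algebra_simps)
  qed (use F.zero_closed F.a_closed F.a_inv_closed in
      \<open>auto simp: free_algebra_simps free_algebra_a_inv fock_act_zero fock_act_add fock_act_minus[of m 0, simplified]\<close>)
  have gen: "fock_act m (gen v) f = left_op m v f" and con: "fock_act m (const r) f S = r * f S" for v r f S
    by (simp_all add: fun_eq_iff fock_act_single)
  have t: "tensor_rels (V_mod m) \<subseteq> ?K"
  proof
    fix x :: "vec word \<Rightarrow>\<^sub>0 laurent" assume x: "x \<in> tensor_rels (V_mod m)"
    then have "fock_act m x f S = 0" for f S
      by (auto simp: tensor_rels_def fock_act_minus fock_act_mult gen con left_op_linear)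
    then show "x \<in> ?K" using x tensor_rels_carrier[OF V] by auto
  qed
  have c: "gen w * gen w - const (qform m w) \<in> ?K" if w: "w \<in> V_mod m" for w
    using gen_carrier[OF w] F.m_closed[OF gen_carrier[OF w] gen_carrier[OF w]] const_carrier
    by (auto simp: fock_act_minus fock_act_mult gen con left_op_square free_algebra_simps
        intro!: free_algebra_minus)
  have "cl_of (V_mod m) (qform m) (p \<ominus>\<^bsub>?F\<^esub> q) = \<zero>\<^bsub>?C\<^esub>"
    using assms by (simp add: a_minus_def C.r_neg)
  moreover have "p \<ominus>\<^bsub>?F\<^esub> q = p - q"
    using assms by (simp add: a_minus_def free_algebra_simps free_algebra_a_inv)
  ultimately have "p - q \<in> ?K"
    using cl_of_kernel[OF V K t c, of "p - q"] free_algebra_minus[OF assms(1,2)] by simp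
  then show ?thesis by (simp add: fun_eq_iff fock_act_minus)
qed

section \<open>Normal forms in the Clifford algebra\<close>

abbreviation Free :: "nat \<Rightarrow> (vec word \<Rightarrow>\<^sub>0 laurent) ring" where "Free m \<equiv> free_algebra (V_mod m)"

abbreviation Cliff :: "nat \<Rightarrow> (nat, laurent) cliff ring" where "Cliff m \<equiv> clifford (V_mod m) (qform m)"

abbreviation cl :: "nat \<Rightarrow> (vec word \<Rightarrow>\<^sub>0 laurent) \<Rightarrow> (nat, laurent) cliff" where
  "cl m \<equiv> cl_of (V_mod m) (qform m)"

lemma cl_ring_hom: "ring_hom_ring (Free m) (Cliff m) (cl m)"
  by (intro ring_hom_ringI2 free_algebra_ring clifford_ring cl_of_hom V_mod_submodule)

lemma Free_closed:
  "p \<in> carrier (Free m) \<Longrightarrow> q \<in> carrier (Free m) \<Longrightarrow> p + q \<in> carrier (Free m)"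
  "p \<in> carrier (Free m) \<Longrightarrow> q \<in> carrier (Free m) \<Longrightarrow> p * q \<in> carrier (Free m)"
proof -
  interpret ring "Free m" by (rule free_algebra_ring)
  show "p \<in> carrier (Free m) \<Longrightarrow> q \<in> carrier (Free m) \<Longrightarrow> p + q \<in> carrier (Free m)"
    "p \<in> carrier (Free m) \<Longrightarrow> q \<in> carrier (Free m) \<Longrightarrow> p * q \<in> carrier (Free m)"
    using a_closed[of p q] m_closed[of p q] by (simp_all add: free_algebra_simps)
qed

lemma cl_simps:
  "p \<in> carrier (Free m) \<Longrightarrow> q \<in> carrier (Free m) \<Longrightarrow> cl m (p + q) = cl m p \<oplus>\<^bsub>Cliff m\<^esub> cl m q"
  "p \<in> carrier (Free m) \<Longrightarrow> q \<in> carrier (Free m) \<Longrightarrow> cl m (p * q) = cl m p \<otimes>\<^bsub>Cliff m\<^esub> cl m q"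
  "p \<in> carrier (Free m) \<Longrightarrow> cl m p \<in> carrier (Cliff m)"
  "cl m 1 = \<one>\<^bsub>Cliff m\<^esub>"
proof -
  interpret h: ring_hom_ring "Free m" "Cliff m" "cl m" by (rule cl_ring_hom)
  show "p \<in> carrier (Free m) \<Longrightarrow> q \<in> carrier (Free m) \<Longrightarrow> cl m (p + q) = cl m p \<oplus>\<^bsub>Cliff m\<^esub> cl m q"
  "p \<in> carrier (Free m) \<Longrightarrow> q \<in> carrier (Free m) \<Longrightarrow> cl m (p * q) = cl m p \<otimes>\<^bsub>Cliff m\<^esub> cl m q"
  "p \<in> carrier (Free m) \<Longrightarrow> cl m p \<in> carrier (Cliff m)"
  "cl m 1 = \<one>\<^bsub>Cliff m\<^esub>"
    using h.hom_add[of p q] h.hom_mult[of p q] h.hom_closed[of p] h.hom_one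
    by (simp_all add: free_algebra_simps)
qed

lemma const_commute: "const r * p = p * const (r :: 'r::comm_ring_1)"
  by (induction p rule: single_induct)
    (simp_all add: distrib_left distrib_right mult_single plus_word_def mult.commute)

lemma cl_eq_tensor_rels:
  assumes "p \<in> carrier (Free m)" "q \<in> carrier (Free m)" "p - q \<in> tensor_rels (V_mod m)"
  shows "cl m p = cl m q"
proof -
  interpret F: ring "Free m" by (rule free_algebra_ring)
  interpret T: ideal "tensor_ideal (V_mod m)" "Free m" by (rule tensor_ideal_ideal[OF V_mod_submodule])
  have "p - q \<in> tensor_ideal (V_mod m)"
    using F.genideal_self[OF tensor_rels_carrier[OF V_mod_submodule]] assms
    by (auto simp: tensor_ideal_def tensor_rels_def)
  moreover have "p \<ominus>\<^bsub>Free m\<^esub> q = p - q"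
    using assms by (simp add: a_minus_def free_algebra_simps free_algebra_a_inv)
  ultimately have "tensor_ideal (V_mod m) +>\<^bsub>Free m\<^esub> p = tensor_ideal (V_mod m) +>\<^bsub>Free m\<^esub> q"
    using F.quotient_eq_iff_same_a_r_cos[OF T.is_ideal, of p q] assms by simp
  then show ?thesis by (simp add: cl_of_def)
qed

lemma V_mod_closed:
  "v \<in> V_mod m \<Longrightarrow> w \<in> V_mod m \<Longrightarrow> v + w \<in> V_mod m" "v \<in> V_mod m \<Longrightarrow> smul r v \<in> V_mod m"
  using V_mod_submodule[of m] by (auto simp: submodule_set_def)

lemma cl_gen_add:
  assumes "v \<in> V_mod m" "w \<in> V_mod m"
  shows "cl m (gen (v + w)) = cl m (gen v + gen w)"
proof (rule cl_eq_tensor_rels)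
  have "gen (v + w) - (gen v + gen w) = gen (v + w) - gen v - (gen w :: vec word \<Rightarrow>\<^sub>0 laurent)"
    by simp
  then show "gen (v + w) - (gen v + gen w) \<in> tensor_rels (V_mod m)"
    using assms unfolding tensor_rels_def by auto
qed (intro Free_closed gen_carrier V_mod_closed assms)+

lemma cl_gen_smul:
  assumes "v \<in> V_mod m"
  shows "cl m (gen (smul r v)) = cl m (const r * gen v)"
proof (rule cl_eq_tensor_rels)
  show "gen (smul r v) - const r * gen v \<in> tensor_rels (V_mod m)"
    using assms unfolding tensor_rels_def by auto
qed (intro Free_closed gen_carrier const_carrier V_mod_closed assms)+

lemma cl_square: "v \<in> V_mod m \<Longrightarrow> cl m (gen v * gen v) = cl m (const (qform m v))"
  using cl_vec_square[OF V_mod_submodule, of v m "qform m"]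
  by (simp only: cl_simps gen_carrier cl_of_gen cl_of_const)

lemma cl_double: "p \<in> carrier (Free m) \<Longrightarrow> cl m p \<oplus>\<^bsub>Cliff m\<^esub> cl m p = \<zero>\<^bsub>Cliff m\<^esub>"
proof -
  interpret h: ring_hom_ring "Free m" "Cliff m" "cl m" by (rule cl_ring_hom)
  assume p: "p \<in> carrier (Free m)"
  have "p + p = 0"
    by (rule poly_mapping_eqI) (simp add: lookup_add laurent_2)
  then show ?thesis using h.hom_add[OF p p] h.hom_zero by (simp add: free_algebra_simps)
qed

text \<open>Expand \<open>(v + w)\<^sup>2 = q(v + w)\<close>.\<close>

lemma cl_polarise:
  assumes "v \<in> V_mod m" "w \<in> V_mod m"
  shows "cl m (gen v * gen w) = cl m (gen w * gen v + const (bform m v w))"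
proof -
  interpret h: ring_hom_ring "Free m" "Cliff m" "cl m" by (rule cl_ring_hom)
  let ?v = "cl m (gen v)" and ?w = "cl m (gen w)"
  let ?b = "cl m (const (bform m v w))" and ?qv = "cl m (const (qform m v))" and ?qw = "cl m (const (qform m w))"
  note C = gen_carrier[OF assms(1)] gen_carrier[OF assms(2)] const_carrier
  note c = C[THEN cl_simps(3)]
  have s: "v + w \<in> V_mod m" using assms by (rule V_mod_closed)
  have "(const (qform m (v + w)) :: vec word \<Rightarrow>\<^sub>0 laurent) = const (bform m v w) + (const (qform m v) + const (qform m w))"
    by (simp add: qform_add single_add add_ac)
  then have "cl m (const (qform m (v + w))) = ?b \<oplus>\<^bsub>Cliff m\<^esub> (?qv \<oplus>\<^bsub>Cliff m\<^esub> ?qw)"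
    by (simp only: cl_simps C Free_closed)
  then have "(?v \<oplus>\<^bsub>Cliff m\<^esub> ?w) \<otimes>\<^bsub>Cliff m\<^esub> (?v \<oplus>\<^bsub>Cliff m\<^esub> ?w) = ?b \<oplus>\<^bsub>Cliff m\<^esub> (?qv \<oplus>\<^bsub>Cliff m\<^esub> ?qw)"
    using cl_square[OF s] s by (simp only: cl_simps C gen_carrier cl_gen_add[OF assms] Free_closed)
  moreover have "(?v \<oplus>\<^bsub>Cliff m\<^esub> ?w) \<otimes>\<^bsub>Cliff m\<^esub> (?v \<oplus>\<^bsub>Cliff m\<^esub> ?w)
    = (?v \<otimes>\<^bsub>Cliff m\<^esub> ?w \<oplus>\<^bsub>Cliff m\<^esub> ?w \<otimes>\<^bsub>Cliff m\<^esub> ?v) \<oplus>\<^bsub>Cliff m\<^esub> (?qv \<oplus>\<^bsub>Cliff m\<^esub> ?qw)"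
    using cl_square[OF assms(1)] cl_square[OF assms(2)] c
    by (simp add: cl_simps(2) C h.S.l_distr h.S.r_distr h.S.a_ac)
  ultimately have "?v \<otimes>\<^bsub>Cliff m\<^esub> ?w \<oplus>\<^bsub>Cliff m\<^esub> ?w \<otimes>\<^bsub>Cliff m\<^esub> ?v = ?b"
    using c by (simp add: h.S.add.right_cancel)
  then have "?v \<otimes>\<^bsub>Cliff m\<^esub> ?w \<oplus>\<^bsub>Cliff m\<^esub> (?w \<otimes>\<^bsub>Cliff m\<^esub> ?v \<oplus>\<^bsub>Cliff m\<^esub> ?w \<otimes>\<^bsub>Cliff m\<^esub> ?v) = ?w \<otimes>\<^bsub>Cliff m\<^esub> ?v \<oplus>\<^bsub>Cliff m\<^esub> ?b"
    using c by (metis h.S.a_assoc h.S.a_comm h.S.m_closed)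
  then have "?v \<otimes>\<^bsub>Cliff m\<^esub> ?w = ?w \<otimes>\<^bsub>Cliff m\<^esub> ?v \<oplus>\<^bsub>Cliff m\<^esub> ?b"
    using cl_double[OF Free_closed(2)[OF C(2,1)]] c by (simp add: cl_simps(2) C)
  then show ?thesis by (simp only: cl_simps C Free_closed)
qed

text \<open>Polynomials whose words use the first \<open>k\<close> basis vectors, each at most once and in decreasing order
  of index. As \<open>v_vec 0 = u_vec\<close>, the basis of \<open>V\<close> is \<open>v_vec 0, \<dots>, v_vec m\<close>.\<close>

fun normal_forms :: "nat \<Rightarrow> (vec word \<Rightarrow>\<^sub>0 laurent) set" where
  "normal_forms 0 = range const"
| "normal_forms (Suc k) = {a + gen (v_vec k) * b | a b. a \<in> normal_forms k \<and> b \<in> normal_forms k}"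

lemma v_vec_V_mod: "k \<le> m \<Longrightarrow> v_vec k \<in> V_mod m"
  by (simp add: v_vec_def V_mod_def del: single_one)

lemma normal_forms_carrier: "k \<le> Suc m \<Longrightarrow> a \<in> normal_forms k \<Longrightarrow> a \<in> carrier (Free m)"
  by (induction k arbitrary: a) (auto intro!: const_carrier Free_closed gen_carrier v_vec_V_mod)

lemma normal_forms_const: "const r \<in> normal_forms k"
proof (induction k arbitrary: r)
  case (Suc k)
  have "const r = const r + gen (v_vec k) * const 0" by simp
  then show ?case unfolding normal_forms.simps using Suc[of r] Suc[of 0] by blast
qed simp

lemma normal_forms_add: "a \<in> normal_forms k \<Longrightarrow> b \<in> normal_forms k \<Longrightarrow> a + b \<in> normal_forms k"
proof (induction k arbitrary: a b)
  case 0
  then show ?case by (auto simp flip: single_add)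
next
  case (Suc k)
  obtain a1 a2 b1 b2 where "a1 \<in> normal_forms k" "a2 \<in> normal_forms k" "b1 \<in> normal_forms k" "b2 \<in> normal_forms k"
    and e: "a = a1 + gen (v_vec k) * a2" "b = b1 + gen (v_vec k) * b2" using Suc.prems by auto
  moreover from e have "a + b = (a1 + b1) + gen (v_vec k) * (a2 + b2)" by (simp only: distrib_left add_ac)
  ultimately show ?case unfolding normal_forms.simps using Suc.IH by blast
qed

lemma normal_forms_scale: "a \<in> normal_forms k \<Longrightarrow> const r * a \<in> normal_forms k"
proof (induction k arbitrary: a)
  case 0
  then show ?case by (auto simp: mult_single plus_word_def)
next
  case (Suc k)
  obtain a1 a2 where "a1 \<in> normal_forms k" "a2 \<in> normal_forms k"
    and e: "a = a1 + gen (v_vec k) * a2" using Suc.prems by auto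
  moreover have "const r * a = const r * a1 + gen (v_vec k) * (const r * a2)"
    by (simp only: e distrib_left mult.assoc[symmetric] const_commute[of r "gen (v_vec k)"])
  ultimately show ?case unfolding normal_forms.simps using Suc.IH by blast
qed

lemma cl_cong:
  assumes "cl m p = cl m p'" "cl m q = cl m q'"
    and "p \<in> carrier (Free m)" "p' \<in> carrier (Free m)" "q \<in> carrier (Free m)" "q' \<in> carrier (Free m)"
  shows "cl m (p + q) = cl m (p' + q')" "cl m (p * q) = cl m (p' * q')"
  using assms by (simp_all add: cl_simps)

text \<open>A basis vector is moved to its place by \<open>x\<^sub>j x\<^sub>k = x\<^sub>k x\<^sub>j + (x\<^sub>j, x\<^sub>k)\<close>, and is absorbed by
  \<open>x\<^sub>k x\<^sub>k = q(x\<^sub>k)\<close> if it meets itself.\<close>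

lemma normal_forms_left_basis:
  assumes "j < k" "k \<le> Suc m" "a \<in> normal_forms k"
  shows "\<exists>a' \<in> normal_forms k. cl m (gen (v_vec j) * a) = cl m a'"
  using assms
proof (induction k arbitrary: a)
  case (Suc k)
  note fc = Free_closed gen_carrier v_vec_V_mod const_carrier
  obtain a1 b where ab: "a1 \<in> normal_forms k" "b \<in> normal_forms k" "a = a1 + gen (v_vec k) * b"
    using Suc.prems by auto
  have k: "k \<le> m" "j \<le> m" using Suc.prems by auto
  have c: "a1 \<in> carrier (Free m)" "b \<in> carrier (Free m)"
    using ab normal_forms_carrier[of k m] Suc.prems by auto
  have e: "gen (v_vec j) * a = gen (v_vec j) * a1 + gen (v_vec j) * gen (v_vec k) * b"
    by (simp only: ab distrib_left mult.assoc)
  show ?case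
  proof (cases "j = k")
    case True
    let ?a' = "const (qform m (v_vec k)) * b + gen (v_vec k) * a1"
    have "?a' \<in> normal_forms (Suc k)"
      using ab normal_forms_scale[OF ab(2), of "qform m (v_vec k)"] by auto
    moreover have "cl m (gen (v_vec k) * a1 + gen (v_vec k) * gen (v_vec k) * b)
        = cl m (gen (v_vec k) * a1 + const (qform m (v_vec k)) * b)"
      by (intro cl_cong cl_square v_vec_V_mod fc c k HOL.refl)
    ultimately show ?thesis unfolding e by (metis True add.commute)
  next
    case False
    then have j: "j < k" using Suc.prems by simp
    obtain a1' where a1': "a1' \<in> normal_forms k" "cl m (gen (v_vec j) * a1) = cl m a1'"
      using Suc.IH[OF j _ ab(1)] Suc.prems by auto
    obtain b' where b': "b' \<in> normal_forms k" "cl m (gen (v_vec j) * b) = cl m b'"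
      using Suc.IH[OF j _ ab(2)] Suc.prems by auto
    have c': "a1' \<in> carrier (Free m)" "b' \<in> carrier (Free m)"
      using a1' b' normal_forms_carrier[of k m] Suc.prems by auto
    let ?r = "bform m (v_vec j) (v_vec k)"
    let ?a' = "(a1' + const ?r * b) + gen (v_vec k) * b'"
    have "?a' \<in> normal_forms (Suc k)"
      using normal_forms_add[OF a1'(1) normal_forms_scale[OF ab(2), of ?r]] b' by auto
    moreover have "cl m (gen (v_vec j) * a1 + gen (v_vec j) * gen (v_vec k) * b)
        = cl m (a1' + (gen (v_vec k) * gen (v_vec j) + const ?r) * b)"
      by (intro cl_cong a1' cl_polarise v_vec_V_mod fc c c' k HOL.refl)
    moreover have "cl m (a1' + (gen (v_vec k) * gen (v_vec j) + const ?r) * b)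
        = cl m (a1' + const ?r * b + gen (v_vec k) * (gen (v_vec j) * b))"
      by (simp only: distrib_right mult.assoc add_ac)
    moreover have "cl m (a1' + const ?r * b + gen (v_vec k) * (gen (v_vec j) * b)) = cl m ?a'"
      by (intro cl_cong a1' b' v_vec_V_mod fc c c' k HOL.refl)
    ultimately show ?thesis unfolding e by metis
  qed
qed simp

lemma normal_forms_left_vec:
  assumes "n \<le> Suc m" "Poly_Mapping.keys w \<subseteq> {..<n}" "a \<in> normal_forms (Suc m)"
  shows "\<exists>a' \<in> normal_forms (Suc m). cl m (gen w * a) = cl m a'"
  using assms(1,2)
proof (induction n arbitrary: w)
  case 0
  have a: "a \<in> carrier (Free m)" using normal_forms_carrier[of "Suc m"] assms(3) by blast
  have z: "(0::vec) \<in> V_mod m" by (simp add: V_mod_def)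
  have "smul 0 (0::vec) = 0" by (rule poly_mapping_eqI) (simp add: smul_lookup)
  then have "cl m (gen (0::vec)) = cl m 0" using cl_gen_smul[OF z, of 0] by simp
  moreover have "0 \<in> carrier (Free m)" using const_carrier[of 0] by simp
  ultimately have "cl m (gen 0 * a) = cl m (0 * a)"
    by (intro cl_cong gen_carrier z a HOL.refl)
  moreover have "w = 0" using 0 by simp
  moreover have "0 \<in> normal_forms (Suc m)" using normal_forms_const[of 0 "Suc m"] by (simp only: single_zero)
  ultimately show ?case by (metis mult_zero_left)
next
  case (Suc n)
  note fc = Free_closed gen_carrier v_vec_V_mod const_carrier
  have a: "a \<in> carrier (Free m)" using normal_forms_carrier[of "Suc m"] assms(3) by blast
  define c where "c = coord w n"
  define w' where "w' = Poly_Mapping.update n 0 w"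
  have w: "w = w' + smul c (v_vec n)"
    by (rule poly_mapping_eqI)
      (auto simp: w'_def c_def lookup_add lookup_update smul_lookup v_vec_def lookup_single when_def)
  have n: "n \<le> m" using Suc.prems by simp
  have k: "Poly_Mapping.keys w' \<subseteq> {..<n}" using Suc.prems by (auto simp: w'_def keys_update less_Suc_eq)
  have V: "w' \<in> V_mod m" using k n by (fastforce simp: V_mod_def)
  have V2: "smul c (v_vec n) \<in> V_mod m"
    by (intro V_mod_closed v_vec_V_mod n)
  obtain a1 where a1: "a1 \<in> normal_forms (Suc m)" "cl m (gen w' * a) = cl m a1"
    using Suc.IH[OF _ k] n by auto
  obtain a2 where a2: "a2 \<in> normal_forms (Suc m)" "cl m (gen (v_vec n) * a) = cl m a2"
    using normal_forms_left_basis[of n "Suc m" m a] n assms(3) by auto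
  have c: "a1 \<in> carrier (Free m)" "a2 \<in> carrier (Free m)"
    using normal_forms_carrier[of "Suc m"] a1 a2 by blast+
  have "cl m (gen w) = cl m (gen w' + gen (smul c (v_vec n)))"
    unfolding w by (rule cl_gen_add[OF V V2])
  also have "\<dots> = cl m (gen w' + const c * gen (v_vec n))"
    by (intro cl_cong cl_gen_smul fc V V2 n HOL.refl)
  finally have "cl m (gen w * a) = cl m ((gen w' + const c * gen (v_vec n)) * a)"
    using V_mod_closed(1)[OF V V2, folded w] by (intro cl_cong fc V n a HOL.refl)
  also have "\<dots> = cl m (gen w' * a + const c * (gen (v_vec n) * a))"
    by (simp only: distrib_right mult.assoc)
  also have "\<dots> = cl m (a1 + const c * a2)"
    by (intro cl_cong a1 a2 c fc V V2 n a HOL.refl)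
  finally show ?case using normal_forms_add[OF a1(1) normal_forms_scale[OF a2(1)]] by blast
qed

lemma normal_form_exists:
  assumes "p \<in> carrier (Free m)"
  shows "\<exists>a \<in> normal_forms (Suc m). cl m p = cl m a"
  using assms
proof (induction p rule: update_induct)
  case const
  have "0 \<in> normal_forms (Suc m)" using normal_forms_const[of 0 "Suc m"] by (simp only: single_zero)
  then show ?case by blast
next
  case (update p w r)
  have e: "Poly_Mapping.update w r p = p + Poly_Mapping.single w r"
    using update(1) by (intro poly_mapping_eqI)
      (auto simp: lookup_update lookup_add lookup_single in_keys_iff when_def)
  have p: "p \<in> carrier (Free m)" and w: "set (letters w) \<subseteq> V_mod m"
    using update by (auto simp: free_algebra_def keys_update)
  have s: "Poly_Mapping.single (Word vs) r \<in> carrier (Free m)" if "set vs \<subseteq> V_mod m" for vs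
    using that by (simp add: free_algebra_def)
  have "\<exists>a \<in> normal_forms (Suc m). cl m (Poly_Mapping.single (Word vs) r) = cl m a"
    if "set vs \<subseteq> V_mod m" for vs using that
  proof (induction vs)
    case Nil
    then show ?case using normal_forms_const by blast
  next
    case (Cons v vs)
    obtain a where a: "a \<in> normal_forms (Suc m)" "cl m (Poly_Mapping.single (Word vs) r) = cl m a"
      using Cons by auto
    have "Poly_Mapping.single (Word (v # vs)) r = gen v * Poly_Mapping.single (Word vs) r"
      by (simp add: mult_single plus_word_def)
    also have "cl m \<dots> = cl m (gen v * a)"
      using Cons.prems normal_forms_carrier[OF _ a(1), of m] by (intro cl_cong a gen_carrier s) auto
    finally show ?case
      using normal_forms_left_vec[of "Suc m" m v a] a(1) Cons.prems
      by (auto simp: V_mod_def atLeast0AtMost lessThan_Suc_atMost)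
  qed
  from this[of "letters w"] w obtain a where a: "a \<in> normal_forms (Suc m)" "cl m (Poly_Mapping.single w r) = cl m a"
    by auto
  obtain b where b: "b \<in> normal_forms (Suc m)" "cl m p = cl m b" using update p by blast
  have "cl m (Poly_Mapping.update w r p) = cl m (b + a)" unfolding e
    using a b p s[of "letters w"] w normal_forms_carrier[of "Suc m" m] by (intro cl_cong) auto
  then show ?case using normal_forms_add[OF b(1) a(1)] by blast
qed

text \<open>The bilinear form is upper triangular, so a basis vector of index \<open>k\<close> contracts nothing among the
  smaller indices and acts as pure exterior multiplication.\<close>

lemma left_op_creation:
  assumes "k \<le> m" "\<And>S. f S \<noteq> 0 \<Longrightarrow> S \<subseteq> {..<k}"
  shows "left_op m (v_vec k) f S = (if k \<in> S then f (S - {k}) else 0)"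
proof -
  have "(if i \<in> S then coord (v_vec k) i else q_diag i * coord (v_vec k) i + (\<Sum>j<i. coord (v_vec k) j)) * f (toggle i S)
      = (if i = k then if k \<in> S then f (S - {k}) else 0 else 0)" for i
  proof (cases "i \<in> S")
    case True
    then show ?thesis by (auto simp: v_vec_def lookup_single when_def toggle_def)
  next
    case False
    show ?thesis
    proof (cases "k \<le> i")
      case True
      then have "f (toggle i S) = 0" using assms(2)[of "toggle i S"] False by (auto simp: toggle_def)
      then show ?thesis using False by auto
    next
      case k: False
      then have "(\<Sum>j<i. coord (v_vec k) j) = 0"
        by (intro sum.neutral) (auto simp: v_vec_def lookup_single when_def)
      then show ?thesis using False k by (auto simp: v_vec_def lookup_single when_def)
    qed
  qed
  then have "left_op m (v_vec k) f S = (\<Sum>i\<le>m. if i = k then if k \<in> S then f (S - {k}) else 0 else 0)"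
    unfolding left_op_def fock_op_def by (intro sum.cong HOL.refl)
  then show ?thesis using assms(1) by simp
qed

lemma fock_act_gen_mult: "fock_act m (a + gen v * b) f S = fock_act m a f S + left_op m v (fock_act m b f) S"
  by (simp add: fock_act_add fock_act_mult fock_act_single)

lemma normal_form_support:
  assumes "k \<le> Suc m" "a \<in> normal_forms k" "fock_act m a vacuum S \<noteq> 0"
  shows "S \<subseteq> {..<k}"
  using assms
proof (induction k arbitrary: a S)
  case 0
  then show ?case by (auto simp: fock_act_single vacuum_def split: if_splits)
next
  case (Suc k)
  obtain a1 b where ab: "a1 \<in> normal_forms k" "b \<in> normal_forms k" "a = a1 + gen (v_vec k) * b"
    using Suc.prems by auto
  have "left_op m (v_vec k) (fock_act m b vacuum) S = (if k \<in> S then fock_act m b vacuum (S - {k}) else 0)"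
    using Suc.IH[OF _ ab(2)] Suc.prems by (intro left_op_creation) auto
  then have "fock_act m a1 vacuum S \<noteq> 0 \<or> k \<in> S \<and> fock_act m b vacuum (S - {k}) \<noteq> 0"
    using Suc.prems(3) by (auto simp: ab(3) fock_act_gen_mult split: if_splits)
  then show ?case using Suc.IH[OF _ ab(1)] Suc.IH[OF _ ab(2)] Suc.prems(1) by fastforce
qed

text \<open>Applied to the vacuum, the two parts of \<open>a + x\<^sub>k b\<close> live on sets without and with \<open>k\<close>, so they vanish
  separately.\<close>

lemma normal_form_zero:
  assumes "k \<le> Suc m" "a \<in> normal_forms k" "\<And>S. fock_act m a vacuum S = 0"
  shows "a = 0"
  using assms
proof (induction k arbitrary: a)
  case 0
  then obtain r where r: "a = const r" by auto
  then show ?case using 0(3)[of "{}"] by (simp add: fock_act_single vacuum_def)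
next
  case (Suc k)
  obtain a1 b where ab: "a1 \<in> normal_forms k" "b \<in> normal_forms k" "a = a1 + gen (v_vec k) * b"
    using Suc.prems by auto
  have k: "k \<le> m" "k \<le> Suc m" using Suc.prems by auto
  note supp = normal_form_support[OF k(2) ab(1)] normal_form_support[OF k(2) ab(2)]
  have z: "fock_act m a1 vacuum S + (if k \<in> S then fock_act m b vacuum (S - {k}) else 0) = 0" for S
    using Suc.prems(3)[of S] left_op_creation[OF k(1) supp(2), where S = S]
    by (simp add: ab(3) fock_act_gen_mult)
  have a1: "fock_act m a1 vacuum S = 0" for S
    using supp(1)[where S = S] z[of S] by (cases "k \<in> S") auto
  have "fock_act m b vacuum S = 0" for S
    using a1[of "insert k S"] z[of "insert k S"] supp(2)[where S = S] by (cases "k \<in> S") auto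
  then show ?case using Suc.IH[OF k(2) ab(1) a1] Suc.IH[OF k(2) ab(2)] by (simp add: ab(3))
qed

text \<open>Every class has a normal form, and a normal form is determined by its effect on the vacuum.\<close>

lemma fock_act_faithful:
  assumes "p \<in> carrier (Free m)" "q \<in> carrier (Free m)"
    and "fock_act m p vacuum = fock_act m q vacuum"
  shows "cl m p = cl m q"
proof -
  interpret h: ring_hom_ring "Free m" "Cliff m" "cl m" by (rule cl_ring_hom)
  have d: "p - q \<in> carrier (Free m)" by (rule free_algebra_minus[OF assms(1,2)])
  obtain a where a: "a \<in> normal_forms (Suc m)" "cl m (p - q) = cl m a"
    using normal_form_exists[OF d] by blast
  have ac: "a \<in> carrier (Free m)" using normal_forms_carrier[OF _ a(1)] by simp
  have "fock_act m a vacuum S = 0" for S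
    using fock_act_well_defined[OF d ac a(2), of vacuum] assms(3)
    by (metis fock_act_minus diff_self)
  then have "a = 0" using normal_form_zero[OF le_refl a(1)] by blast
  then have "cl m (p - q) = \<zero>\<^bsub>Cliff m\<^esub>" using a h.hom_zero by (simp add: free_algebra_simps)
  then have "cl m (p - q + q) = cl m q" using d assms by (simp only: cl_simps h.S.l_zero)
  then show ?thesis by simp
qed

section \<open>Products of reflections\<close>

text \<open>Maps act on the right, so the reflection in the first vector of the list is applied first.\<close>

definition reflect :: "nat \<Rightarrow> vec list \<Rightarrow> vec \<Rightarrow> vec" where
  "reflect m = fold (\<lambda>w v. v + smul (bform m v w) w)"

lemma reflect_V_mod: "set ws \<subseteq> V_mod m \<Longrightarrow> v \<in> V_mod m \<Longrightarrow> reflect m ws v \<in> V_mod m"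
  by (induction ws arbitrary: v) (auto simp: reflect_def V_mod_closed)

lemma reflect_append: "reflect m (ws @ ws') v = reflect m ws' (reflect m ws v)"
  by (simp add: reflect_def)

abbreviation monomial :: "vec list \<Rightarrow> (vec word \<Rightarrow>\<^sub>0 laurent)" where
  "monomial ws \<equiv> Poly_Mapping.single (Word ws) 1"

lemma monomial_append: "monomial (ws @ ws') = monomial ws * monomial ws'"
  by (simp add: mult_single plus_word_def)

lemma monomial_Cons: "monomial (w # ws) = gen w * monomial ws"
  by (simp add: mult_single plus_word_def)

lemma monomial_Nil: "monomial [] = 1"
  using single_one[where ?'a = "vec word" and ?'b = laurent] by (simp only: zero_word_def)

lemma monomial_carrier: "set ws \<subseteq> V_mod m \<Longrightarrow> monomial ws \<in> carrier (Free m)"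
  by (simp add: free_algebra_def)

text \<open>For \<open>q(w) = 1\<close> the relation \<open>v w = w v + (v, w)\<close> reads \<open>v w = w (v + (v, w) w)\<close>: moving \<open>v\<close> past
  \<open>w\<close> reflects it.\<close>

lemma monomial_conjugation:
  assumes "set ws \<subseteq> {w \<in> V_mod m. qform m w = 1}" "v \<in> V_mod m"
  shows "cl m (gen v * monomial ws) = cl m (monomial ws * gen (reflect m ws v))"
  using assms
proof (induction ws arbitrary: v)
  case Nil
  then show ?case by (simp add: monomial_Nil reflect_def)
next
  case (Cons w ws)
  let ?v = "v + smul (bform m v w) w"
  have w: "w \<in> V_mod m" "qform m w = 1" and ws: "set ws \<subseteq> V_mod m" and v: "v \<in> V_mod m"
    using Cons.prems by auto
  have v': "?v \<in> V_mod m" by (intro V_mod_closed v w)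
  note fc = Free_closed gen_carrier const_carrier monomial_carrier[OF ws] V_mod_closed v w v'
    reflect_V_mod ws
  have "cl m (gen w * gen ?v) = cl m (gen w * (gen v + const (bform m v w) * gen w))"
    using cl_gen_add[OF v V_mod_closed(2)[OF w(1)]] cl_gen_smul[OF w(1)]
    by (simp add: cl_simps fc)
  also have "\<dots> = cl m (gen w * gen v + const (bform m v w) * (gen w * gen w))"
    by (simp only: distrib_left mult.assoc[symmetric] const_commute[of "bform m v w" "gen w", symmetric])
  also have "\<dots> = cl m (gen w * gen v + const (bform m v w) * const 1)"
    using cl_square[OF w(1)] by (intro cl_cong fc HOL.refl) (simp add: w(2))
  also have "\<dots> = cl m (gen v * gen w)"
    using cl_polarise[OF v w(1)] by (simp add: mult_single plus_word_def)
  finally have r: "cl m (gen v * gen w) = cl m (gen w * gen ?v)" by simp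
  have "cl m (gen v * monomial (w # ws)) = cl m (gen v * gen w * monomial ws)"
    by (simp only: monomial_Cons[of w ws] mult.assoc)
  also have "\<dots> = cl m (gen w * gen ?v * monomial ws)"
    by (intro cl_cong r fc HOL.refl)
  also have "\<dots> = cl m (gen w * (gen ?v * monomial ws))" by (simp only: mult.assoc)
  also have "\<dots> = cl m (gen w * (monomial ws * gen (reflect m ws ?v)))"
    using Cons.prems by (intro cl_cong Cons.IH fc HOL.refl) auto
  also have "\<dots> = cl m (monomial (w # ws) * gen (reflect m (w # ws) v))"
    by (simp add: monomial_Cons[of w ws] mult.assoc reflect_def del: single_one)
  finally show ?case .
qed

lemma monomial_unit:
  assumes "set ws \<subseteq> {w \<in> V_mod m. qform m w = 1}"
  shows "cl m (monomial ws) \<in> Units (Cliff m)"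
  using assms
proof (induction ws)
  case Nil
  interpret C: ring "Cliff m" by (rule clifford_ring[OF V_mod_submodule])
  show ?case by (simp add: monomial_Nil cl_simps)
next
  case (Cons w ws)
  interpret C: ring "Cliff m" by (rule clifford_ring[OF V_mod_submodule])
  have w: "w \<in> V_mod m" "qform m w = 1" and ws: "set ws \<subseteq> V_mod m" using Cons.prems by auto
  have "cl m (gen w) \<otimes>\<^bsub>Cliff m\<^esub> cl m (gen w) = \<one>\<^bsub>Cliff m\<^esub>"
    using cl_square[OF w(1)] w monomial_Nil by (simp add: cl_simps gen_carrier)
  then have "cl m (gen w) \<in> Units (Cliff m)"
    using cl_simps(3)[OF gen_carrier[OF w(1)]] by (auto simp: Units_def)
  then show ?case
    using Cons w ws unfolding monomial_Cons[of w ws]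
    by (simp add: cl_simps(2) gen_carrier monomial_carrier)
qed

text \<open>A vector is recovered from its action on the vacuum, whose coefficient at \<open>{i}\<close> is the \<open>i\<close>-th coordinate.\<close>

lemma cl_vec_inj: "inj_on (cl_vec (V_mod m) (qform m)) (V_mod m)"
proof (rule inj_onI)
  fix v w assume vw: "v \<in> V_mod m" "w \<in> V_mod m"
    and e: "cl_vec (V_mod m) (qform m) v = cl_vec (V_mod m) (qform m) w"
  have "fock_act m (gen v) vacuum = fock_act m (gen w) vacuum"
    by (rule fock_act_well_defined) (use e vw in \<open>simp_all add: gen_carrier cl_of_gen\<close>)
  then have e: "left_op m v vacuum {i} = left_op m w vacuum {i}" for i
    by (metis fock_act_gen_mult[of m 0] fock_act_one fock_act_zero add_0 mult.right_neutral)
  then have l: "coord v i = coord w i" if "i \<le> m" for i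
    using that e[of i] by (simp add: left_op_vacuum(1))
  show "v = w"
  proof (rule poly_mapping_eqI)
    fix i
    show "coord v i = coord w i"
    proof (cases "i \<le> m")
      case False
      then have "i \<notin> Poly_Mapping.keys v" "i \<notin> Poly_Mapping.keys w" using vw by (auto simp: V_mod_def)
      then show ?thesis by (simp add: in_keys_iff)
    qed (rule l)
  qed
qed

lemma pin_map_monomial:
  assumes "set ws \<subseteq> {w \<in> V_mod m. qform m w = 1}"
  shows "pin_map (V_mod m) (qform m) (cl m (monomial ws)) = (\<lambda>v\<in>V_mod m. reflect m ws v)"
proof -
  interpret C: ring "Cliff m" by (rule clifford_ring[OF V_mod_submodule])
  let ?c = "cl m (monomial ws)"
  have ws: "set ws \<subseteq> V_mod m" using assms by auto
  have "the_inv_into (V_mod m) (cl_vec (V_mod m) (qform m))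
      (conj_by (Cliff m) (cl_vec (V_mod m) (qform m) v) ?c) = reflect m ws v" if v: "v \<in> V_mod m" for v
  proof -
    note c = gen_carrier[OF v] gen_carrier[OF reflect_V_mod[OF ws v]] monomial_carrier[OF ws]
    have "cl m (gen v) \<otimes>\<^bsub>Cliff m\<^esub> ?c = ?c \<otimes>\<^bsub>Cliff m\<^esub> cl m (gen (reflect m ws v))"
      using monomial_conjugation[OF assms v] by (simp only: cl_simps c)
    then have "conj_by (Cliff m) (cl m (gen v)) ?c = cl m (gen (reflect m ws v))"
      using monomial_unit[OF assms] c[THEN cl_simps(3)]
      by (simp add: conj_by_def C.m_assoc C.Units_inv_closed) (simp flip: C.m_assoc add: C.Units_l_inv)
    then show ?thesis
      using the_inv_into_f_f[OF cl_vec_inj reflect_V_mod[OF ws v]] by (simp add: cl_of_gen)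
  qed
  then show ?thesis by (auto simp: pin_map_def fun_eq_iff restrict_def)
qed

text \<open>The vector \<open>s v\<^sub>1\<close> replaces \<open>v\<^sub>1\<close>: it defines the same reflection and has norm \<open>s\<^sup>2 t\<^sup>-\<^sup>1 = 1\<close>. This is
  where the factor \<open>s\<close> in the image of \<open>a\<close> comes from.\<close>

definition reflection_vectors :: "nat \<Rightarrow> vec set" where
  "reflection_vectors m = {u_vec, smul s_var (v_vec 1)} \<union> {v_vec i + v_vec (i + 1) | i. 1 \<le> i \<and> i \<le> m - 1}"

lemma reflection_vectors_norm:
  assumes "m \<ge> 2" "w \<in> reflection_vectors m"
  shows "w \<in> V_mod m \<and> qform m w = 1"
proof -
  have u: "u_vec \<in> V_mod m" using v_vec_V_mod[of 0 m] by (simp add: u_vec_def v_vec_def)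
  consider "w = u_vec" | "w = smul s_var (v_vec 1)" | i where "1 \<le> i" "i \<le> m - 1" "w = v_vec i + v_vec (i + 1)"
    using assms by (auto simp: reflection_vectors_def)
  then show ?thesis
  proof cases
    case 1 then show ?thesis using u by (simp add: qform_values)
  next
    case 2 then show ?thesis
      using assms t_var_t_inv by (simp add: V_mod_closed v_vec_V_mod qform_smul qform_values t_var_def)
  next
    case 3 then show ?thesis
      using assms by (simp add: V_mod_closed v_vec_V_mod qform_add qform_values bform_values laurent_2)
  qed
qed

section \<open>Parity by specialisation to \<open>s = 1\<close>\<close>

(* With these rewrite rules the simplifier would replace the ring operations by Boolean ones,
   out of reach of the algebraic laws for sums. *)
declare add_bit_eq_xor [simp del] mult_bit_eq_and [simp del]

definition eval_one :: "laurent \<Rightarrow> bit" where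
  "eval_one p = (\<Sum>k\<in>Poly_Mapping.keys p. Poly_Mapping.lookup p k)"

lemma eval_one_single: "eval_one (Poly_Mapping.single k r) = r"
  by (cases "r = 0") (simp_all add: eval_one_def)

lemma eval_one_add: "eval_one (p + q) = eval_one p + eval_one q"
proof -
  let ?A = "Poly_Mapping.keys p \<union> Poly_Mapping.keys q"
  have e: "eval_one r = (\<Sum>k\<in>?A. Poly_Mapping.lookup r k)" if "Poly_Mapping.keys r \<subseteq> ?A" for r
    unfolding eval_one_def by (rule sum.mono_neutral_left) (use that in \<open>auto simp: in_keys_iff\<close>)
  show ?thesis
    using e[of p] e[of q] e[OF Poly_Mapping.keys_add] by (simp add: lookup_add sum.distrib)
qed

lemma eval_one_mult: "eval_one (p * q) = eval_one p * eval_one q"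
proof (induction p rule: single_induct)
  case 1 show ?case by (simp add: eval_one_def)
next
  case (2 p w r)
  have "eval_one (Poly_Mapping.single w r * q) = r * eval_one q"
    by (induction q rule: single_induct) (simp_all add: eval_one_add eval_one_single mult_single distrib_left eval_one_def[of 0])
  then show ?case using 2 by (simp add: distrib_right eval_one_add eval_one_single)
qed

lemma eval_one_sum: "eval_one (sum f A) = (\<Sum>x\<in>A. eval_one (f x))"
  by (induction A rule: infinite_finite_induct) (simp_all add: eval_one_add eval_one_def[of 0])

lemma bit_double: "(x::bit) + x = 0"
  by (cases x) simp_all

text \<open>The \<open>m + 2\<close> functionals obtained at \<open>s = 1\<close> from the coordinates and from their sum. They are the
  coordinate functions of \<open>GF(2)\<^sup>m\<^sup>+\<^sup>2\<close> restricted to the subspace of vectors of even weight, where \<open>u\<close>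
  and the \<open>v\<^sub>i\<close> correspond to the sums of the last standard vector with the others.\<close>

definition weight :: "nat \<Rightarrow> nat \<Rightarrow> vec \<Rightarrow> bit" where
  "weight m i v = (if i \<le> m then eval_one (coord v i) else (\<Sum>j\<le>m. eval_one (coord v j)))"

text \<open>In characteristic two the Gram matrix is the all-ones matrix plus the identity.\<close>

lemma eval_one_bform:
  "eval_one (bform m v w) = weight m (Suc m) v * weight m (Suc m) w + (\<Sum>i\<le>m. eval_one (coord v i) * eval_one (coord w i))"
proof -
  have "(\<Sum>j\<in>{..m} - {i}. eval_one (coord w j)) = weight m (Suc m) w + eval_one (coord w i)" if "i \<le> m" for i
    using that sum.remove[of "{..m}" i "\<lambda>j. eval_one (coord w j)"] bit_double
    by (simp add: weight_def add.commute add.left_commute)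
  then have "eval_one (bform m v w) = (\<Sum>i\<le>m. eval_one (coord v i) * (weight m (Suc m) w + eval_one (coord w i)))"
    by (simp add: bform_def eval_one_sum eval_one_mult flip: sum_distrib_left)
  then show ?thesis
    by (simp add: distrib_left sum.distrib sum_distrib_right weight_def[of m "Suc m" v])
qed

lemma weight_reflection:
  "weight m i (v + smul (bform m v w) w) = weight m i v + eval_one (bform m v w) * weight m i w"
  by (simp add: weight_def lookup_add smul_lookup eval_one_add eval_one_mult sum.distrib sum_distrib_left)

text \<open>A vector that reduces to a basis vector \<open>x\<^sub>a\<close> exchanges the \<open>a\<close>-th coordinate with the sum of all
  coordinates; one that reduces to \<open>x\<^sub>a + x\<^sub>b\<close> exchanges the coordinates \<open>a\<close> and \<open>b\<close>.\<close>

lemma reflection_transposes_weights: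
  assumes "m \<ge> 2" "w \<in> reflection_vectors m"
  obtains a b where "a \<le> Suc m" "b \<le> Suc m" "a \<noteq> b"
    "\<And>i v. i \<le> Suc m \<Longrightarrow> weight m i (v + smul (bform m v w) w) = weight m (transpose a b i) v"
proof -
  note witness = that
  have s: "eval_one s_var = 1" by (simp add: s_var_def eval_one_single)
  have one: "eval_one 1 = 1" using eval_one_single[of 0 1] by simp
  have zero: "eval_one 0 = 0" by (simp add: eval_one_def)
  \<comment> \<open>the vectors \<open>u\<close> and \<open>s v\<^sub>1\<close>; index \<open>Suc m\<close> is the sum of all coordinates\<close>
  have vertex: thesis if a: "a \<le> m" "\<And>i. eval_one (coord w i) = (if i = a then 1 else 0)" for a
  proof (rule witness[of a "Suc m"])
    fix i v assume "i \<le> Suc m"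
    have "weight m i w = (if i = a \<or> i = Suc m then 1 else 0)" if "i \<le> Suc m" for i
      using that a by (auto simp: weight_def)
    moreover have "eval_one (bform m v w) = weight m (Suc m) v + weight m a v"
      using a(1) by (simp add: eval_one_bform weight_def a(2) if_distrib[of "(*) _"] cong: if_cong)
    ultimately show "weight m i (v + smul (bform m v w) w) = weight m (transpose a (Suc m) i) v"
      using \<open>i \<le> Suc m\<close> unfolding weight_reflection
      by (auto simp: transpose_def bit_double add.left_commute)
  qed (use a in auto)
  \<comment> \<open>the vectors \<open>v\<^sub>i + v\<^sub>i\<^sub>+\<^sub>1\<close>\<close>
  have edge: thesis
    if ab: "a \<le> m" "b \<le> m" "a \<noteq> b" "\<And>i. eval_one (coord w i) = (if i = a \<or> i = b then 1 else 0)" for a b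
  proof (rule witness[of a b])
    fix i v assume "i \<le> Suc m"
    have e: "(if i = a \<or> i = b then 1 else 0) = (if i = a then 1 else 0) + (if i = b then 1 else (0::bit))" for i
      using ab(3) by auto
    have "weight m i w = (if i = a \<or> i = b then 1 else 0)" if "i \<le> Suc m" for i
      using that ab by (auto simp: weight_def e sum.distrib bit_double)
    moreover have "eval_one (bform m v w) = weight m a v + weight m b v"
      using ab(1,2) by (simp add: eval_one_bform weight_def ab(4) e sum.distrib distrib_left
          if_distrib[of "(*) _"] bit_double cong: if_cong)
    ultimately show "weight m i (v + smul (bform m v w) w) = weight m (transpose a b i) v"
      using \<open>i \<le> Suc m\<close> unfolding weight_reflection
      by (auto simp: transpose_def bit_double add.left_commute simp flip: add.assoc)
  qed (use ab in auto)
  consider "w = u_vec" | "w = smul s_var (v_vec 1)" | i where "1 \<le> i" "i \<le> m - 1" "w = v_vec i + v_vec (i + 1)"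
    using assms by (auto simp: reflection_vectors_def)
  then show thesis
  proof cases
    case 1
    then show thesis by (intro vertex[of 0]) (auto simp: u_vec_def lookup_single when_def one zero simp del: single_one)
  next
    case 2
    then show thesis using assms(1)
      by (intro vertex[of 1]) (auto simp: v_vec_def smul_lookup lookup_single when_def one zero s simp del: single_one)
  next
    case (3 i)
    then show thesis using assms(1)
      by (intro edge[of i "i + 1"])
        (auto simp: v_vec_def lookup_add lookup_single when_def one zero simp del: single_one)
  qed
qed

lemma reflect_permutes_weights:
  assumes "m \<ge> 2" "set ws \<subseteq> reflection_vectors m"
  shows "\<exists>\<sigma>. \<sigma> permutes {..Suc m} \<and> sign \<sigma> = (- 1) ^ length ws
    \<and> (\<forall>v. \<forall>i\<le>Suc m. weight m i (reflect m ws v) = weight m (\<sigma> i) v)"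
  using assms(2)
proof (induction ws)
  case Nil
  show ?case by (intro exI[of _ id] conjI permutes_id) (simp_all add: reflect_def)
next
  case (Cons w ws)
  obtain \<sigma> where \<sigma>: "\<sigma> permutes {..Suc m}" "sign \<sigma> = (- 1) ^ length ws"
    "\<And>v i. i \<le> Suc m \<Longrightarrow> weight m i (reflect m ws v) = weight m (\<sigma> i) v" using Cons by auto
  have w: "w \<in> reflection_vectors m" using Cons.prems by simp
  obtain a b where ab: "a \<le> Suc m" "b \<le> Suc m" "a \<noteq> b"
    "\<And>i v. i \<le> Suc m \<Longrightarrow> weight m i (v + smul (bform m v w) w) = weight m (transpose a b i) v"
    using reflection_transposes_weights[OF assms(1) w] by metis
  have "transpose a b \<circ> \<sigma> permutes {..Suc m}"
    using \<sigma>(1) ab by (intro permutes_compose permutes_swap_id) auto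
  moreover have "sign (transpose a b \<circ> \<sigma>) = (- 1) ^ length (w # ws)"
    using \<sigma>(1,2) ab(3) permutation_permutes[of \<sigma>]
    by (subst sign_compose) (auto simp: permutation_swap_id sign_swap_id)
  moreover have "weight m i (reflect m (w # ws) v) = weight m ((transpose a b \<circ> \<sigma>) i) v" if "i \<le> Suc m" for v i
    using that \<sigma>(3) ab(4)[of "\<sigma> i"] permutes_in_image[OF \<sigma>(1), of i] by (simp add: reflect_def)
  ultimately show ?case by blast
qed

text \<open>The weights are pairwise distinct, so a trivial product of reflections induces the trivial
  permutation, whose sign is \<open>1\<close>.\<close>

lemma reflect_trivial_even:
  assumes "m \<ge> 2" "set ws \<subseteq> reflection_vectors m" "\<And>v. v \<in> V_mod m \<Longrightarrow> reflect m ws v = v"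
  shows "even (length ws)"
proof -
  obtain \<sigma> where \<sigma>: "\<sigma> permutes {..Suc m}" "sign \<sigma> = (- 1) ^ length ws"
    "\<And>v i. i \<le> Suc m \<Longrightarrow> weight m i (reflect m ws v) = weight m (\<sigma> i) v"
    using reflect_permutes_weights[OF assms(1,2)] by blast
  have e: "weight m i (v_vec j) = (if i = j \<or> i = Suc m then 1 else 0)" if "i \<le> Suc m" "j \<le> m" for i j
  proof -
    have one: "eval_one 1 = 1" using eval_one_single[of 0 1] by simp
    have "eval_one (coord (v_vec j) k) = (if k = j then 1 else 0)" for k
      by (auto simp: v_vec_def lookup_single when_def one eval_one_def[of 0] simp del: single_one)
    then show ?thesis using that by (auto simp: weight_def)
  qed
  have "\<sigma> i = i" for i
  proof (cases "i \<le> Suc m")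
    case True
    then have s: "\<sigma> i \<le> Suc m" using permutes_in_image[OF \<sigma>(1), of i] by simp
    have "weight m i (v_vec j) = weight m (\<sigma> i) (v_vec j)" if "j \<le> m" for j
      using \<sigma>(3)[OF True, of "v_vec j"] assms(3)[OF v_vec_V_mod[OF that]] by simp
    then have h: "(i = j \<or> i = Suc m) = (\<sigma> i = j \<or> \<sigma> i = Suc m)" if "j \<le> m" for j
      using that True s e by (metis zero_neq_one)
    \<comment> \<open>basis vectors separate two coordinates; to separate a coordinate from their sum, a second basis
      vector is available because \<open>m \<ge> 1\<close>\<close>
    show ?thesis
      using h[of 0] h[of 1] h[of i] h[of "\<sigma> i"] s True assms(1) by auto
  next
    case False
    then show ?thesis using \<sigma>(1) by (simp add: permutes_not_in)
  qed
  then have "\<sigma> = id" by auto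
  then show ?thesis using \<sigma>(2) by (metis sign_id neg_one_odd_power one_neq_neg_one)
qed

section \<open>Central even elements\<close>

lemma card_toggle_parity: "finite S \<Longrightarrow> even (card (toggle i S)) \<longleftrightarrow> odd (card S)"
  by (cases "i \<in> S") (simp_all add: toggle_def card.remove[of S i] del: card_Diff_insert)

text \<open>Each letter toggles one index, which flips the parity of the cardinality.\<close>

lemma foldr_left_op_support:
  assumes "foldr (left_op m) ws vacuum S \<noteq> 0"
  shows "S \<subseteq> {..m} \<and> (even (card S) \<longleftrightarrow> even (length ws))"
  using assms
proof (induction ws arbitrary: S)
  case Nil
  then show ?case by (simp add: vacuum_def split: if_splits)
next
  case (Cons w ws)
  obtain i where i: "i \<le> m" "foldr (left_op m) ws vacuum (toggle i S) \<noteq> 0"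
    using Cons.prems unfolding left_op_def fock_op_def foldr.simps o_apply
    by (metis (no_types, lifting) atMost_iff mult_zero_right sum.neutral)
  have t: "toggle i S \<subseteq> {..m}" "even (card (toggle i S)) \<longleftrightarrow> even (length ws)"
    using Cons.IH[OF i(2)] by auto
  have "S \<subseteq> {..m}" using t(1) i(1) by (auto simp: toggle_def split: if_splits)
  moreover from this have "finite S" using finite_subset by blast
  ultimately show ?case using t(2) card_toggle_parity by auto
qed

lemma cl_rev_scalar: "cl_rev (cl m (const r)) = cl m (const r)"
  using anti_inv.f_coset[OF tensor_anti_inv[OF V_mod_submodule] clifford_ideal_ideal[OF V_mod_submodule]
      clifford_ideal_stable[OF V_mod_submodule] tensor_carrier(2)[OF V_mod_submodule], of m "qform m" r]
  by (simp add: cl_rev_def cl_of_const cl_scalar_def rev_tensor(2)[OF V_mod_submodule])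

text \<open>Let \<open>g\<close> be the image of the vacuum. Commuting with \<open>x\<^sub>i + x\<^sub>j\<close> forces \<open>g(S \<union> {j}) = 0\<close> for \<open>i \<in> S\<close> and
  \<open>j \<notin> S\<close>, because the functional \<open>(x\<^sub>i + x\<^sub>j, \<cdot>)\<close> sees only the indices \<open>i\<close> and \<open>j\<close>. So \<open>g\<close> vanishes on sets
  with two or more elements, and on singletons by parity. Only the coefficient at the empty set is left,
  as for a scalar.\<close>

lemma even_central_monomial:
  assumes ws: "set ws \<subseteq> V_mod m" and even: "even (length ws)"
    and central: "\<And>v. v \<in> V_mod m \<Longrightarrow> cl m (gen v * monomial ws) = cl m (monomial ws * gen v)"
  shows "\<exists>r. cl m (monomial ws) = cl m (const r)"
proof -
  define g where "g = fock_act m (monomial ws) vacuum"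
  have g: "g = foldr (left_op m) ws vacuum" by (simp add: g_def fun_eq_iff fock_act_single)
  have LR: "left_op m v g = right_op m v g" if v: "v \<in> V_mod m" for v
  proof
    fix S
    note c = gen_carrier[OF v] monomial_carrier[OF ws]
    have gen: "fock_act m (gen v) f = left_op m v f" for f by (simp add: fun_eq_iff fock_act_single)
    have "left_op m v g S = fock_act m (gen v * monomial ws) vacuum S"
      by (simp only: fock_act_mult gen g_def)
    also have "\<dots> = fock_act m (monomial ws * gen v) vacuum S"
      using fock_act_well_defined[OF Free_closed(2)[OF c] Free_closed(2)[OF c(2,1)] central[OF v]] by metis
    also have "\<dots> = right_op m v g S"
      by (simp only: fock_act_mult gen g_def left_op_vacuum(2)[symmetric] fock_act_right_op)
    finally show "left_op m v g S = right_op m v g S" .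
  qed
  have two: "g T = 0" if ij: "i \<in> T" "j \<in> T" "i \<noteq> j" "T \<subseteq> {..m}" for i j T
  proof -
    let ?v = "v_vec i + v_vec j"
    have m: "i \<le> m" "j \<le> m" using ij by auto
    have c: "(\<Sum>l\<in>{..m} - {k}. coord ?v l) = (if k = j then 1 else 0)" if k: "k \<in> {..m} - (T - {j})" for k
    proof -
      have e: "(\<Sum>l\<in>{..m} - {k}. coord (v_vec p) l) = (if k = p then 0 else 1)" if "p \<le> m" for p
        using that by (auto simp: v_vec_def lookup_single when_def simp del: single_one)
      have "k \<noteq> i" using k ij by auto
      then show ?thesis unfolding lookup_add sum.distrib e[OF m(1)] e[OF m(2)] by (simp add: laurent_2)
    qed
    have "left_op m ?v g (T - {j}) + right_op m ?v g (T - {j}) = 0"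
      using LR[of ?v] m by (simp add: V_mod_closed v_vec_V_mod laurent_2)
    then have "(\<Sum>k\<in>{..m} - (T - {j}). (\<Sum>l\<in>{..m} - {k}. coord ?v l) * g (insert k (T - {j}))) = 0"
      by (simp only: left_right_difference)
    moreover have "(\<Sum>k\<in>{..m} - (T - {j}). (\<Sum>l\<in>{..m} - {k}. coord ?v l) * g (insert k (T - {j})))
       = (\<Sum>k\<in>{..m} - (T - {j}). if k = j then g (insert k (T - {j})) else 0)"
      by (rule sum.cong[OF HOL.refl]) (simp add: c)
    ultimately show ?thesis using ij m by (simp add: insert_absorb)
  qed
  have z: "g T = 0" if T: "T \<noteq> {}" for T
  proof (rule ccontr)
    assume nz: "g T \<noteq> 0"
    then have s: "T \<subseteq> {..m}" "even (card T)" using foldr_left_op_support even by (auto simp: g)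
    have f: "finite T" using s(1) finite_subset by blast
    have "card T \<noteq> 1" "card T \<noteq> 0" using s(2) T f by auto
    then have "\<not> card T \<le> Suc 0" by linarith
    then obtain i j where "i \<in> T" "j \<in> T" "i \<noteq> j" using card_le_Suc0_iff_eq[OF f] by blast
    then show False using two s(1) nz by blast
  qed
  have "fock_act m (monomial ws) vacuum = fock_act m (const (g {})) vacuum"
    using z by (auto simp: g_def[symmetric] fun_eq_iff fock_act_single vacuum_def)
  then show ?thesis
    using fock_act_faithful[OF monomial_carrier[OF ws] const_carrier] by blast
qed

text \<open>The element is even and central, hence a scalar \<open>r\<close>, and the Pin condition becomes \<open>r\<^sup>2 = 1\<close>. Then
  \<open>(r + 1)\<^sup>2 = 0\<close>, and Laurent polynomials over a field have no zero divisors.\<close>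

lemma pin_kernel_trivial:
  assumes "m \<ge> 2" "set ws \<subseteq> reflection_vectors m" "\<And>v. v \<in> V_mod m \<Longrightarrow> reflect m ws v = v"
    and pin: "cl m (monomial ws) \<otimes>\<^bsub>Cliff m\<^esub> cl_rev (cl m (monomial ws)) = \<one>\<^bsub>Cliff m\<^esub>"
  shows "cl m (monomial ws) = \<one>\<^bsub>Cliff m\<^esub>"
proof -
  have ws: "set ws \<subseteq> {w \<in> V_mod m. qform m w = 1}"
    using assms(2) reflection_vectors_norm[OF assms(1)] by auto
  then have V: "set ws \<subseteq> V_mod m" by auto
  obtain r where r: "cl m (monomial ws) = cl m (const r)"
    using even_central_monomial[OF V reflect_trivial_even[OF assms(1-3)]]
      monomial_conjugation[OF ws] assms(3) by metis
  have "cl m (const (r * r)) = cl m (const 1)"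
    using pin monomial_Nil unfolding r cl_rev_scalar
    by (simp add: const_carrier mult_single plus_word_def flip: cl_simps(2,4))
  then have "fock_act m (const (r * r)) vacuum {} = fock_act m (const 1) vacuum {}"
    using fock_act_well_defined[OF const_carrier const_carrier] by metis
  then have "r * r = 1" by (simp add: fock_act_single vacuum_def)
  \<comment> \<open>the cross terms cancel in characteristic two\<close>
  then have "(r + 1) * (r + 1) = 0"
    by (simp add: distrib_left distrib_right laurent_2 add.assoc flip: add.assoc[of r r])
  then have "r = 1" using laurent_eqI by simp
  then show ?thesis using r monomial_Nil by (simp add: cl_simps(4))
qed

section \<open>Generators of the group\<close>

lemma yt_carrier: "carrier (yt_group m) = carrier (y_group m) \<times> {0, 1}"
  by (auto simp: yt_group_def semidirect_product_def carrier_integer_mod_group)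

lemma yt_mult:
  "e \<in> {0, 1} \<Longrightarrow> (g, 0) \<otimes>\<^bsub>yt_group m\<^esub> (h, e) = (g \<otimes>\<^bsub>y_group m\<^esub> h, e)"
  "(g, 1) \<otimes>\<^bsub>yt_group m\<^esub> (h, e) = (g \<otimes>\<^bsub>y_group m\<^esub> y_flip h, (1 + e) mod 2)"
  by (auto simp: yt_group_def semidirect_product_def mult_integer_mod_group)

lemma yt_generators_carrier:
  assumes "m \<ge> 2"
  shows "yt_tau m \<in> carrier (yt_group m)" "yt_a m \<in> carrier (yt_group m)"
    and "1 \<le> i \<Longrightarrow> i \<le> m - 1 \<Longrightarrow> yt_stilde m i \<in> carrier (yt_group m)"
proof -
  interpret Y: group "yt_group m" by (rule yt_group_group[OF assms])
  interpret y: group "y_group m" by (rule y_group_group[OF assms])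
  show t: "yt_tau m \<in> carrier (yt_group m)" by (simp add: yt_tau_def yt_carrier)
  show "yt_a m \<in> carrier (yt_group m)"
    using free_a_carrier[of m] by (auto simp: yt_a_def yt_carrier y_group_def FactGroup_def RCOSETS_def)
  assume "1 \<le> i" "i \<le> m - 1"
  then have "free_s m i \<in> carrier (y_free m)" using assms by (intro free_s_carrier) auto
  then have "yt_s m i \<in> carrier (yt_group m)"
    by (auto simp: yt_s_def yt_carrier y_group_def FactGroup_def RCOSETS_def)
  then show "yt_stilde m i \<in> carrier (yt_group m)" using t by (simp add: yt_stilde_def)
qed

text \<open>Longer transpositions arise by conjugating an adjacent one with a shorter one:
  \<open>(a, n + 1) = (a, n) (n, n + 1) (a, n)\<close>.\<close>

lemma permutes_induct_adjacent [consumes 1, case_names id adjacent comp]: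
  fixes m :: nat
  assumes "p permutes {1..m}" "P id"
    and adjacent: "\<And>i. 1 \<le> i \<Longrightarrow> i \<le> m - 1 \<Longrightarrow> P (transpose i (i + 1))"
    and comp: "\<And>p q. p permutes {1..m} \<Longrightarrow> q permutes {1..m} \<Longrightarrow> P p \<Longrightarrow> P q \<Longrightarrow> P (p \<circ> q)"
  shows "P p"
proof -
  have le: "P (transpose a b)" if "1 \<le> a" "a \<le> b" "b \<le> m" for a b
    using that(2,3)
  proof (induction b rule: dec_induct)
    case base
    show ?case using assms(2) by (simp add: id_def)
  next
    case (step n)
    have t: "transpose a n permutes {1..m}" "transpose n (Suc n) permutes {1..m}"
      using step that(1) by (auto intro!: permutes_swap_id)
    show ?case
    proof (cases "a = n")
      case True
      then show ?thesis using adjacent[of n] step that(1) by simp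
    next
      case False
      have "P (transpose a n \<circ> transpose n (Suc n) \<circ> transpose a n)"
        using step that(1) adjacent[of n] by (intro comp t permutes_compose) auto
      then show ?thesis using False step by (simp add: transpose_comp_triple)
    qed
  qed
  have "finite {1..m}" by simp
  with assms(1) show ?thesis
  proof (induction rule: permutes_induct)
    case id
    show ?case by (rule assms(2))
  next
    case (swap a b p)
    then have "P (transpose a b)"
      using le[of a b] le[of b a] by (cases "a \<le> b") (auto simp: transpose_commute)
    then show ?case using swap by (intro comp permutes_swap_id)
  qed
qed

text \<open>Products of the generators exhaust the group without their inverses: \<open>\<tau>\<close> is an involution,
  \<open>s\<^sub>i = \<tau> \<tau>s\<^sub>i\<close>, and \<open>a\<^sup>-\<^sup>1 = \<tau> a \<tau>\<close>.\<close>

lemma yt_induct [consumes 2, case_names tau a stilde mult]: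
  assumes m: "m \<ge> 2" and g: "g \<in> carrier (yt_group m)"
    and tau: "P (yt_tau m)" and a: "P (yt_a m)"
    and stilde: "\<And>i. 1 \<le> i \<Longrightarrow> i \<le> m - 1 \<Longrightarrow> P (yt_stilde m i)"
    and mult: "\<And>g h. g \<in> carrier (yt_group m) \<Longrightarrow> h \<in> carrier (yt_group m) \<Longrightarrow> P g \<Longrightarrow> P h
      \<Longrightarrow> P (g \<otimes>\<^bsub>yt_group m\<^esub> h)"
  shows "P g"
proof -
  interpret Y: group "yt_group m" by (rule yt_group_group[OF m])
  interpret y: group "y_group m" by (rule y_group_group[OF m])
  interpret N: normal "y_kernel m" "y_free m" by (rule y_kernel_normal[OF m])
  let ?L = "lists (fp_letters integer_group (sym_group m))"
  let ?c = "fp_class integer_group (sym_group m)"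
  define emb where "emb w = (y_kernel m #>\<^bsub>y_free m\<^esub> ?c w, 0::int)" for w
  note gen = yt_generators_carrier[OF m]
  have cc: "?c w \<in> carrier (y_free m)" if "w \<in> ?L" for w
    using that unfolding y_free_carrier by (rule imageI)
  have emb_carrier: "emb w \<in> carrier (yt_group m)" if "w \<in> ?L" for w
    using cc[OF that] by (auto simp: emb_def yt_carrier y_group_def FactGroup_def RCOSETS_def)
  have emb_append: "emb (v @ w) = emb v \<otimes>\<^bsub>yt_group m\<^esub> emb w" if "v \<in> ?L" "w \<in> ?L" for v w
    using cc[OF that(1)] cc[OF that(2)]
    by (simp add: emb_def yt_mult y_group_def FactGroup_def N.rcos_sum y_free_mult[OF that])
  have emb_eq: "emb v = emb w" if "fp_eq integer_group (sym_group m) v w" for v w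
    using that fp_class_eq_iff[of v integer_group "sym_group m" w]
      fp_eq_lists[OF group_integer_group sym_group_is_group that] unfolding emb_def by metis
  have tau_tau: "yt_tau m \<otimes>\<^bsub>yt_group m\<^esub> yt_tau m = \<one>\<^bsub>yt_group m\<^esub>"
  proof -
    have "y_flip \<one>\<^bsub>y_group m\<^esub> = \<one>\<^bsub>y_group m\<^esub>"
      using y_flip_hom[OF m] by (intro hom_one) auto
    then show ?thesis
      by (simp add: yt_tau_def yt_mult) (simp add: yt_group_def semidirect_product_def)
  qed
  have tau_cancel: "yt_tau m \<otimes>\<^bsub>yt_group m\<^esub> (yt_tau m \<otimes>\<^bsub>yt_group m\<^esub> x) = x"
    if "x \<in> carrier (yt_group m)" for x
    using that gen(1) tau_tau by (simp flip: Y.m_assoc)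
  have one: "P \<one>\<^bsub>yt_group m\<^esub>" using mult[OF gen(1) gen(1) tau tau] by (simp add: tau_tau)
  have emb_nil: "emb [] = \<one>\<^bsub>yt_group m\<^esub>"
  proof -
    have n: "[] \<in> ?L" by simp
    have "emb [] \<otimes>\<^bsub>yt_group m\<^esub> emb [] = emb []" using emb_append[OF n n] by simp
    then show ?thesis using emb_carrier[OF n] by simp
  qed
  have emb_a: "emb [Inl 1] = yt_a m" by (simp add: emb_def yt_a_def free_a_def)
  have a_inv: "P (emb [Inl (- 1)])"
  proof -
    have "flip_word ` free_a m = ?c [Inl (- 1)]"
      unfolding free_a_def flip_class by (simp add: flip_word_def)
    then have f: "y_flip (y_kernel m #>\<^bsub>y_free m\<^esub> free_a m) = y_kernel m #>\<^bsub>y_free m\<^esub> ?c [Inl (- 1)]"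
      using y_flip_coset[OF m free_a_carrier] by simp
    have "emb [Inl (- 1)] \<in> carrier (yt_group m)"
      by (rule emb_carrier) (auto simp: fp_letters_def)
    then have "yt_tau m \<otimes>\<^bsub>yt_group m\<^esub> yt_a m \<otimes>\<^bsub>yt_group m\<^esub> yt_tau m = emb [Inl (- 1)]"
      using y_flip_hom[OF m] f hom_one[OF y_flip_hom[OF m] y.group_axioms y.group_axioms]
      by (simp add: yt_tau_def yt_a_def yt_mult emb_def yt_carrier)
    then show ?thesis using mult[OF _ gen(1) mult[OF gen(1,2) tau a] tau] gen by simp
  qed
  have "P (emb [Inl k])" for k
  proof (induction k rule: int_induct[where k = 0])
    case base
    have "emb [Inl 0] = emb []"
      using fp_eq.one_left[of "[]" integer_group "sym_group m" "[]"] by (intro emb_eq) simp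
    then show ?case using one emb_nil by simp
  next
    case (step1 i)
    have l: "[Inl i] \<in> ?L" "[Inl 1] \<in> ?L" by (auto simp: fp_letters_def)
    have "emb ([Inl i] @ [Inl 1]) = emb [Inl (i + 1)]"
      using fp_eq.mult_left[of "[]" integer_group "sym_group m" "[]" i 1] by (intro emb_eq) simp
    then show ?case
      using mult[OF emb_carrier[OF l(1)] emb_carrier[OF l(2)] step1(2)] a emb_append[OF l] by (simp add: emb_a)
  next
    case (step2 i)
    have l: "[Inl i] \<in> ?L" "[Inl (- 1)] \<in> ?L" by (auto simp: fp_letters_def)
    have "emb ([Inl i] @ [Inl (- 1)]) = emb [Inl (i - 1)]"
      using fp_eq.mult_left[of "[]" integer_group "sym_group m" "[]" i "- 1"] by (intro emb_eq) simp
    then show ?case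
      using mult[OF emb_carrier[OF l(1)] emb_carrier[OF l(2)] step2(2) a_inv] emb_append[OF l] by simp
  qed
  moreover have "P (emb [Inr p])" if "p permutes {1..m}" for p
    using that
  proof (induction rule: permutes_induct_adjacent)
    case id
    have "emb [Inr id] = emb []"
      using fp_eq.one_right[of "[]" integer_group "sym_group m" "[]"]
      by (intro emb_eq) (simp add: sym_group_one)
    then show ?case using one by (simp only: emb_nil)
  next
    case (adjacent i)
    have s: "yt_s m i = emb [Inr (transpose i (i + 1))]" by (simp add: yt_s_def emb_def free_s_def)
    have "emb [Inr (transpose i (i + 1))] \<in> carrier (yt_group m)"
      using adjacent by (intro emb_carrier) (auto simp: fp_letters_def sym_group_carrier intro!: permutes_swap_id)
    moreover have "P (yt_tau m \<otimes>\<^bsub>yt_group m\<^esub> yt_stilde m i)"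
      using adjacent gen by (intro mult tau stilde) auto
    ultimately show ?case by (simp add: yt_stilde_def s tau_cancel)
  next
    case (comp p q)
    have l: "[Inr p] \<in> ?L" "[Inr q] \<in> ?L" using comp by (auto simp: fp_letters_def sym_group_carrier)
    have "emb ([Inr p] @ [Inr q]) = emb [Inr (p \<circ> q)]"
      using fp_eq.mult_right[of "[]" integer_group "sym_group m" "[]" p q] comp
      by (intro emb_eq) (simp add: sym_group_mult sym_group_carrier)
    then show ?case
      using mult[OF emb_carrier[OF l(1)] emb_carrier[OF l(2)] comp(3,4)] emb_append[OF l] by metis
  qed
  ultimately have letter: "P (emb [l])" if "l \<in> fp_letters integer_group (sym_group m)" for l
    using that by (auto simp: fp_letters_def sym_group_carrier)
  have word: "P (emb w)" if "w \<in> ?L" for w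
    using that
  proof (induction w)
    case Nil
    then show ?case using one emb_nil by simp
  next
    case (Cons l w)
    have l: "[l] \<in> ?L" using Cons by simp
    show ?case
      using mult[OF emb_carrier[OF l] emb_carrier[OF Cons(2)] letter[OF Cons(1)] Cons(3)]
        emb_append[OF l Cons(2)] by simp
  qed
  obtain X e where X: "g = (X, e)" "X \<in> carrier (y_group m)" "e \<in> {0, 1}"
    using g by (auto simp: yt_carrier)
  obtain w where w: "w \<in> ?L" "(X, 0) = emb w"
    using X(2) by (auto simp: y_group_def FactGroup_def RCOSETS_def y_free_carrier emb_def)
  have P0: "P (X, 0)" using word[OF w(1)] w(2) by simp
  have X0: "(X, 0) \<in> carrier (yt_group m)" using emb_carrier[OF w(1)] w(2) by simp
  have "(X, 0) \<otimes>\<^bsub>yt_group m\<^esub> yt_tau m = (X, 1)" using X by (simp add: yt_tau_def yt_mult)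
  then have "P (X, 1)" using mult[OF X0 gen(1) P0 tau] by simp
  then show ?thesis using P0 X by auto
qed

section \<open>The comparison of the two homomorphisms\<close>

lemma refl_map_reflect:
  assumes "qform m w = 1"
  shows "refl_map (V_mod m) (qform m) (bform m) w = (\<lambda>v\<in>V_mod m. reflect m [w] v)"
  by (simp add: refl_map_def reflect_def assms)

lemma refl_map_v1:
  assumes "m \<ge> 2"
  shows "refl_map (V_mod m) (qform m) (bform m) (v_vec 1) = (\<lambda>v\<in>V_mod m. reflect m [smul s_var (v_vec 1)] v)"
proof -
  have "(THE c. t_inv * c = 1) = t_var"
  proof (rule the_equality)
    show "t_inv * t_var = 1" using t_var_t_inv by (simp add: mult.commute)
    fix c assume "t_inv * c = 1"
    then have "t_var * (t_inv * c) = t_var" by simp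
    then show "c = t_var" by (simp add: t_var_t_inv flip: mult.assoc)
  qed
  moreover have "bform m x (smul s_var y) = s_var * bform m x y" for x y
    by (simp add: bform_def smul_lookup sum_distrib_left mult_ac)
  moreover have "smul (s_var * c) (smul s_var y) = smul (c * t_var) y" for c and y :: vec
    by (rule poly_mapping_eqI) (simp add: smul_lookup t_var_def power2_eq_square mult_ac)
  ultimately show ?thesis
    using assms by (simp add: refl_map_def reflect_def qform_values)
qed

lemma GO_mult_reflect:
  assumes "set ws \<subseteq> V_mod m"
  shows "(\<lambda>v\<in>V_mod m. reflect m ws v) \<otimes>\<^bsub>GO (V_mod m) q\<^esub> (\<lambda>v\<in>V_mod m. reflect m ws' v)
    = (\<lambda>v\<in>V_mod m. reflect m (ws @ ws') v)"
  using reflect_V_mod[OF assms]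
  by (auto simp: GO_def compose_def fun_eq_iff restrict_def reflect_append)

theorem proposition3p22:
  fixes m :: nat
    and \<phi> :: "y_word set set \<times> int \<Rightarrow> (vec \<Rightarrow> vec)"
    and \<psi> :: "y_word set set \<times> int \<Rightarrow> (nat, laurent) cliff"
  defines "V \<equiv> V_mod m"
    and "q \<equiv> qform m"
  defines "r \<equiv> refl_map V q (bform m)"
    and "Cl \<equiv> clifford V q"
    and "\<iota> \<equiv> cl_vec V q"
    and "\<pi> \<equiv> pin_map V q"
    and "Y \<equiv> yt_group m"
  assumes "m \<ge> 2"
    and phi_hom: "\<phi> \<in> hom Y (SO V q)"
    and phi_tau: "\<phi> (yt_tau m) = r u_vec"
    and phi_a: "\<phi> (yt_a m) = r u_vec \<otimes>\<^bsub>SO V q\<^esub> r (v_vec 1)"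
    and phi_s: "\<And>i. 1 \<le> i \<Longrightarrow> i \<le> m - 1 \<Longrightarrow> \<phi> (yt_stilde m i) = r (v_vec i + v_vec (i + 1))"
    and psi_hom: "\<psi> \<in> hom Y (Pin V q)"
    and psi_tau: "\<psi> (yt_tau m) = \<iota> u_vec"
    and psi_a: "\<psi> (yt_a m) = cl_scalar V q s_var \<otimes>\<^bsub>Cl\<^esub> \<iota> u_vec \<otimes>\<^bsub>Cl\<^esub> \<iota> (v_vec 1)"
    and psi_s: "\<And>i. 1 \<le> i \<Longrightarrow> i \<le> m - 1 \<Longrightarrow> \<psi> (yt_stilde m i) = \<iota> (v_vec i + v_vec (i + 1))"
  shows "inj_on \<pi> (\<psi> ` carrier Y)
    \<and> (\<forall>g \<in> carrier Y. \<phi> g = \<pi> (\<psi> g))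
    \<and> \<pi> \<in> iso (Pin V q\<lparr>carrier := \<psi> ` carrier Y\<rparr>) (SO V q\<lparr>carrier := \<phi> ` carrier Y\<rparr>)"
proof -
  interpret Y: group Y unfolding Y_def by (rule yt_group_group) fact
  interpret Cl: ring Cl unfolding Cl_def V_def q_def by (rule clifford_ring[OF V_mod_submodule])
  note norm = reflection_vectors_norm[OF \<open>m \<ge> 2\<close>]
  have u: "u_vec \<in> reflection_vectors m" and v1: "smul s_var (v_vec 1) \<in> reflection_vectors m"
    and s: "\<And>i. 1 \<le> i \<Longrightarrow> i \<le> m - 1 \<Longrightarrow> v_vec i + v_vec (i + 1) \<in> reflection_vectors m"
    by (auto simp: reflection_vectors_def)
  have norms: "set ws \<subseteq> {w \<in> V_mod m. qform m w = 1}" if "set ws \<subseteq> reflection_vectors m" for ws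
    using that norm by auto
  have inV: "set ws \<subseteq> V_mod m" if "set ws \<subseteq> reflection_vectors m" for ws
    using that norm by auto
  have r: "r w = (\<lambda>v\<in>V_mod m. reflect m [w] v)" if "w \<in> reflection_vectors m" for w
    unfolding r_def V_def q_def using norm[OF that] by (simp add: refl_map_reflect)
  have \<iota>: "\<iota> w = cl m (monomial [w])" for w
    by (simp add: \<iota>_def V_def q_def cl_of_gen)
  have word: "\<exists>ws. set ws \<subseteq> reflection_vectors m \<and> \<psi> g = cl m (monomial ws)
      \<and> \<phi> g = (\<lambda>v\<in>V_mod m. reflect m ws v)" if g: "g \<in> carrier Y" for g
    using \<open>m \<ge> 2\<close> g[unfolded Y_def]
  proof (induction rule: yt_induct)
    case tau
    then show ?case using u by (intro exI[of _ "[u_vec]"]) (simp add: psi_tau phi_tau r \<iota>)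
  next
    case a
    let ?v = "v_vec 1" and ?w = "smul s_var (v_vec 1)"
    have V: "u_vec \<in> V_mod m" "?v \<in> V_mod m" "?w \<in> V_mod m"
      using norm[OF u] norm[OF v1] v_vec_V_mod[of 1 m] \<open>m \<ge> 2\<close> by (blast, linarith, blast)
    note fc = Free_closed gen_carrier const_carrier V
    have "\<psi> (yt_a m) = cl m (const s_var * gen u_vec * gen ?v)"
      unfolding psi_a Cl_def \<iota>_def V_def q_def by (simp only: cl_simps fc cl_of_gen cl_of_const)
    also have "const s_var * gen u_vec * gen ?v = gen u_vec * (const s_var * gen ?v)"
      by (simp only: const_commute[of s_var "gen u_vec"] mult.assoc)
    also have "cl m \<dots> = cl m (gen u_vec * gen ?w)"
      by (intro cl_cong fc HOL.refl cl_gen_smul[symmetric])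
    also have "\<dots> = cl m (monomial [u_vec, ?w])"
      by (simp only: monomial_append[of "[u_vec]" "[?w]", symmetric] append.simps)
    finally have "\<psi> (yt_a m) = cl m (monomial [u_vec, ?w])" .
    moreover have "\<phi> (yt_a m) = (\<lambda>v\<in>V_mod m. reflect m [u_vec, ?w] v)"
      using GO_mult_reflect[of "[u_vec]" m "qform m" "[?w]"] refl_map_v1[OF \<open>m \<ge> 2\<close>] V
      unfolding phi_a r[OF u] unfolding r_def V_def q_def by simp
    ultimately show ?case using u v1 by (intro exI[of _ "[u_vec, ?w]"]) auto
  next
    case (stilde i)
    then show ?case using s[of i]
      by (intro exI[of _ "[v_vec i + v_vec (i + 1)]"]) (simp add: psi_s phi_s r \<iota>)
  next
    case (mult g h)
    then obtain ws ws' where ws: "set ws \<subseteq> reflection_vectors m" "\<psi> g = cl m (monomial ws)"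
      "\<phi> g = (\<lambda>v\<in>V_mod m. reflect m ws v)" "set ws' \<subseteq> reflection_vectors m" "\<psi> h = cl m (monomial ws')"
      "\<phi> h = (\<lambda>v\<in>V_mod m. reflect m ws' v)" by blast
    have gh: "g \<in> carrier Y" "h \<in> carrier Y" using mult by (simp_all add: Y_def)
    have "\<psi> (g \<otimes>\<^bsub>Y\<^esub> h) = \<psi> g \<otimes>\<^bsub>Cliff m\<^esub> \<psi> h"
      using hom_mult[OF psi_hom gh] by (simp add: Pin_def V_def q_def)
    then have "\<psi> (g \<otimes>\<^bsub>Y\<^esub> h) = cl m (monomial (ws @ ws'))"
      using inV[OF ws(1)] inV[OF ws(4)]
      by (simp add: ws(2,5) monomial_append cl_simps monomial_carrier)
    moreover have "\<phi> (g \<otimes>\<^bsub>Y\<^esub> h) = (\<lambda>v\<in>V_mod m. reflect m (ws @ ws') v)"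
      using hom_mult[OF phi_hom gh] GO_mult_reflect[OF inV[OF ws(1)]] by (simp add: ws(3,6) V_def)
    ultimately show ?case using ws(1,4) by (intro exI[of _ "ws @ ws'"]) (simp add: Y_def)
  qed
  have factor: "\<phi> g = \<pi> (\<psi> g)" if g: "g \<in> carrier Y" for g
  proof -
    obtain ws where ws: "set ws \<subseteq> reflection_vectors m" "\<psi> g = cl m (monomial ws)"
      "\<phi> g = (\<lambda>v\<in>V_mod m. reflect m ws v)" using word[OF g] by blast
    show ?thesis
      by (simp only: ws(2,3) \<pi>_def V_def q_def pin_map_monomial[OF norms[OF ws(1)]])
  qed
  have unit: "\<psi> g \<in> Units Cl" if "g \<in> carrier Y" for g
    using hom_in_carrier[OF psi_hom that] by (auto simp: Pin_def clifford_group_def Cl_def)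
  have psi_mult: "\<psi> (g \<otimes>\<^bsub>Y\<^esub> h) = \<psi> g \<otimes>\<^bsub>Cl\<^esub> \<psi> h" if "g \<in> carrier Y" "h \<in> carrier Y" for g h
    using hom_mult[OF psi_hom that] by (simp add: Pin_def Cl_def)
  have phi_mult: "\<phi> (g \<otimes>\<^bsub>Y\<^esub> h) = \<phi> g \<otimes>\<^bsub>SO V q\<^esub> \<phi> h" if "g \<in> carrier Y" "h \<in> carrier Y" for g h
    by (rule hom_mult[OF phi_hom that])
  have psi_one: "\<psi> \<one>\<^bsub>Y\<^esub> = \<one>\<^bsub>Cl\<^esub>"
    using psi_mult[of "\<one>\<^bsub>Y\<^esub>" "\<one>\<^bsub>Y\<^esub>"] unit[of "\<one>\<^bsub>Y\<^esub>"]
    by (metis Y.one_closed Y.r_one Cl.Units_closed Cl.Units_l_cancel Cl.one_closed Cl.r_one)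
  have phi_one: "\<phi> \<one>\<^bsub>Y\<^esub> = (\<lambda>v\<in>V_mod m. v)"
    using factor[OF Y.one_closed] pin_map_monomial[of "[]" m]
    by (simp add: psi_one monomial_Nil cl_simps(4) \<pi>_def V_def q_def Cl_def reflect_def)
  have kernel: "\<psi> g = \<one>\<^bsub>Cl\<^esub>" if g: "g \<in> carrier Y" "\<phi> g = \<phi> \<one>\<^bsub>Y\<^esub>" for g
  proof -
    obtain ws where ws: "set ws \<subseteq> reflection_vectors m" "\<psi> g = cl m (monomial ws)"
      "\<phi> g = (\<lambda>v\<in>V_mod m. reflect m ws v)" using word[OF g(1)] by blast
    have "reflect m ws v = v" if "v \<in> V_mod m" for v
      using g(2) that unfolding ws(3) phi_one by (metis restrict_apply')
    moreover have "\<psi> g \<otimes>\<^bsub>Cl\<^esub> cl_rev (\<psi> g) = \<one>\<^bsub>Cl\<^esub>"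
      using hom_in_carrier[OF psi_hom g(1)] by (simp add: Pin_def Cl_def)
    ultimately show ?thesis
      using pin_kernel_trivial[OF \<open>m \<ge> 2\<close> ws(1)] by (simp add: ws(2) Cl_def V_def q_def)
  qed
  have inj: "inj_on \<pi> (\<psi> ` carrier Y)"
  proof (rule inj_onI)
    fix c d assume "c \<in> \<psi> ` carrier Y" "d \<in> \<psi> ` carrier Y" and cd: "\<pi> c = \<pi> d"
    then obtain g h where g: "g \<in> carrier Y" "c = \<psi> g" and h: "h \<in> carrier Y" "d = \<psi> h" by blast
    have e: "\<phi> g = \<phi> h" using cd factor g h by simp
    let ?k = "g \<otimes>\<^bsub>Y\<^esub> inv\<^bsub>Y\<^esub> h"
    have "\<phi> ?k = \<phi> h \<otimes>\<^bsub>SO V q\<^esub> \<phi> (inv\<^bsub>Y\<^esub> h)"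
      using e g h by (simp add: phi_mult)
    also have "\<dots> = \<phi> \<one>\<^bsub>Y\<^esub>" using h by (simp flip: phi_mult)
    finally have "\<psi> ?k = \<one>\<^bsub>Cl\<^esub>" using kernel g h by simp
    moreover have "\<psi> g = \<psi> ?k \<otimes>\<^bsub>Cl\<^esub> \<psi> h"
      using g h by (simp add: Y.m_assoc flip: psi_mult)
    ultimately show "c = d" using unit[OF h(1)] by (simp add: g h Cl.Units_closed)
  qed
  have img: "\<pi> ` \<psi> ` carrier Y = \<phi> ` carrier Y"
    using factor by (auto simp: image_image)
  have "\<pi> (\<psi> g \<otimes>\<^bsub>Cl\<^esub> \<psi> h) = \<pi> (\<psi> g) \<otimes>\<^bsub>SO V q\<^esub> \<pi> (\<psi> h)" if "g \<in> carrier Y" "h \<in> carrier Y" for g h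
    using that by (simp add: phi_mult flip: psi_mult factor)
  then have "\<pi> \<in> hom (Pin V q\<lparr>carrier := \<psi> ` carrier Y\<rparr>) (SO V q\<lparr>carrier := \<phi> ` carrier Y\<rparr>)"
    using img by (intro homI) (auto simp: Pin_def Cl_def)
  then have "\<pi> \<in> iso (Pin V q\<lparr>carrier := \<psi> ` carrier Y\<rparr>) (SO V q\<lparr>carrier := \<phi> ` carrier Y\<rparr>)"
    using inj img by (simp add: iso_def bij_betw_def)
  then show ?thesis using inj factor by blast
qed

end
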